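(* Let $a_1,\ldots,a_\ell\colon[c,+\infty)\to\mathbb{R}_+$ be functions from a Hardy field. Suppose that there exists $\delta>0$ such that $t^\delta\prec a_1(t)$ and $(a_{j+1}(t))^\delta\prec a_j(t)\prec(a_{j+1}(t))^{1-\delta}$ for $j=1,\ldots,\ell-1$. Then for all measure preserving actions $T_1^t,\ldots,T_\ell^t$, $t\in\mathbb{R}$, on a probability space $(X,\mathcal{X},\mu)$ (not assumed to commute with each other) and all $f_1,\ldots,f_\ell\in L^\infty(\mu)$, we have $$\lim_{y\to+\infty}\frac1y\int_0^yf_1(T_1^{a_1(t)}x)\cdots f_\ell(T_\ell^{a_\ell(t)}x)\,dt=\tilde f_1(x)\cdots\tilde f_\ell(x)$$ for $\mu$-almost every $x\in X$, where for $j=1,\ldots,\ell$ we denote by $\tilde f_j$ the orthogonal projection of $f_j$ on the space of functions in $L^2(\mu)$ that are $T_j^t$-invariant for every $t\in\mathbb{R}$.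
   Context: $\mathbb{R}_+$ is the set of non-negative reals. A measure preserving action (flow) on $(X,\mathcal{X},\mu)$ is a family $T^t$, $t\in\mathbb{R}$, of invertible measure preserving transformations with $T^{s+t}=T^s\circ T^t$, $T^0=\mathrm{id}$, such that the map $(t,x)\mapsto T^tx$ from $\mathbb{R}\times X$ to $X$ is measurable. For functions $a,b$, $a(t)\prec b(t)$ means $\lim_{t\to+\infty}a(t)/b(t)=0$. Let $B$ be the ring of equivalence classes of real valued functions defined on half lines $[c,+\infty)$, two functions being identified if they agree eventually. A Hardy field is a subfield of $(B,+,\cdot)$ closed under differentiation. Statements about elements of a Hardy field concern only sufficiently large $t$; in particular the values of $a_j(t)$ for bounded $t$ (e.g. on $[0,c]$) play no role in the limit.
   Formalization: The formal theorem also assumes δ < 1; for δ > 1 and ℓ ≥ 2 the hypotheses force a_2(t) → 0 and the claim fails (e.g. δ = 2, a_1 = t^3, a_2 = t^{-10}), while for ℓ = 1 any δ ≥ 1 may be replaced by 1/2. *)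

theory Defs
  imports "HOL-Probability.Probability"
begin

section \<open>Hardy fields\<close>

text \<open>
  A real valued function on a half line \<open>[c, \<infinity>)\<close> is represented by any total function that
  agrees with it there; the values outside the half line are lost in the quotient.
\<close>

definition eventually_equal :: "(real \<Rightarrow> real) \<Rightarrow> (real \<Rightarrow> real) \<Rightarrow> bool"
  where "eventually_equal f g \<longleftrightarrow> (\<forall>\<^sub>F t in at_top. f t = g t)"

lemma equivp_eventually_equal: "equivp eventually_equal"
proof (rule equivpI)
  show "reflp eventually_equal"
    by (simp add: reflp_def eventually_equal_def)
  show "symp eventually_equal"
    by (simp add: symp_def eventually_equal_def eq_commute)
  show "transp eventually_equal"
    unfolding transp_def eventually_equal_def by (auto elim: eventually_elim2)
qed

quotient_type germ = "real \<Rightarrow> real" / eventually_equal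
  morphisms rep_germ germ_of
  by (rule equivp_eventually_equal)

instantiation germ :: comm_ring_1
begin

lift_definition zero_germ :: germ is "\<lambda>_. 0" .

lift_definition one_germ :: germ is "\<lambda>_. 1" .

lift_definition plus_germ :: "germ \<Rightarrow> germ \<Rightarrow> germ" is "\<lambda>f g t. f t + g t"
  unfolding eventually_equal_def by (auto elim: eventually_elim2)

lift_definition minus_germ :: "germ \<Rightarrow> germ \<Rightarrow> germ" is "\<lambda>f g t. f t - g t"
  unfolding eventually_equal_def by (auto elim: eventually_elim2)

lift_definition uminus_germ :: "germ \<Rightarrow> germ" is "\<lambda>f t. - f t"
  unfolding eventually_equal_def by (auto elim: eventually_mono)

lift_definition times_germ :: "germ \<Rightarrow> germ \<Rightarrow> germ" is "\<lambda>f g t. f t * g t"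
  unfolding eventually_equal_def by (auto elim: eventually_elim2)

instance
proof
  show "(0::germ) \<noteq> 1"
    by transfer (simp add: eventually_equal_def)
qed (transfer; simp add: eventually_equal_def algebra_simps)+

end

lemma eventually_equal_has_real_derivative:
  assumes "eventually_equal f f'" "eventually_equal g g'"
    and "\<forall>\<^sub>F t in at_top. (f has_real_derivative g t) (at t)"
  shows "\<forall>\<^sub>F t in at_top. (f' has_real_derivative g' t) (at t)"
proof -
  obtain N where N: "\<And>t. t \<ge> N \<Longrightarrow> f t = f' t"
    using assms(1) unfolding eventually_equal_def eventually_at_top_linorder by blast
  have "\<forall>\<^sub>F t in at_top. t > N" by (rule eventually_gt_at_top)
  then show ?thesis
    using assms(2,3) unfolding eventually_equal_def
  proof eventually_elim
    case (elim t)
    then have "(f has_real_derivative g' t) (at t)" by simp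
    moreover have "\<forall>\<^sub>F s in nhds t. f s = f' s"
      using eventually_nhds_in_open[of "{N<..}" t] elim(1) N
      by (auto elim!: eventually_mono)
    ultimately show ?case
      using DERIV_cong_ev[OF refl] by blast
  qed
qed

lift_definition has_germ_derivative :: "germ \<Rightarrow> germ \<Rightarrow> bool"
  is "\<lambda>f g. \<forall>\<^sub>F t in at_top. (f has_real_derivative g t) (at t)"
proof -
  fix f f' g g' :: "real \<Rightarrow> real"
  assume *: "eventually_equal f f'" "eventually_equal g g'"
  then have "eventually_equal f' f" "eventually_equal g' g"
    using equivp_symp[OF equivp_eventually_equal] by blast+
  with * show "(\<forall>\<^sub>F t in at_top. (f has_real_derivative g t) (at t)) =
      (\<forall>\<^sub>F t in at_top. (f' has_real_derivative g' t) (at t))"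
    using eventually_equal_has_real_derivative by blast
qed

definition subfield_of_germs :: "germ set \<Rightarrow> bool"
  where "subfield_of_germs H \<longleftrightarrow>
    0 \<in> H \<and> 1 \<in> H \<and>
    (\<forall>f\<in>H. \<forall>g\<in>H. f - g \<in> H \<and> f * g \<in> H) \<and>
    (\<forall>f\<in>H. f \<noteq> 0 \<longrightarrow> (\<exists>g\<in>H. f * g = 1))"

definition hardy_field :: "germ set \<Rightarrow> bool"
  where "hardy_field H \<longleftrightarrow>
    subfield_of_germs H \<and> (\<forall>f\<in>H. \<exists>g\<in>H. has_germ_derivative f g)"

text \<open>
  The first conjunct says that the quotient is eventually defined. It cannot be dropped:
  since \<open>x / 0 = 0\<close> in HOL, every function would otherwise be negligible with respect to \<open>0\<close>.
\<close>

definition negligible_wrt :: "(real \<Rightarrow> real) \<Rightarrow> (real \<Rightarrow> real) \<Rightarrow> bool" (infix "\<prec>" 50)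
  where "a \<prec> b \<longleftrightarrow>
    (\<forall>\<^sub>F t in at_top. b t \<noteq> 0) \<and> ((\<lambda>t. a t / b t) \<longlongrightarrow> 0) at_top"

text \<open>
  A function in a Hardy field may be wild on a bounded set, but it always has a Borel measurable
  representative on the whole line.
\<close>

lemma hardy_field_borel_representative:
  assumes "hardy_field H" "germ_of a \<in> H"
  shows "\<exists>b. b \<in> borel_measurable borel \<and> (\<forall>\<^sub>F t in at_top. b t = a t)"
proof -
  obtain g where "has_germ_derivative (germ_of a) g"
    using assms unfolding hardy_field_def by blast
  then have "\<forall>\<^sub>F t in at_top. (a has_real_derivative rep_germ g t) (at t)"
    using Quotient3_abs_rep[OF Quotient3_germ, of g] has_germ_derivative.abs_eq by metis
  then obtain N where N: "\<And>t. t \<ge> N \<Longrightarrow> (a has_real_derivative rep_germ g t) (at t)"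
    unfolding eventually_at_top_linorder by blast
  have "continuous_on {N..} a"
    by (intro continuous_at_imp_continuous_on ballI) (auto intro: N DERIV_isCont)
  then have "(\<lambda>t. if t \<in> {N..} then a t else 0) \<in> borel_measurable borel"
    by (intro borel_measurable_continuous_on_if) auto
  moreover have "\<forall>\<^sub>F t in at_top. (if t \<in> {N..} then a t else 0) = a t"
    using eventually_ge_at_top[of N] by eventually_elim simp
  ultimately show ?thesis by blast
qed


section \<open>Measure preserving flows\<close>

text \<open>Each \<open>T t\<close> is invertible, with measurable inverse \<open>T (- t)\<close>, by the group law.\<close>

definition measure_preserving_flow :: "'a measure \<Rightarrow> (real \<Rightarrow> 'a \<Rightarrow> 'a) \<Rightarrow> bool"
  where "measure_preserving_flow M T \<longleftrightarrow>
    (\<forall>t. T t \<in> measurable M M \<and> distr M M (T t) = M) \<and>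
    (\<forall>s t. \<forall>x\<in>space M. T (s + t) x = T s (T t x)) \<and>
    (\<forall>x\<in>space M. T 0 x = x) \<and>
    (\<lambda>(t, x). T t x) \<in> measurable (borel \<Otimes>\<^sub>M M) M"


section \<open>Function spaces\<close>

text \<open>
  Elements of \<open>L\<^sup>\<infinity>\<close> and \<open>L\<^sup>2\<close> are represented by measurable functions; the classes modulo
  almost everywhere equality are not formed.
\<close>

definition L_infinity :: "'a measure \<Rightarrow> ('a \<Rightarrow> complex) set"
  where "L_infinity M = {f \<in> borel_measurable M. \<exists>C. AE x in M. norm (f x) \<le> C}"

definition L_two :: "'a measure \<Rightarrow> ('a \<Rightarrow> complex) set"
  where "L_two M = {f \<in> borel_measurable M. integrable M (\<lambda>x. (norm (f x))\<^sup>2)}"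

definition L_two_invariant :: "'a measure \<Rightarrow> (real \<Rightarrow> 'a \<Rightarrow> 'a) \<Rightarrow> ('a \<Rightarrow> complex) set"
  where "L_two_invariant M T = {g \<in> L_two M. \<forall>t. AE x in M. g (T t x) = g x}"

text \<open>
  \<open>p\<close> is (a representative of) the orthogonal projection of \<open>f\<close> on the subspace \<open>V\<close> of \<open>L\<^sup>2\<close>.
\<close>

definition is_orthogonal_projection ::
    "'a measure \<Rightarrow> ('a \<Rightarrow> complex) set \<Rightarrow> ('a \<Rightarrow> complex) \<Rightarrow> ('a \<Rightarrow> complex) \<Rightarrow> bool"
  where "is_orthogonal_projection M V f p \<longleftrightarrow>
    p \<in> V \<and> (\<forall>h\<in>V. (\<integral>x. (f x - p x) * cnj (h x) \<partial>M) = 0)"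

end

(*
  If a Hardy field function b dominates a power of t, then b(t) = O(t b'(t)), 1 / (t b'(t)) tends to 0
  and 1 / b' is eventually monotone. Hence averages of g(b(t)) are bounded by a constant times averages
  of g, so that each f_j may be replaced along almost every orbit by a function that is close to it on
  average. Replace the slower factors by ones that are C^1 along the flow (double averages over short
  windows), and the fastest one by its mean plus an oscillating part with bounded primitive, namely the
  difference between a function and its long window averages. Integrating by parts against b_l, the
  oscillating part contributes nothing, because b_j'/b_l' tends to 0 for j < l; now induct on l. The
  approximations exist by Birkhoff's theorem, and their errors are small on average along almost every
  orbit, again by Birkhoff's theorem.
*)
theory Submission
  imports Defs "HOL-Real_Asymp.Real_Asymp"
begin

section \<open>Growth of functions in a Hardy field\<close>

text \<open>A Hardy field need not contain the real constants, \<open>t\<close> or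
  \<open>ln t\<close>, so growth is obtained by comparing a derivative in the field with a rational
  and integrating the comparison. The \<open>f j\<close> are merely measurable, so no approximation
  is uniform: errors are small only on average over \<open>[0, S]\<close>, and a transfer inequality
  whose constant does not depend on the error keeps them small along \<open>b j\<close>. This
  separates the problem into two sides: \<open>time_change\<close> collects what is used about the
  times, \<open>regular_orbit\<close> what is used about one orbit. The limit theorem joining them
  concerns fixed functions of a real variable, and the flows meet only when finitely many sets of
  full measure are intersected. Monotonicity of \<open>1 / b'\<close> bounds its total variation by
  its end values, so the term with the second derivative in the integration by parts is integrated
  exactly. The projections enter as Birkhoff limits, which have the same inner products with
  invariant functions as the \<open>f j\<close>.\<close>

lemma germ_of_eq_iff: "germ_of f = germ_of g \<longleftrightarrow> (\<forall>\<^sub>F t in at_top. f t = g t)"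
  unfolding germ.abs_eq_iff eventually_equal_def ..

section \<open>Field operations, constants and signs of germs\<close>

lemma hardy_field_diff:
  assumes "hardy_field H" "germ_of f \<in> H" "germ_of g \<in> H"
  shows "germ_of (\<lambda>t. f t - g t) \<in> H"
  using assms unfolding hardy_field_def subfield_of_germs_def
  by (metis minus_germ.abs_eq)

lemma hardy_field_mult:
  assumes "hardy_field H" "germ_of f \<in> H" "germ_of g \<in> H"
  shows "germ_of (\<lambda>t. f t * g t) \<in> H"
  using assms unfolding hardy_field_def subfield_of_germs_def
  by (metis times_germ.abs_eq)

lemma hardy_field_inverse_exists:
  assumes "hardy_field H" "germ_of f \<in> H" "\<not> (\<forall>\<^sub>F t in at_top. f t = 0)"
  obtains g where "germ_of g \<in> H" "\<forall>\<^sub>F t in at_top. f t * g t = 1"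
proof -
  have "germ_of f \<noteq> 0"
    using assms(3) by (simp add: zero_germ.abs_eq germ_of_eq_iff)
  then obtain G where G: "G \<in> H" "germ_of f * G = 1"
    using assms unfolding hardy_field_def subfield_of_germs_def by blast
  obtain g where g: "G = germ_of g"
    by (metis Quotient3_abs_rep[OF Quotient3_germ])
  have "\<forall>\<^sub>F t in at_top. f t * g t = 1"
    using G(2) by (simp add: g times_germ.abs_eq one_germ.abs_eq germ_of_eq_iff)
  with G g show ?thesis using that by blast
qed

lemma hardy_field_inverse:
  assumes "hardy_field H" "germ_of f \<in> H" "\<forall>\<^sub>F t in at_top. f t \<noteq> 0"
  shows "germ_of (\<lambda>t. 1 / f t) \<in> H"
proof -
  have "\<not> (\<forall>\<^sub>F t in at_top. f t = 0)"
  proof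
    assume "\<forall>\<^sub>F t in at_top. f t = 0"
    with assms(3) have "\<forall>\<^sub>F t::real in at_top. False" by eventually_elim simp
    then show False by simp
  qed
  then obtain g where g: "germ_of g \<in> H" "\<forall>\<^sub>F t in at_top. f t * g t = 1"
    using hardy_field_inverse_exists[OF assms(1,2)] by blast
  have "\<forall>\<^sub>F t in at_top. 1 / f t = g t"
    using g(2) assms(3) by eventually_elim (simp add: field_simps)
  then show ?thesis using g(1) by (metis germ_of_eq_iff)
qed

lemma hardy_field_derivative:
  assumes "hardy_field H" "germ_of f \<in> H"
  obtains f' where "germ_of f' \<in> H" "\<forall>\<^sub>F t in at_top. (f has_real_derivative f' t) (at t)"
proof -
  obtain G where G: "G \<in> H" "has_germ_derivative (germ_of f) G"
    using assms unfolding hardy_field_def by blast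
  obtain g where g: "G = germ_of g"
    by (metis Quotient3_abs_rep[OF Quotient3_germ])
  show ?thesis using that[of g] G by (simp add: g has_germ_derivative.abs_eq)
qed

text \<open>Constants of this kind and their reciprocals are the thresholds in the comparisons
  below; an arbitrary real constant need not belong to \<open>H\<close>.\<close>

lemma hardy_field_of_nat:
  assumes "hardy_field H"
  shows "germ_of (\<lambda>_. real n) \<in> H"
proof (induction n)
  case 0
  then show ?case using assms
    by (simp add: zero_germ.abs_eq[symmetric] hardy_field_def subfield_of_germs_def)
next
  case (Suc n)
  have one: "germ_of (\<lambda>_. 1) \<in> H"
    using assms by (simp add: one_germ.abs_eq[symmetric] hardy_field_def subfield_of_germs_def)
  have "germ_of (\<lambda>_. 0) \<in> H"
    using assms by (simp add: zero_germ.abs_eq[symmetric] hardy_field_def subfield_of_germs_def)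
  \<comment> \<open>Closure is postulated for differences, so adding 1 means subtracting
    \<open>0 - 1\<close>.\<close>
  from hardy_field_diff[OF assms this one] have "germ_of (\<lambda>_. 0 - 1) \<in> H" .
  from hardy_field_diff[OF assms Suc this] show ?case
    by (simp add: add.commute)
qed

lemma hardy_field_inverse_of_nat:
  assumes "hardy_field H"
  shows "germ_of (\<lambda>_. 1 / real (Suc n)) \<in> H"
  by (rule hardy_field_inverse[OF assms hardy_field_of_nat[OF assms]]) simp

text \<open>A germ other than 0 is invertible, so a representative eventually has no zero; a
  derivative makes it continuous there, and the intermediate value theorem fixes the sign.\<close>

lemma hardy_field_eventually_sign:
  assumes H: "hardy_field H" and f: "germ_of f \<in> H"
  shows "(\<forall>\<^sub>F t in at_top. f t = 0) \<or> (\<forall>\<^sub>F t in at_top. f t > 0) \<or> (\<forall>\<^sub>F t in at_top. f t < 0)"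
proof (cases "\<forall>\<^sub>F t in at_top. f t = 0")
  case False
  then obtain g where "\<forall>\<^sub>F t in at_top. f t * g t = 1"
    using hardy_field_inverse_exists[OF H f] by blast
  then have ne: "\<forall>\<^sub>F t in at_top. f t \<noteq> 0"
    by eventually_elim auto
  obtain f' where "\<forall>\<^sub>F t in at_top. (f has_real_derivative f' t) (at t)"
    using hardy_field_derivative[OF H f] by blast
  with ne have "\<forall>\<^sub>F t in at_top. f t \<noteq> 0 \<and> isCont f t"
    by eventually_elim (auto intro: DERIV_isCont)
  then obtain N where N: "\<And>t. t \<ge> N \<Longrightarrow> f t \<noteq> 0" "\<And>t. t \<ge> N \<Longrightarrow> isCont f t"
    unfolding eventually_at_top_linorder by blast
  have conn: "connected (f ` {N..})"
    by (intro connected_continuous_image continuous_at_imp_continuous_on) (auto intro: N)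
  have "(\<forall>t\<ge>N. f t > 0) \<or> (\<forall>t\<ge>N. f t < 0)"
  proof (rule ccontr)
    assume "\<not> ?thesis"
    then obtain s t where "s \<ge> N" "t \<ge> N" "f s < 0" "f t > 0"
      using N(1) by (metis linorder_neqE_linordered_idom)
    then have "0 \<in> f ` {N..}"
      using connectedD_interval[OF conn, of "f s" "f t" 0] by auto
    then show False using N(1) by force
  qed
  then show ?thesis unfolding eventually_at_top_linorder by blast
qed auto

lemma hardy_field_eventually_compare:
  assumes H: "hardy_field H" and "germ_of f \<in> H" "germ_of g \<in> H"
  shows "(\<forall>\<^sub>F t in at_top. f t \<ge> g t) \<or> (\<forall>\<^sub>F t in at_top. f t < g t)"
proof -
  from hardy_field_eventually_sign[OF H hardy_field_diff[OF assms]]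
  show ?thesis by (auto elim: eventually_mono)
qed

section \<open>Growth from comparisons of derivatives\<close>

text \<open>\<open>C\<close> is the value of \<open>f - g\<close> at a point from which all three
  conditions hold. Neither function has to lie in the Hardy field, so \<open>t\<close> and
  \<open>ln t\<close> can serve as comparison functions.\<close>

lemma eventually_le_of_derivative_le:
  fixes f g :: "real \<Rightarrow> real"
  assumes "\<forall>\<^sub>F t in at_top. (f has_real_derivative f' t) (at t)"
    and "\<forall>\<^sub>F t in at_top. (g has_real_derivative g' t) (at t)"
    and "\<forall>\<^sub>F t in at_top. f' t \<le> g' t"
  obtains C where "\<forall>\<^sub>F t in at_top. f t \<le> g t + C"
proof -
  have "\<forall>\<^sub>F t in at_top. (f has_real_derivative f' t) (at t) \<and>
      (g has_real_derivative g' t) (at t) \<and> f' t \<le> g' t"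
    using assms by eventually_elim simp
  then obtain N where N: "\<And>t. t \<ge> N \<Longrightarrow> (f has_real_derivative f' t) (at t)"
      "\<And>t. t \<ge> N \<Longrightarrow> (g has_real_derivative g' t) (at t)" "\<And>t. t \<ge> N \<Longrightarrow> f' t \<le> g' t"
    unfolding eventually_at_top_linorder by blast
  have "f t \<le> g t + (f N - g N)" if "t \<ge> N" for t
  proof -
    have "g N - f N \<le> g t - f t"
      by (rule DERIV_nonneg_imp_nondecreasing[OF that])
        (metis N DERIV_diff diff_ge_0_iff_ge)
    then show ?thesis by simp
  qed
  then show ?thesis using that unfolding eventually_at_top_linorder by blast
qed

text \<open>The interface between Hardy fields and averaging. The sign of \<open>b''\<close> makes
  \<open>1 / b'\<close> eventually monotone; the limit of \<open>1 / (t * b' t)\<close> makes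
  boundary terms of an integration by parts negligible against \<open>t\<close>; and
  \<open>b t \<le> C * (t * b' t)\<close> compares a bound proportional to the distance
  \<open>b y\<close> run along the orbit with one proportional to the time \<open>y\<close>.\<close>

definition time_change :: "(real \<Rightarrow> real) \<Rightarrow> (real \<Rightarrow> real) \<Rightarrow> bool"
  where "time_change b b' \<longleftrightarrow>
    (\<exists>b''. (\<forall>\<^sub>F t in at_top. (b has_real_derivative b' t) (at t) \<and>
        (b' has_real_derivative b'' t) (at t) \<and> b' t > 0) \<and>
      ((\<forall>\<^sub>F t in at_top. b'' t \<ge> 0) \<or> (\<forall>\<^sub>F t in at_top. b'' t \<le> 0))) \<and>
    filterlim b at_top at_top \<and>
    ((\<lambda>t. 1 / (t * b' t)) \<longlongrightarrow> 0) at_top \<and>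
    (\<exists>C>0. \<forall>\<^sub>F t in at_top. b t \<le> C * (t * b' t))"

lemma not_eventually_conflict:
  assumes "\<forall>\<^sub>F t::real in at_top. P t" "\<forall>\<^sub>F t in at_top. \<not> P t"
  shows False
proof -
  have "\<forall>\<^sub>F t::real in at_top. False"
    using assms by eventually_elim simp
  then show False by simp
qed

text \<open>
  The three asymptotic bounds come from comparing \<open>1 / b'\<close> and \<open>b / b'\<close> with linear functions:
  their derivatives lie in the Hardy field and so are eventually comparable with rationals, and a
  wrong comparison integrates to \<open>b\<close> growing at most like \<open>ln t\<close> or a power below \<open>t\<^sup>\<delta>\<close>.
\<close>

lemma hardy_field_time_change:
  assumes H: "hardy_field H" and b: "germ_of b \<in> H"
    and \<delta>: "0 < \<delta>" and grow: "filterlim (\<lambda>t. b t / t powr \<delta>) at_top at_top"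
  obtains b' where "germ_of b' \<in> H" "time_change b b'"
proof -
  have big: "\<forall>\<^sub>F t in at_top. b t \<ge> K * t powr \<delta>" for K
    using filterlim_at_top[THEN iffD1, OF grow, rule_format, of K] eventually_gt_at_top[of 0]
    by eventually_elim (simp add: field_simps)
  have lim: "filterlim b at_top at_top"
  proof (rule filterlim_at_top_mono[of "\<lambda>t. t powr \<delta>"])
    show "filterlim (\<lambda>t. t powr \<delta>) at_top at_top"
      using \<delta> by real_asymp
    show "\<forall>\<^sub>F t in at_top. t powr \<delta> \<le> b t" using big[of 1] by simp
  qed
  obtain b' where b': "germ_of b' \<in> H" "\<forall>\<^sub>F t in at_top. (b has_real_derivative b' t) (at t)"
    using hardy_field_derivative[OF H b] by blast
  obtain b'' where b'': "germ_of b'' \<in> H" "\<forall>\<^sub>F t in at_top. (b' has_real_derivative b'' t) (at t)"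
    using hardy_field_derivative[OF H b'(1)] by blast
  have pos: "\<forall>\<^sub>F t in at_top. b' t > 0"
  proof (rule ccontr)
    assume "\<not> ?thesis"
    then have "(\<forall>\<^sub>F t in at_top. b' t = 0) \<or> (\<forall>\<^sub>F t in at_top. b' t < 0)"
      using hardy_field_eventually_sign[OF H b'(1)] by blast
    then have "\<forall>\<^sub>F t in at_top. b' t \<le> 0" by (auto elim: eventually_mono)
    moreover have "\<forall>\<^sub>F t in at_top. ((\<lambda>_. 0) has_real_derivative 0) (at (t::real))" by simp
    ultimately obtain C where C: "\<forall>\<^sub>F t in at_top. b t \<le> 0 + C"
      using eventually_le_of_derivative_le[of b b' "\<lambda>_. 0" "\<lambda>_. 0"] b'(2) by blast
    have "\<forall>\<^sub>F t in at_top. b t > C"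
      using lim by (simp add: filterlim_at_top_dense)
    then have "\<forall>\<^sub>F t in at_top. \<not> b t \<le> 0 + C" by eventually_elim simp
    then show False using not_eventually_conflict[OF C] by blast
  qed
  have "germ_of (\<lambda>t. 1 / b' t) \<in> H"
    by (rule hardy_field_inverse[OF H b'(1)]) (use pos in eventually_elim, simp)
  note \<phi> = this
  obtain \<phi>' where \<phi>': "germ_of \<phi>' \<in> H"
      "\<forall>\<^sub>F t in at_top. ((\<lambda>t. 1 / b' t) has_real_derivative \<phi>' t) (at t)"
    using hardy_field_derivative[OF H \<phi>] by blast
  have small: "\<forall>\<^sub>F t in at_top. 1 / (t * b' t) < e" if "e > 0" for e
  proof -
    obtain n where n: "1 / real (Suc n) < e"
      using \<open>e > 0\<close> nat_approx_posE by blast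
    define q where "q = 1 / real (Suc n)"
    have q: "0 < q" "q < e" using n by (auto simp: q_def)
    have lin: "\<forall>\<^sub>F t in at_top. ((\<lambda>t. q * t) has_real_derivative q) (at t)"
      by (intro always_eventually allI) (auto intro!: derivative_eq_intros)
    have "germ_of (\<lambda>_. q) \<in> H"
      unfolding q_def by (rule hardy_field_inverse_of_nat[OF H])
    from hardy_field_eventually_compare[OF H \<phi>'(1) this]
    show ?thesis
    proof
      assume "\<forall>\<^sub>F t in at_top. \<phi>' t < q"
      then have "\<forall>\<^sub>F t in at_top. \<phi>' t \<le> q" by eventually_elim simp
      then obtain C where C: "\<forall>\<^sub>F t in at_top. 1 / b' t \<le> q * t + C"
        using eventually_le_of_derivative_le[OF \<phi>'(2) lin] by blast
      have "\<forall>\<^sub>F t in at_top. t > \<bar>C\<bar> / (e - q)" by (rule eventually_gt_at_top)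
      with C eventually_gt_at_top[of 0] pos show ?thesis
      proof eventually_elim
        case (elim t)
        have "C < (e - q) * t" using elim(4) q by (simp add: field_simps abs_if split: if_splits)
        then have "1 / b' t < e * t" using elim(1) by (simp add: algebra_simps)
        then show ?case using elim(2,3) by (simp add: field_simps)
      qed
    next
      assume "\<forall>\<^sub>F t in at_top. q \<le> \<phi>' t"
      then obtain C where C: "\<forall>\<^sub>F t in at_top. q * t \<le> 1 / b' t + C"
        using eventually_le_of_derivative_le[OF lin \<phi>'(2)] by blast
      \<comment> \<open>Past this point \<open>C\<close> is at most half of \<open>q * t\<close>,
        hence the factor 2 in the bound for \<open>b'\<close>.\<close>
      have "\<forall>\<^sub>F t in at_top. t > 2 * \<bar>C\<bar> / q" by (rule eventually_gt_at_top)
      with C eventually_gt_at_top[of 0] pos have le: "\<forall>\<^sub>F t in at_top. b' t \<le> (2 / q) * (1 / t)"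
      proof eventually_elim
        case (elim t)
        have "C \<le> q * t / 2" using elim(4) q by (simp add: field_simps abs_if split: if_splits)
        then have "q * t / 2 \<le> 1 / b' t" using elim(1) by (simp add: algebra_simps)
        then show ?case using elim(2,3) q by (simp add: field_simps)
      qed
      have "\<forall>\<^sub>F t in at_top. ((\<lambda>t. (2 / q) * ln t) has_real_derivative (2 / q) * (1 / t)) (at t)"
        using eventually_gt_at_top[of 0]
        by eventually_elim (use q in \<open>auto intro!: derivative_eq_intros\<close>)
      then obtain C where C: "\<forall>\<^sub>F t in at_top. b t \<le> (2 / q) * ln t + C"
        using eventually_le_of_derivative_le[OF b'(2) _ le] by blast
      have "\<forall>\<^sub>F t in at_top. (2 / q) * ln t + C < t powr \<delta>"
        using \<delta> by real_asymp
      with big[of 1] have "\<forall>\<^sub>F t in at_top. \<not> b t \<le> (2 / q) * ln t + C"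
        by eventually_elim simp
      then show ?thesis using not_eventually_conflict[OF C] by blast
    qed
  qed
  have lim0: "((\<lambda>t. 1 / (t * b' t)) \<longlongrightarrow> 0) at_top"
  proof (rule order_tendstoI)
    show "\<forall>\<^sub>F t in at_top. a < 1 / (t * b' t)" if "a < 0" for a
      using pos eventually_gt_at_top[of 0]
    proof eventually_elim
      case (elim t)
      then have "0 < 1 / (t * b' t)" by simp
      then show ?case using that by linarith
    qed
  qed (use small in auto)
  have \<psi>: "germ_of (\<lambda>t. b t * (1 / b' t)) \<in> H"
    by (rule hardy_field_mult[OF H b \<phi>])
  obtain \<psi>' where \<psi>': "germ_of \<psi>' \<in> H"
      "\<forall>\<^sub>F t in at_top. ((\<lambda>t. b t * (1 / b' t)) has_real_derivative \<psi>' t) (at t)"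
    using hardy_field_derivative[OF H \<psi>] by blast
  have "\<exists>C>0. \<forall>\<^sub>F t in at_top. b t \<le> C * (t * b' t)"
  proof -
    \<comment> \<open>With \<open>1 / q < \<delta>\<close> the wrong comparison gives
      \<open>b' / b \<le> 1 / (q * t - C)\<close>, hence \<open>ln b\<close> at most
      \<open>(1 / q) * ln t\<close> up to a constant, against the growth of \<open>b\<close> above
      \<open>t powr \<delta>\<close>.\<close>
    obtain n where n: "real n > 1 / \<delta>" using reals_Archimedean2 by blast
    define q where "q = real n"
    have q: "0 < q" "1 / q < \<delta>" 
    proof -
      show "0 < q" using n \<delta> unfolding q_def by (rule_tac less_trans[of 0 "1 / \<delta>"]) auto
      then show "1 / q < \<delta>" using n \<delta> by (simp add: q_def field_simps)
    qed
    have lin: "\<forall>\<^sub>F t in at_top. ((\<lambda>t. q * t) has_real_derivative q) (at t)"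
      by (intro always_eventually allI) (auto intro!: derivative_eq_intros)
    have "germ_of (\<lambda>_. q) \<in> H"
      unfolding q_def by (rule hardy_field_of_nat[OF H])
    from hardy_field_eventually_compare[OF H \<psi>'(1) this]
    show ?thesis
    proof
      assume "\<forall>\<^sub>F t in at_top. \<psi>' t < q"
      then have "\<forall>\<^sub>F t in at_top. \<psi>' t \<le> q" by eventually_elim simp
      then obtain C where C: "\<forall>\<^sub>F t in at_top. b t * (1 / b' t) \<le> q * t + C"
        using eventually_le_of_derivative_le[OF \<psi>'(2) lin] by blast
      have "\<forall>\<^sub>F t in at_top. t > \<bar>C\<bar>" by (rule eventually_gt_at_top)
      with C pos have "\<forall>\<^sub>F t in at_top. b t \<le> (q + 1) * (t * b' t)"
      proof eventually_elim
        case (elim t)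
        then have "b t * (1 / b' t) \<le> (q + 1) * t" by (simp add: algebra_simps)
        then show ?case using elim(2) by (simp add: field_simps)
      qed
      moreover have "q + 1 > 0" using q by simp
      ultimately show ?thesis by blast
    next
      assume "\<forall>\<^sub>F t in at_top. q \<le> \<psi>' t"
      then obtain C where C: "\<forall>\<^sub>F t in at_top. q * t \<le> b t * (1 / b' t) + C"
        using eventually_le_of_derivative_le[OF lin \<psi>'(2)] by blast
      have bpos: "\<forall>\<^sub>F t in at_top. b t > 0"
        using lim by (simp add: filterlim_at_top_dense)
      have "\<forall>\<^sub>F t in at_top. t > \<bar>C\<bar> / q" by (rule eventually_gt_at_top)
      with C pos bpos have le: "\<forall>\<^sub>F t in at_top. b' t / b t \<le> 1 / (q * t - C)"
      proof eventually_elim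
        case (elim t)
        have "C < q * t" using elim(4) q by (simp add: field_simps abs_if split: if_splits)
        then have "q * t - C > 0" by simp
        moreover have "q * t - C \<le> b t / b' t" using elim by simp
        ultimately show ?case using elim
          by (metis divide_inverse inverse_divide inverse_eq_divide le_imp_inverse_le mult_1 divide_divide_eq_right)
      qed
      have d1: "\<forall>\<^sub>F t in at_top. ((\<lambda>t. ln (b t)) has_real_derivative b' t / b t) (at t)"
        using b'(2) bpos by eventually_elim (auto intro!: derivative_eq_intros)
      have "\<forall>\<^sub>F t in at_top. t > \<bar>C\<bar> / q" by (rule eventually_gt_at_top)
      then have "\<forall>\<^sub>F t in at_top. ((\<lambda>t. (1 / q) * ln (q * t - C)) has_real_derivative 1 / (q * t - C)) (at t)"
      proof eventually_elim
        case (elim t)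
        have "C < q * t" using elim q by (simp add: field_simps abs_if split: if_splits)
        then show ?case using q by (auto intro!: derivative_eq_intros)
      qed
      then obtain D where D: "\<forall>\<^sub>F t in at_top. ln (b t) \<le> (1 / q) * ln (q * t - C) + D"
        using eventually_le_of_derivative_le[OF d1 _ le] by blast
      have "\<forall>\<^sub>F t in at_top. (1 / q) * ln (q * t - C) + D < \<delta> * ln t"
        using q \<delta> by real_asymp
      with D bpos eventually_gt_at_top[of 0]
      have *: "\<forall>\<^sub>F t in at_top. b t < t powr \<delta>"
      proof eventually_elim
        case (elim t)
        then have "ln (b t) < ln (t powr \<delta>)" by (simp add: ln_powr)
        then show ?case using elim by (subst (asm) ln_less_cancel_iff) auto
      qed
      have "\<forall>\<^sub>F t in at_top. \<not> b t < t powr \<delta>"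
        using big[of 1] by eventually_elim simp
      then show ?thesis using not_eventually_conflict[OF *] by blast
    qed
  qed
  moreover have "(\<forall>\<^sub>F t in at_top. b'' t \<ge> 0) \<or> (\<forall>\<^sub>F t in at_top. b'' t \<le> 0)"
    using hardy_field_eventually_compare[OF H b''(1) hardy_field_of_nat[OF H, of 0]]
      eventually_mono[of "\<lambda>t. b'' t < 0" at_top "\<lambda>t. b'' t \<le> 0"] by auto
  moreover have "\<forall>\<^sub>F t in at_top. (b has_real_derivative b' t) (at t) \<and>
        (b' has_real_derivative b'' t) (at t) \<and> b' t > 0"
    using b'(2) b''(2) pos by eventually_elim simp
  ultimately have "time_change b b'"
    unfolding time_change_def using lim lim0 by blast
  then show ?thesis using that b'(1) by blast
qed

text \<open>A converse of l'Hospital's rule, false for general functions. For each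
  \<open>q = 1 / (n + 1)\<close> either \<open>a' < q * b'\<close> eventually or
  \<open>q * b' \<le> a'\<close> eventually; the second alternative integrates to
  \<open>q * b \<le> a + C\<close>, which contradicts \<open>a / b\<close> tending to 0 because
  \<open>b\<close> tends to infinity.\<close>

lemma hardy_field_derivative_quotient_tendsto_0:
  assumes H: "hardy_field H" and germs: "germ_of a' \<in> H" "germ_of b' \<in> H"
    and a: "time_change a a'" and b: "time_change b b'"
    and ab: "((\<lambda>t. a t / b t) \<longlongrightarrow> 0) at_top"
  shows "((\<lambda>t. a' t / b' t) \<longlongrightarrow> 0) at_top"
proof (rule order_tendstoI)
  have a1: "\<forall>\<^sub>F t in at_top. (a has_real_derivative a' t) (at t)" "\<forall>\<^sub>F t in at_top. a' t > 0"
    using a unfolding time_change_def by (auto elim: eventually_mono)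
  have b1: "\<forall>\<^sub>F t in at_top. (b has_real_derivative b' t) (at t)" "\<forall>\<^sub>F t in at_top. b' t > 0"
    using b unfolding time_change_def by (auto elim: eventually_mono)
  have blim: "filterlim b at_top at_top" using b unfolding time_change_def by blast
  show "\<forall>\<^sub>F t in at_top. e < a' t / b' t" if "e < 0" for e
    using a1(2) b1(2)
  proof eventually_elim
    case (elim t)
    then have "0 < a' t / b' t" by simp
    then show ?case using that by linarith
  qed
  show "\<forall>\<^sub>F t in at_top. a' t / b' t < e" if e: "e > 0" for e
  proof -
    obtain n where n: "1 / real (Suc n) < e"
      using e nat_approx_posE by blast
    define q where "q = 1 / real (Suc n)"
    have q: "0 < q" "q < e" using n by (auto simp: q_def)
    have "germ_of (\<lambda>t. q * b' t) \<in> H"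
      unfolding q_def by (intro hardy_field_mult[OF H] hardy_field_inverse_of_nat[OF H] germs)
    from hardy_field_eventually_compare[OF H germs(1) this]
    show ?thesis
    proof
      assume "\<forall>\<^sub>F t in at_top. a' t < q * b' t"
      with b1(2) show ?thesis
      proof eventually_elim
        case (elim t)
        then have "a' t / b' t < q" by (simp add: field_simps)
        then show ?case using q by simp
      qed
    next
      assume le: "\<forall>\<^sub>F t in at_top. q * b' t \<le> a' t"
      have "\<forall>\<^sub>F t in at_top. ((\<lambda>t. q * b t) has_real_derivative q * b' t) (at t)"
        using b1(1) by eventually_elim (auto intro!: derivative_eq_intros)
      then obtain C where C: "\<forall>\<^sub>F t in at_top. q * b t \<le> a t + C"
        using eventually_le_of_derivative_le[OF _ a1(1) le] by blast
      have "\<forall>\<^sub>F t in at_top. a t / b t < q / 2"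
        using order_tendstoD(2)[OF ab, of "q / 2"] q by linarith
      moreover have "\<forall>\<^sub>F t in at_top. b t > 2 * \<bar>C\<bar> / q"
        using blim by (simp add: filterlim_at_top_dense)
      moreover have "\<forall>\<^sub>F t in at_top. b t > 0"
        using blim by (simp add: filterlim_at_top_dense)
      ultimately have "\<forall>\<^sub>F t in at_top. \<not> q * b t \<le> a t + C"
      proof eventually_elim
        case (elim t)
        have "a t < q * b t / 2" using elim(1,3) by (simp add: field_simps)
        moreover have "C < q * b t / 2" using elim(2) q by (simp add: field_simps abs_if split: if_splits)
        ultimately show ?case by linarith
      qed
      then show ?thesis using not_eventually_conflict[OF C] by blast
    qed
  qed
qed

section \<open>Averages along time changes\<close>

lemma bounded_borel_set_integrable:
  fixes g :: "real \<Rightarrow> 'b::{banach, second_countable_topology}"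
  assumes [measurable]: "g \<in> borel_measurable borel" and "\<And>t. norm (g t) \<le> K"
  shows "set_integrable lborel {a..b} g"
proof (rule set_integrable_bound[of lborel _ "\<lambda>_. K"])
  show "set_integrable lborel {a..b} (\<lambda>_. K)"
    by (intro borel_integrable_atLeastAtMost' continuous_intros)
  have "K \<ge> 0" using assms(2)[of 0] norm_ge_zero order_trans by blast
  then show "AE x in lborel. x \<in> {a..b} \<longrightarrow> norm (g x) \<le> norm K"
    using assms(2) by simp
qed (simp add: set_borel_measurable_def)

lemma set_integral_le_const:
  fixes g :: "real \<Rightarrow> real"
  assumes "g \<in> borel_measurable borel" "\<And>t. 0 \<le> g t" "\<And>t. g t \<le> K" "a \<le> b"
  shows "(LBINT t:{a..b}. g t) \<le> K * (b - a)"
proof -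
  have "(LBINT t:{a..b}. g t) \<le> (LBINT t:{a..b}. K)"
    by (intro set_integral_mono bounded_borel_set_integrable[of _ K])
      (use assms(1-3) order_trans[OF assms(2,3)] in auto)
  also have "\<dots> = K * (b - a)"
    using assms(4) by (simp add: set_integral_const mult.commute)
  finally show ?thesis .
qed

lemma set_integral_split_Icc:
  fixes g :: "real \<Rightarrow> 'b::{banach, second_countable_topology}"
  assumes "g \<in> borel_measurable borel" "\<And>t. norm (g t) \<le> K" "a \<le> b" "b \<le> c"
  shows "(LBINT t:{a..c}. g t) = (LBINT t:{a..b}. g t) + (LBINT t:{b..c}. g t)"
proof -
  have eq: "{a..c} = {a..b} \<union> {b..c}" using assms by auto
  show ?thesis unfolding eq
  proof (rule set_integral_Un_AE)
    have "AE x in lborel. x \<noteq> b" by (rule AE_lborel_singleton)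
    then show "AE x in lborel. \<not> (x \<in> {a..b} \<and> x \<in> {b..c})"
      by eventually_elim auto
  qed (auto intro!: bounded_borel_set_integrable assms)
qed

lemma set_integral_mono_set:
  fixes g :: "real \<Rightarrow> real"
  assumes "g \<in> borel_measurable borel" "\<And>t. 0 \<le> g t" "\<And>t. g t \<le> K" "{a..b} \<subseteq> {c..d}"
  shows "(LBINT t:{a..b}. g t) \<le> (LBINT t:{c..d}. g t)"
proof -
  have "set_integrable lborel {c..d} g"  "set_integrable lborel {a..b} g"
    by (rule bounded_borel_set_integrable[of _ K]; use assms in auto)+
  then show ?thesis
    unfolding set_lebesgue_integral_def set_integrable_def
    by (intro integral_mono) (use assms in \<open>auto split: split_indicator\<close>)
qed

text \<open>\<open>g\<close> will be an error along an orbit, hence only Borel and bounded; the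
  continuity needed for the substitution is asked of \<open>b'\<close>.\<close>

lemma set_integral_substitution_Icc:
  fixes g b b' :: "real \<Rightarrow> real"
  assumes "g \<in> borel_measurable borel" "\<And>t. \<bar>g t\<bar> \<le> K"
    and "\<And>t. t \<in> {u..v} \<Longrightarrow> (b has_real_derivative b' t) (at t)"
    and "continuous_on {u..v} b'" "\<And>t. t \<in> {u..v} \<Longrightarrow> 0 \<le> b' t" "u \<le> v"
  shows "set_integrable lborel {u..v} (\<lambda>t. g (b t) * b' t)"
    and "(LBINT t:{u..v}. g (b t) * b' t) = (LBINT s:{b u..b v}. g s)"
proof -
  have "set_integrable lborel {b u..b v} g"
    by (rule bounded_borel_set_integrable[of _ K]) (use assms in auto)
  from integral_substitution[OF this assms(3-6)]
  show "set_integrable lborel {u..v} (\<lambda>t. g (b t) * b' t)"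
    "(LBINT t:{u..v}. g (b t) * b' t) = (LBINT s:{b u..b v}. g s)"
    by (simp_all add: set_lebesgue_integral_def mult.commute)
qed

section \<open>Averages and oscillation along one time change\<close>

text \<open>One threshold serves all the eventual conditions; the alternative for the sign of
  \<open>b''\<close> is decided before the threshold is chosen. \<open>t0 \<ge> 1\<close> keeps
  \<open>t\<close> positive.\<close>

lemma time_change_obtain:
  assumes "time_change b b'"
  obtains t0 C b'' where "t0 \<ge> 1" "C > 0"
    and "\<forall>t\<ge>t0. (b has_real_derivative b' t) (at t) \<and> (b' has_real_derivative b'' t) (at t) \<and>
      b' t > 0 \<and> b t \<ge> 0 \<and> b t \<le> C * (t * b' t)"
    and "(\<forall>t\<ge>t0. b'' t \<ge> 0) \<or> (\<forall>t\<ge>t0. b'' t \<le> 0)"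
proof -
  obtain b'' where d: "\<forall>\<^sub>F t in at_top. (b has_real_derivative b' t) (at t) \<and>
        (b' has_real_derivative b'' t) (at t) \<and> b' t > 0"
      and s: "(\<forall>\<^sub>F t in at_top. b'' t \<ge> 0) \<or> (\<forall>\<^sub>F t in at_top. b'' t \<le> 0)"
    using assms unfolding time_change_def by blast
  obtain C where C: "C > 0" "\<forall>\<^sub>F t in at_top. b t \<le> C * (t * b' t)"
    using assms unfolding time_change_def by blast
  have nn: "\<forall>\<^sub>F t in at_top. b t \<ge> 0"
    using assms unfolding time_change_def by (simp add: filterlim_at_top)
  have ev: "\<forall>\<^sub>F t in at_top. ((b has_real_derivative b' t) (at t) \<and>
        (b' has_real_derivative b'' t) (at t) \<and> b' t > 0) \<and> b t \<le> C * (t * b' t) \<and> b t \<ge> 0"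
    using d C(2) nn by eventually_elim simp
  from s show ?thesis
  proof
    assume "\<forall>\<^sub>F t in at_top. b'' t \<ge> 0"
    with ev have "\<forall>\<^sub>F t in at_top. (((b has_real_derivative b' t) (at t) \<and>
        (b' has_real_derivative b'' t) (at t) \<and> b' t > 0) \<and> b t \<le> C * (t * b' t) \<and> b t \<ge> 0) \<and> b'' t \<ge> 0"
      by eventually_elim simp
    then obtain N where "\<And>t. t \<ge> N \<Longrightarrow> (((b has_real_derivative b' t) (at t) \<and>
        (b' has_real_derivative b'' t) (at t) \<and> b' t > 0) \<and> b t \<le> C * (t * b' t) \<and> b t \<ge> 0) \<and> b'' t \<ge> 0"
      unfolding eventually_at_top_linorder by blast
    then show ?thesis by (intro that[of "max 1 N" C b'']) (use C(1) in auto)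
  next
    assume "\<forall>\<^sub>F t in at_top. b'' t \<le> 0"
    with ev have "\<forall>\<^sub>F t in at_top. (((b has_real_derivative b' t) (at t) \<and>
        (b' has_real_derivative b'' t) (at t) \<and> b' t > 0) \<and> b t \<le> C * (t * b' t) \<and> b t \<ge> 0) \<and> b'' t \<le> 0"
      by eventually_elim simp
    then obtain N where "\<And>t. t \<ge> N \<Longrightarrow> (((b has_real_derivative b' t) (at t) \<and>
        (b' has_real_derivative b'' t) (at t) \<and> b' t > 0) \<and> b t \<le> C * (t * b' t) \<and> b t \<ge> 0) \<and> b'' t \<le> 0"
      unfolding eventually_at_top_linorder by blast
    then show ?thesis by (intro that[of "max 1 N" C b'']) (use C(1) in auto)
  qed
qed

text \<open>
  If \<open>1 / b'\<close> is increasing, bound it by its value at \<open>y\<close>; if it is decreasing, the second mean value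
  theorem moves it out of the integral of \<open>(g (b t) - \<eta>) b' t\<close>, whose primitive is bounded above.
\<close>

lemma time_change_average:
  assumes tc: "time_change b b'" and b[measurable]: "b \<in> borel_measurable borel"
  obtains C where "C > 0"
    and "\<And>(g :: real \<Rightarrow> real) \<eta> K. g \<in> borel_measurable borel \<Longrightarrow> (\<And>s. 0 \<le> g s) \<Longrightarrow> (\<And>s. g s \<le> K) \<Longrightarrow>
      \<eta> > 0 \<Longrightarrow> \<forall>\<^sub>F S in at_top. (LBINT s:{0..S}. g s) \<le> \<eta> * S \<Longrightarrow>
      \<forall>\<^sub>F y in at_top. (LBINT t:{0..y}. g (b t)) \<le> C * \<eta> * y"
proof -
  obtain t0 C0 b'' where t0: "t0 \<ge> 1" and C0: "C0 > 0"
    and ev: "\<forall>t\<ge>t0. (b has_real_derivative b' t) (at t) \<and> (b' has_real_derivative b'' t) (at t) \<and>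
      b' t > 0 \<and> b t \<ge> 0 \<and> b t \<le> C0 * (t * b' t)"
    and sgn: "(\<forall>t\<ge>t0. b'' t \<ge> 0) \<or> (\<forall>t\<ge>t0. b'' t \<le> 0)"
    using time_change_obtain[OF tc] by blast
  have d1: "\<And>t. t \<ge> t0 \<Longrightarrow> (b has_real_derivative b' t) (at t)"
    and d2: "\<And>t. t \<ge> t0 \<Longrightarrow> (b' has_real_derivative b'' t) (at t)"
    and pos: "\<And>t. t \<ge> t0 \<Longrightarrow> b' t > 0"
    and nn: "\<And>t. t \<ge> t0 \<Longrightarrow> b t \<ge> 0"
    and bC: "\<And>t. t \<ge> t0 \<Longrightarrow> b t \<le> C0 * (t * b' t)"
    using ev by auto
  have lim: "filterlim b at_top at_top" using tc unfolding time_change_def by blast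
  have cont: "continuous_on {u..v} b'" if "u \<ge> t0" for u v
    by (intro continuous_at_imp_continuous_on ballI DERIV_isCont[OF d2]) (use that in auto)
  have bmono: "b u \<le> b v" if "t0 \<le> u" "u \<le> v" for u v
    by (rule DERIV_nonneg_imp_nondecreasing[OF that(2)])
      (use that d1 pos in \<open>meson less_imp_le order_trans\<close>)
  show ?thesis
  \<comment> \<open>\<open>C0\<close> comes from \<open>b t \<le> C0 * (t * b' t)\<close> when
    \<open>1 / b'\<close> increases, one unit covers \<open>\<eta> * (y - t0)\<close> when it
    decreases, and the last unit absorbs \<open>K * t0 + A\<close> for large \<open>y\<close>. The
    sum depends on neither \<open>g\<close> nor \<open>\<eta>\<close>.\<close>
  proof (rule that[of "C0 + 2"])
    show "C0 + 2 > 0" using C0 by simp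
  next
    fix g :: "real \<Rightarrow> real" and \<eta> K
    assume g[measurable]: "g \<in> borel_measurable borel" and g0: "\<And>s. 0 \<le> g s" and gK: "\<And>s. g s \<le> K"
      and \<eta>: "\<eta> > 0" and avg: "\<forall>\<^sub>F S in at_top. (LBINT s:{0..S}. g s) \<le> \<eta> * S"
    have K: "K \<ge> 0" using g0[of 0] gK[of 0] by simp
    have gb[measurable]: "(\<lambda>t. g (b t)) \<in> borel_measurable borel" by measurable
    have absg: "\<bar>g s\<bar> \<le> K" for s using g0[of s] gK[of s] by simp
    obtain S1 where S1: "S1 \<ge> 0" "\<And>S. S \<ge> S1 \<Longrightarrow> (LBINT s:{0..S}. g s) \<le> \<eta> * S"
      using avg unfolding eventually_at_top_linorder by (metis max.cobounded1 max.bounded_iff)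
    \<comment> \<open>The hypothesis controls long intervals only; below \<open>S1\<close> the
      trivial bound \<open>K * S1\<close> takes over.\<close>
    have prim: "(LBINT s:{0..S}. g s) \<le> \<eta> * S + K * S1" if "S \<ge> 0" for S
    proof (cases "S \<ge> S1")
      case True
      then show ?thesis using S1 K by (simp add: add_increasing2)
    next
      case False
      have "(LBINT s:{0..S}. g s) \<le> K * (S - 0)"
        by (rule set_integral_le_const) (use g0 gK that in auto)
      also have "\<dots> \<le> K * S1" using False K by (simp add: mult_left_mono)
      finally show ?thesis using \<eta> that by (simp add: add_increasing)
    qed
    have "\<exists>A. \<forall>\<^sub>F y in at_top. (LBINT t:{t0..y}. g (b t)) \<le> (C0 + 1) * \<eta> * y + A"
    proof (cases "\<forall>t\<ge>t0. b'' t \<le> 0")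
      case True
      have "\<forall>\<^sub>F y in at_top. b y \<ge> S1" using lim by (simp add: filterlim_at_top)
      with eventually_ge_at_top[of t0]
      have "\<forall>\<^sub>F y in at_top. (LBINT t:{t0..y}. g (b t)) \<le> (C0 + 1) * \<eta> * y + 0"
      proof eventually_elim
        case (elim y)
        have mono: "b' y \<le> b' t" if "t \<in> {t0..y}" for t
        proof (rule DERIV_nonpos_imp_nonincreasing[of t y b'])
          show "\<exists>z. (b' has_real_derivative z) (at x) \<and> z \<le> 0" if "t \<le> x" for x
            using d2[of x] True \<open>t \<in> {t0..y}\<close> that by auto
        qed (use that in auto)
        have sub: "set_integrable lborel {t0..y} (\<lambda>t. g (b t) * b' t)"
          "(LBINT t:{t0..y}. g (b t) * b' t) = (LBINT s:{b t0..b y}. g s)"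
          by (rule set_integral_substitution_Icc[where K = K];
              use absg d1 cont pos elim in \<open>auto intro: less_imp_le\<close>)+
        have "(LBINT t:{t0..y}. g (b t)) \<le> (LBINT t:{t0..y}. (1 / b' y) * (g (b t) * b' t))"
        proof (rule set_integral_mono)
          show "set_integrable lborel {t0..y} (\<lambda>t. g (b t))"
            by (rule bounded_borel_set_integrable[of _ K]) (use absg in auto)
          show "set_integrable lborel {t0..y} (\<lambda>t. (1 / b' y) * (g (b t) * b' t))"
            by (rule set_integrable_mult_right) (use sub in simp)
          fix t assume t: "t \<in> {t0..y}"
          have "g (b t) * 1 \<le> g (b t) * (b' t / b' y)"
            by (rule mult_left_mono) (use mono[OF t] pos[of y] elim g0 in auto)
          then show "g (b t) \<le> (1 / b' y) * (g (b t) * b' t)" by simp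
        qed
        also have "\<dots> = (1 / b' y) * (LBINT s:{b t0..b y}. g s)"
          by (subst set_integral_mult_right) (use sub in simp)
        also have "\<dots> \<le> (1 / b' y) * (LBINT s:{0..b y}. g s)"
          by (intro mult_left_mono set_integral_mono_set[of _ K])
            (use g0 gK pos[of y] elim nn[of t0] in auto)
        also have "\<dots> \<le> (1 / b' y) * (\<eta> * b y)"
          by (intro mult_left_mono S1) (use pos[of y] elim in auto)
        also have "\<dots> \<le> (1 / b' y) * (\<eta> * (C0 * (y * b' y)))"
          by (intro mult_left_mono bC) (use pos[of y] elim \<eta> in auto)
        also have "\<dots> = C0 * \<eta> * y" using pos[of y] elim by simp
        also have "\<dots> \<le> (C0 + 1) * \<eta> * y + 0"
          using \<eta> t0 elim by (simp add: algebra_simps)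
        finally show ?case .
      qed
      then show ?thesis by blast
    next
      case False
      with sgn have b2: "\<And>t. t \<ge> t0 \<Longrightarrow> b'' t \<ge> 0" by blast
      define A where "A = (1 / b' t0) * (\<eta> * b t0 + K * S1)"
      have "(LBINT t:{t0..y}. g (b t)) \<le> (C0 + 1) * \<eta> * y + A" if y: "y \<ge> t0" for y
      proof -
        have mono: "b' u \<le> b' v" if "t0 \<le> u" "u \<le> v" for u v
        proof (rule DERIV_nonneg_imp_nondecreasing[of u v b'])
          show "\<exists>z. (b' has_real_derivative z) (at x) \<and> 0 \<le> z" if "u \<le> x" for x
            using d2[of x] b2[of x] \<open>t0 \<le> u\<close> that by auto
        qed (use that in auto)
        let ?k = "\<lambda>s. g s - \<eta>"
        have absk: "\<bar>?k s\<bar> \<le> K + \<eta>" for s using g0[of s] gK[of s] \<eta> by simp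
        have sub: "set_integrable lborel {u..v} (\<lambda>t. ?k (b t) * b' t)"
          "(LBINT t:{u..v}. ?k (b t) * b' t) = (LBINT s:{b u..b v}. ?k s)"
          if "t0 \<le> u" "u \<le> v" for u v
          by (rule set_integral_substitution_Icc[where K = "K + \<eta>"];
              use absk d1 cont pos that in \<open>auto intro: less_imp_le\<close>)+
        have D: "integral {t0..c} (\<lambda>t. ?k (b t) * b' t) \<le> \<eta> * b t0 + K * S1" if "t0 \<le> c" for c
        proof -
          have "integral {t0..c} (\<lambda>t. ?k (b t) * b' t) = (LBINT s:{b t0..b c}. ?k s)"
            using set_borel_integral_eq_integral(2)[OF sub(1)[of t0 c]] sub(2)[of t0 c] that by simp
          also have "\<dots> = (LBINT s:{b t0..b c}. g s) - (LBINT s:{b t0..b c}. \<eta>)"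
            by (intro set_integral_diff bounded_borel_set_integrable[of _ K]
                bounded_borel_set_integrable[of _ \<eta>]) (use absg \<eta> in auto)
          also have "(LBINT s:{b t0..b c}. \<eta>) = \<eta> * (b c - b t0)"
            using bmono[of t0 c] that by (simp add: set_integral_const mult.commute)
          also have "(LBINT s:{b t0..b c}. g s) \<le> (LBINT s:{0..b c}. g s)"
            by (intro set_integral_mono_set[of _ K]) (use g0 gK nn[of t0] in auto)
          also have "\<dots> \<le> \<eta> * b c + K * S1" by (rule prim) (use nn that in auto)
          finally show ?thesis by (simp add: algebra_simps)
        qed
        have intf: "(\<lambda>t. ?k (b t) * b' t) integrable_on {t0..y}"
          using set_borel_integral_eq_integral(1)[OF sub(1)[of t0 y]] y by simp
        \<comment> \<open>The mean value theorem asks for a nondecreasing weight, hence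
          \<open>- 1 / b'\<close> instead of \<open>1 / b'\<close>.\<close>
        obtain c where c: "c \<in> {t0..y}" and
          eq: "integral {t0..y} (\<lambda>t. (- 1 / b' t) * (?k (b t) * b' t)) =
            (- 1 / b' t0) * integral {t0..c} (\<lambda>t. ?k (b t) * b' t) +
            (- 1 / b' y) * integral {c..y} (\<lambda>t. ?k (b t) * b' t)"
        proof (rule second_mean_value_theorem[OF intf y, where g = "\<lambda>t. - 1 / b' t"])
          fix u v assume "t0 \<le> u" "u \<le> v" "v \<le> y"
          then show "- 1 / b' u \<le> - 1 / b' v"
            using mono[of u v] pos[of u] by (simp add: frac_le)
        qed blast
        define I where "I = integral {t0..c} (\<lambda>t. ?k (b t) * b' t)"
        define J where "J = integral {t0..y} (\<lambda>t. ?k (b t) * b' t)"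
        have IJ: "I + integral {c..y} (\<lambda>t. ?k (b t) * b' t) = J"
          unfolding I_def J_def by (rule Henstock_Kurzweil_Integration.integral_combine) (use c intf in auto)
        have "integral {t0..y} (\<lambda>t. (- 1 / b' t) * (?k (b t) * b' t)) = integral {t0..y} (\<lambda>t. - ?k (b t))"
        proof (rule integral_cong)
          fix t assume "t \<in> {t0..y}"
          then have "b' t > 0" using pos by auto
          then show "(- 1 / b' t) * (?k (b t) * b' t) = - ?k (b t)" by simp
        qed
        then have "integral {t0..y} (\<lambda>t. ?k (b t)) = (1 / b' t0) * I + (1 / b' y) * (J - I)"
        proof -
          assume neg: "integral {t0..y} (\<lambda>t. (- 1 / b' t) * (?k (b t) * b' t)) = integral {t0..y} (\<lambda>t. - ?k (b t))"
          have "integral {c..y} (\<lambda>t. ?k (b t) * b' t) = J - I" using IJ by linarith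
          then have "- integral {t0..y} (\<lambda>t. ?k (b t)) = (- 1 / b' t0) * I + (- 1 / b' y) * (J - I)"
            using eq neg I_def by (metis integral_neg)
          then show ?thesis by (simp only: minus_divide_left[symmetric] mult_minus_left)
        qed
        \<comment> \<open>In this arrangement both coefficients are nonnegative, so the upper bound
          for the primitive applies to \<open>I\<close> and to \<open>J\<close>, and the terms with
          \<open>1 / b' y\<close> cancel.\<close>
        also have "\<dots> = (1 / b' t0 - 1 / b' y) * I + (1 / b' y) * J"
          by (simp add: diff_divide_distrib left_diff_distrib)
        also have "\<dots> \<le> (1 / b' t0 - 1 / b' y) * (\<eta> * b t0 + K * S1) + (1 / b' y) * (\<eta> * b t0 + K * S1)"
          unfolding I_def J_def
          by (intro add_mono mult_left_mono D)
            (use c y pos[of t0] pos[of y] mono[of t0 y] in \<open>auto simp: frac_le\<close>)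
        also have "\<dots> = A" by (simp add: A_def algebra_simps)
        finally have le: "integral {t0..y} (\<lambda>t. ?k (b t)) \<le> A" .
        have "integral {t0..y} (\<lambda>t. ?k (b t)) = (LBINT t:{t0..y}. ?k (b t))"
          by (rule set_borel_integral_eq_integral(2)[symmetric],
              rule bounded_borel_set_integrable[of _ "K + \<eta>"]) (use absk in auto)
        also have "\<dots> = (LBINT t:{t0..y}. g (b t)) - (LBINT t:{t0..y}. \<eta>)"
          by (intro set_integral_diff bounded_borel_set_integrable[of _ K]
                bounded_borel_set_integrable[of _ \<eta>]) (use absg \<eta> in auto)
        also have "(LBINT t:{t0..y}. \<eta>) = \<eta> * (y - t0)"
          using y by (simp add: set_integral_const mult.commute)
        finally have "(LBINT t:{t0..y}. g (b t)) \<le> A + \<eta> * (y - t0)" using le by simp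
        also have "\<dots> \<le> (C0 + 1) * \<eta> * y + A"
          using \<eta> t0 y C0 by (simp add: algebra_simps add_increasing)
        finally show ?thesis .
      qed
      then show ?thesis unfolding eventually_at_top_linorder by blast
    qed
    then obtain A where A: "\<forall>\<^sub>F y in at_top. (LBINT t:{t0..y}. g (b t)) \<le> (C0 + 1) * \<eta> * y + A" by blast
    have "\<forall>\<^sub>F y in at_top. y \<ge> (K * t0 + A) / \<eta>" by (rule eventually_ge_at_top)
    with A eventually_ge_at_top[of t0]
    show "\<forall>\<^sub>F y in at_top. (LBINT t:{0..y}. g (b t)) \<le> (C0 + 2) * \<eta> * y"
    proof eventually_elim
      case (elim y)
      have "(LBINT t:{0..y}. g (b t)) = (LBINT t:{0..t0}. g (b t)) + (LBINT t:{t0..y}. g (b t))"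
        by (rule set_integral_split_Icc[of _ K]) (use absg t0 elim in auto)
      also have "(LBINT t:{0..t0}. g (b t)) \<le> K * (t0 - 0)"
        by (rule set_integral_le_const) (use g0 gK t0 in auto)
      also have "(LBINT t:{t0..y}. g (b t)) \<le> (C0 + 1) * \<eta> * y + A" by (rule elim)
      finally have "(LBINT t:{0..y}. g (b t)) \<le> (C0 + 1) * \<eta> * y + (K * t0 + A)" by simp
      moreover have "K * t0 + A \<le> \<eta> * y" using elim \<eta> by (simp add: field_simps)
      ultimately show ?case by (simp add: algebra_simps)
    qed
  qed
qed

text \<open>Since \<open>h (b t)\<close> is the derivative of \<open>G (b t)\<close> divided by
  \<open>b' t\<close>, the integrand is the derivative of \<open>R t = F t * G (b t) / b' t\<close>
  minus an error \<open>E t\<close>. One part of \<open>E\<close> carries \<open>F' / b'\<close>,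
  which is small by \<open>slow\<close>; the other carries the derivative of \<open>1 / b'\<close>,
  which does not change sign, so its absolute value has a known primitive. The boundary terms are
  \<open>o(y)\<close> because \<open>1 / (y * b' y)\<close> tends to 0.\<close>

lemma time_change_oscillation:
  fixes F h G :: "_ \<Rightarrow> complex"
  assumes tc: "time_change b b'" and b[measurable]: "b \<in> borel_measurable borel"
    and F[measurable]: "F \<in> borel_measurable borel" and F1: "\<And>t. norm (F t) \<le> 1"
    and F': "\<forall>\<^sub>F t in at_top. (F has_vector_derivative F' t) (at t)"
    and slow: "\<And>e. e > 0 \<Longrightarrow> \<forall>\<^sub>F t in at_top. norm (F' t) \<le> e * b' t"
    and G: "\<And>s. (G has_vector_derivative h s) (at s)" "\<And>s. norm (G s) \<le> K"
    and h: "continuous_on UNIV h" "\<And>s. norm (h s) \<le> K"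
    and \<eta>: "\<eta> > 0"
  shows "\<forall>\<^sub>F y in at_top. norm (LBINT t:{0..y}. F t * h (b t)) \<le> \<eta> * y"
proof -
  have K: "K \<ge> 0" using G(2)[of 0] norm_ge_zero order_trans by blast
  have [measurable]: "h \<in> borel_measurable borel"
    by (rule borel_measurable_continuous_onI) (rule h(1))
  have Fh: "(\<lambda>t. F t * h (b t)) \<in> borel_measurable borel" by measurable
  have FhK: "norm (F t * h (b t)) \<le> K" for t
    using mult_mono[OF F1[of t] h(2)[of "b t"]] by (simp add: norm_mult)
  \<comment> \<open>\<open>K + 1\<close> avoids a zero denominator; the factor 4 leaves room for two
    terms \<open>K * e * y\<close> and a constant.\<close>
  define e where "e = \<eta> / (4 * (K + 1))"
  have e: "e > 0" using \<eta> K by (simp add: e_def)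
  have Ke: "4 * (K * e) \<le> \<eta>" using K \<eta> by (simp add: e_def field_simps)
  obtain t1 C0 b'' where t1: "t1 \<ge> 1" and "C0 > 0"
    and ev: "\<forall>t\<ge>t1. (b has_real_derivative b' t) (at t) \<and> (b' has_real_derivative b'' t) (at t) \<and>
      b' t > 0 \<and> b t \<ge> 0 \<and> b t \<le> C0 * (t * b' t)"
    and sgn: "(\<forall>t\<ge>t1. b'' t \<ge> 0) \<or> (\<forall>t\<ge>t1. b'' t \<le> 0)"
    using time_change_obtain[OF tc] by blast
  have d1: "\<And>t. t \<ge> t1 \<Longrightarrow> (b has_real_derivative b' t) (at t)"
    and d2: "\<And>t. t \<ge> t1 \<Longrightarrow> (b' has_real_derivative b'' t) (at t)"
    and pos: "\<And>t. t \<ge> t1 \<Longrightarrow> b' t > 0"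
    using ev by auto
  have "\<forall>\<^sub>F t in at_top. (F has_vector_derivative F' t) (at t) \<and> norm (F' t) \<le> e * b' t"
    using F' slow[OF e] by eventually_elim simp
  then obtain t2 where t2: "\<And>t. t \<ge> t2 \<Longrightarrow> (F has_vector_derivative F' t) (at t) \<and> norm (F' t) \<le> e * b' t"
    unfolding eventually_at_top_linorder by blast
  define t0 where "t0 = max t1 t2"
  have t0: "t0 \<ge> 1" "t0 \<ge> t1" "t0 \<ge> t2" using t1 by (auto simp: t0_def)
  \<comment> \<open>\<open>\<sigma>\<close> is the sign of \<open>b''\<close> beyond
    \<open>t0\<close>: there \<open>\<bar>b'' t\<bar> / (b' t)^2\<close> equals
    \<open>- \<sigma>\<close> times the derivative of \<open>1 / b'\<close>.\<close>
  obtain \<sigma> :: real where \<sigma>: "\<bar>\<sigma>\<bar> = 1" "\<And>t. t \<ge> t0 \<Longrightarrow> \<bar>b'' t\<bar> = \<sigma> * b'' t"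
  proof (cases "\<forall>t\<ge>t1. b'' t \<ge> 0")
    case True
    then show ?thesis using that[of 1] t0 by auto
  next
    case False
    then show ?thesis using that[of "-1"] t0 sgn by auto
  qed
  define R where "R = (\<lambda>t. (1 / b' t) *\<^sub>R (F t * G (b t)))"
  define E where "E = (\<lambda>t. (1 / b' t) *\<^sub>R (F' t * G (b t)) + (- b'' t / (b' t)\<^sup>2) *\<^sub>R (F t * G (b t)))"
  have inv': "((\<lambda>t. 1 / b' t) has_real_derivative - b'' t / (b' t)\<^sup>2) (at t)" if "t \<ge> t0" for t
    using d2[of t] pos[of t] that t0
    by (auto intro!: derivative_eq_intros simp: power2_eq_square)
  have R': "(R has_vector_derivative F t * h (b t) + E t) (at t)" if t: "t \<ge> t0" for t
  proof -
    have "((G \<circ> b) has_vector_derivative b' t *\<^sub>R h (b t)) (at t)"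
      by (rule vector_diff_chain_at)
        (use d1[of t] t t0 G in \<open>auto simp: has_real_derivative_iff_has_vector_derivative\<close>)
    then have "((\<lambda>t. F t * G (b t)) has_vector_derivative
        F t * (b' t *\<^sub>R h (b t)) + F' t * G (b t)) (at t)"
      using t2[of t] t t0 unfolding o_def by (intro has_vector_derivative_mult) auto
    from has_vector_derivative_scaleR[OF inv'[OF t] this]
    have "(R has_vector_derivative (1 / b' t) *\<^sub>R (F t * (b' t *\<^sub>R h (b t)) + F' t * G (b t)) +
        (- b'' t / (b' t)\<^sup>2) *\<^sub>R (F t * G (b t))) (at t)"
      by (simp add: R_def)
    also have "(1 / b' t) *\<^sub>R (F t * (b' t *\<^sub>R h (b t)) + F' t * G (b t)) +
        (- b'' t / (b' t)\<^sup>2) *\<^sub>R (F t * G (b t)) = F t * h (b t) + E t"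
      using pos[of t] t t0 by (simp add: E_def scaleR_add_right)
    finally show ?thesis .
  qed
  have FG: "norm (F t * G (b t)) \<le> K" for t
    using mult_mono[OF F1[of t] G(2)[of "b t"]] by (simp add: norm_mult)
  have normR: "norm (R t) \<le> K * (1 / b' t)" if "t \<ge> t0" for t
    using mult_left_mono[OF FG[of t], of "1 / b' t"] pos[of t] that t0 by (simp add: R_def mult.commute)
  \<comment> \<open>The bound is the derivative of \<open>K * e * t - K * \<sigma> / b' t\<close>,
    so it integrates in closed form.\<close>
  have normE: "norm (E t) \<le> K * e - K * (\<sigma> * (- b'' t / (b' t)\<^sup>2))" if t: "t \<ge> t0" for t
  proof -
    have bp: "b' t > 0" using pos t t0 by auto
    have "norm ((1 / b' t) *\<^sub>R (F' t * G (b t))) = (1 / b' t) * (norm (F' t) * norm (G (b t)))"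
      using bp by (simp add: norm_mult)
    also have "\<dots> \<le> (1 / b' t) * ((e * b' t) * K)"
      by (intro mult_left_mono mult_mono) (use bp t2[of t] t t0 G e in auto)
    also have "\<dots> = K * e" using bp by simp
    finally have 1: "norm ((1 / b' t) *\<^sub>R (F' t * G (b t))) \<le> K * e" .
    have "norm ((- b'' t / (b' t)\<^sup>2) *\<^sub>R (F t * G (b t))) = (\<bar>b'' t\<bar> / (b' t)\<^sup>2) * norm (F t * G (b t))"
      using bp by (simp add: abs_divide)
    also have "\<dots> \<le> (\<bar>b'' t\<bar> / (b' t)\<^sup>2) * K"
      by (intro mult_left_mono FG) auto
    also have "\<dots> = - K * (\<sigma> * (- b'' t / (b' t)\<^sup>2))" using \<sigma>(2)[OF t] by simp
    finally show ?thesis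
      unfolding E_def using 1 norm_triangle_ineq[of "(1 / b' t) *\<^sub>R (F' t * G (b t))"
          "(- b'' t / (b' t)\<^sup>2) *\<^sub>R (F t * G (b t))"] by linarith
  qed
  have main: "norm (LBINT t:{t0..y}. F t * h (b t)) \<le>
      2 * K * (1 / b' y) + 2 * K * (1 / b' t0) + K * e * y" if y: "y \<ge> t0" for y
  proof -
    \<comment> \<open>Gauge integrals are used here: \<open>F'\<close> and \<open>b''\<close> are
      only pointwise derivatives, and the fundamental theorem then holds without an integrability
      assumption on them.\<close>
    have i1: "((\<lambda>t. F t * h (b t) + E t) has_integral (R y - R t0)) {t0..y}"
      by (rule fundamental_theorem_of_calculus[OF y])
        (auto intro: has_vector_derivative_at_within R')
    have si: "set_integrable lborel {t0..y} (\<lambda>t. F t * h (b t))"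
      by (rule bounded_borel_set_integrable[OF Fh FhK])
    note i2 = set_borel_integral_eq_integral[OF si]
    have i2': "((\<lambda>t. F t * h (b t)) has_integral (LBINT t:{t0..y}. F t * h (b t))) {t0..y}"
      using i2 by (simp add: has_integral_integral)
    have i3: "(E has_integral (R y - R t0 - (LBINT t:{t0..y}. F t * h (b t)))) {t0..y}"
      using has_integral_diff[OF i1 i2'] by simp
    have i4: "((\<lambda>t. - b'' t / (b' t)\<^sup>2) has_integral (1 / b' y - 1 / b' t0)) {t0..y}"
      by (rule fundamental_theorem_of_calculus[OF y])
        (use inv' in \<open>auto intro: has_vector_derivative_at_within
          simp: has_real_derivative_iff_has_vector_derivative\<close>)
    have i5: "((\<lambda>t. K * e - K * (\<sigma> * (- b'' t / (b' t)\<^sup>2))) has_integral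
        (K * e * (y - t0) - K * (\<sigma> * (1 / b' y - 1 / b' t0)))) {t0..y}"
      using has_integral_diff[OF has_integral_const_real[of "K * e" t0 y]
          has_integral_mult_right[OF has_integral_mult_right[OF i4, of \<sigma>], of K]] y
      by (simp add: mult.commute)
    have "norm (R y - R t0 - (LBINT t:{t0..y}. F t * h (b t))) \<le>
        K * e * (y - t0) - K * (\<sigma> * (1 / b' y - 1 / b' t0))"
      unfolding integral_unique[OF i3, symmetric] integral_unique[OF i5, symmetric]
      by (rule integral_norm_bound_integral[OF has_integral_integrable[OF i3] has_integral_integrable[OF i5]])
        (use normE in auto)
    moreover have "- K * (\<sigma> * (1 / b' y - 1 / b' t0)) \<le> K * (1 / b' y) + K * (1 / b' t0)"
    proof -
      have "- (\<sigma> * (1 / b' y - 1 / b' t0)) \<le> \<bar>\<sigma> * (1 / b' y - 1 / b' t0)\<bar>" by simp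
      also have "\<dots> = \<bar>1 / b' y - 1 / b' t0\<bar>" using \<sigma>(1) by (simp add: abs_mult)
      also have "\<dots> \<le> 1 / b' y + 1 / b' t0" using pos[of y] pos[of t0] y t0 by (simp add: abs_le_iff)
      finally show ?thesis using K mult_left_mono[of _ "1 / b' y + 1 / b' t0" K]
        by (fastforce simp: algebra_simps)
    qed
    moreover have "norm (R y) \<le> K * (1 / b' y)" "norm (R t0) \<le> K * (1 / b' t0)"
      using normR y by auto
    moreover have "K * e * (y - t0) \<le> K * e * y" using K e t0 by (simp add: mult_left_mono)
    moreover have "norm (LBINT t:{t0..y}. F t * h (b t)) \<le>
        norm (R y - R t0 - (LBINT t:{t0..y}. F t * h (b t))) + norm (R y) + norm (R t0)"
      by (smt (verit) norm_triangle_ineq4 norm_minus_commute norm_triangle_sub)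
    ultimately show ?thesis by linarith
  qed
  have lim0: "((\<lambda>t. 1 / (t * b' t)) \<longlongrightarrow> 0) at_top" using tc unfolding time_change_def by blast
  have "\<forall>\<^sub>F y in at_top. 1 / (y * b' y) < e / 2"
    using order_tendstoD(2)[OF lim0, of "e / 2"] e by linarith
  moreover have "\<forall>\<^sub>F y in at_top. y \<ge> (K * t0 + 2 * K * (1 / b' t0)) / (\<eta> / 4)"
    by (rule eventually_ge_at_top)
  ultimately show ?thesis using eventually_ge_at_top[of t0]
  proof eventually_elim
    case (elim y)
    have y0: "y > 0" "b' y > 0" using elim t0 pos by auto
    have "1 / b' y \<le> e * y / 2" using elim(1) y0 by (simp add: field_simps)
    then have 1: "2 * K * (1 / b' y) \<le> K * e * y" using mult_left_mono[of "1 / b' y" "e * y / 2" "2 * K"] K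
      by (simp add: algebra_simps)
    have 2: "K * t0 + 2 * K * (1 / b' t0) \<le> \<eta> / 4 * y" using elim(2) \<eta> by (simp add: field_simps)
    have "(LBINT t:{0..y}. F t * h (b t)) = (LBINT t:{0..t0}. F t * h (b t)) + (LBINT t:{t0..y}. F t * h (b t))"
      by (rule set_integral_split_Icc[OF Fh FhK]) (use elim t0 in auto)
    then have "norm (LBINT t:{0..y}. F t * h (b t)) \<le>
        norm (LBINT t:{0..t0}. F t * h (b t)) + norm (LBINT t:{t0..y}. F t * h (b t))"
      by (simp add: norm_triangle_ineq)
    moreover have "norm (LBINT t:{0..t0}. F t * h (b t)) \<le> (LBINT t:{0..t0}. norm (F t * h (b t)))"
      by (rule set_integral_norm_bound[OF bounded_borel_set_integrable[OF Fh FhK]])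
    moreover have "(LBINT t:{0..t0}. norm (F t * h (b t))) \<le> K * (t0 - 0)"
      by (rule set_integral_le_const) (use Fh FhK t0 in auto)
    moreover note main[OF elim(3)] 1 2
    moreover have "4 * (K * e) * y \<le> \<eta> * y" using Ke y0 by (simp add: mult_right_mono)
    ultimately have "4 * norm (LBINT t:{0..y}. F t * h (b t)) \<le> 4 * (\<eta> / 4 * y + 2 * (K * e * y))"
      by simp
    moreover have "8 * (K * e * y) \<le> 2 * (\<eta> * y)" using \<open>4 * (K * e) * y \<le> \<eta> * y\<close> by (simp add: algebra_simps)
    moreover have "\<eta> * y \<ge> 0" using \<eta> y0 by simp
    ultimately show ?case by (simp add: algebra_simps)
  qed
qed


section \<open>Products along time changes of different speeds\<close>

text \<open>Each term of the product rule contains one derivative and otherwise factors of norm at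
  most 1. Only the size of the derivative is used later, hence the existential form.\<close>

lemma has_vector_derivative_prod_bounded:
  fixes u :: "'i \<Rightarrow> real \<Rightarrow> complex"
  assumes "finite I"
    and "\<And>i. i \<in> I \<Longrightarrow> (u i has_vector_derivative u' i) (at t)"
    and "\<And>i. i \<in> I \<Longrightarrow> norm (u i t) \<le> 1"
  shows "\<exists>d. ((\<lambda>t. \<Prod>i\<in>I. u i t) has_vector_derivative d) (at t) \<and> norm d \<le> (\<Sum>i\<in>I. norm (u' i))"
  using assms
proof (induction I rule: finite_induct)
  case empty
  then show ?case by (intro exI[of _ 0]) simp
next
  case (insert i I)
  then obtain d where d: "((\<lambda>t. \<Prod>i\<in>I. u i t) has_vector_derivative d) (at t)"
      "norm d \<le> (\<Sum>i\<in>I. norm (u' i))"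
    by auto
  have "((\<lambda>t. u i t * (\<Prod>i\<in>I. u i t)) has_vector_derivative
      u i t * d + u' i * (\<Prod>i\<in>I. u i t)) (at t)"
    by (rule has_vector_derivative_mult) (use insert d in auto)
  moreover have "norm (u i t * d + u' i * (\<Prod>i\<in>I. u i t)) \<le> (\<Sum>i\<in>insert i I. norm (u' i))"
  proof -
    have 1: "norm (u i t * d) \<le> 1 * norm d"
      unfolding norm_mult by (rule mult_right_mono) (use insert in auto)
    have "norm (\<Prod>i\<in>I. u i t) \<le> 1"
      unfolding prod_norm[symmetric] by (rule prod_le_1) (use insert in auto)
    then have 2: "norm (u' i * (\<Prod>i\<in>I. u i t)) \<le> norm (u' i) * 1"
      unfolding norm_mult by (rule mult_left_mono) simp
    show ?thesis
      using insert 1 2 d(2) norm_triangle_ineq[of "u i t * d" "u' i * (\<Prod>i\<in>I. u i t)"] by simp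
  qed
  ultimately show ?case using insert by auto
qed

text \<open>All that is used about an orbit \<open>\<phi> s = f (T s x)\<close>. The first
  approximation, with bounded derivative, stands in for \<open>\<phi>\<close> as a slow factor; the
  second, with bounded primitive, stands in for \<open>\<phi> - m\<close> as the fastest factor. The
  bounds \<open>L\<close> and \<open>K\<close> may depend on \<open>\<eta>\<close>. The last clause
  forces \<open>m\<close> to be the limit of the averages of \<open>\<phi>\<close>.\<close>

definition regular_orbit :: "(real \<Rightarrow> complex) \<Rightarrow> complex \<Rightarrow> bool"
  where "regular_orbit \<phi> m \<longleftrightarrow>
    \<phi> \<in> borel_measurable borel \<and> (\<forall>s. norm (\<phi> s) \<le> 1) \<and>
    (\<forall>\<eta>>0. \<exists>\<psi> \<psi>' L. (\<forall>s. (\<psi> has_vector_derivative \<psi>' s) (at s) \<and> norm (\<psi> s) \<le> 1 \<and> norm (\<psi>' s) \<le> L) \<and>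
      (\<forall>\<^sub>F S in at_top. (LBINT s:{0..S}. norm (\<phi> s - \<psi> s)) \<le> \<eta> * S)) \<and>
    (\<forall>\<eta>>0. \<exists>h G K. (\<forall>s. (G has_vector_derivative h s) (at s) \<and> norm (G s) \<le> K \<and> norm (h s) \<le> K) \<and>
      continuous_on UNIV h \<and>
      (\<forall>\<^sub>F S in at_top. (LBINT s:{0..S}. norm (\<phi> s - m - h s)) \<le> \<eta> * S))"

text \<open>Replacing each slow \<open>\<phi> j\<close> by \<open>\<psi> j\<close> and the last
  factor by \<open>h\<close> changes the integrand by at most a multiple of the sum of the
  approximation errors at the times \<open>b j t\<close>, and averages of these are controlled by
  averages over the orbits. What remains is an oscillatory integral whose amplitude varies slowly
  compared with \<open>b (Suc n)\<close>.\<close>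

lemma average_prod_step:
  fixes \<phi> :: "nat \<Rightarrow> real \<Rightarrow> complex" and b b' :: "nat \<Rightarrow> real \<Rightarrow> real"
  assumes b[measurable]: "\<And>j. j \<in> {1..Suc n} \<Longrightarrow> b j \<in> borel_measurable borel"
    and tc: "\<And>j. j \<in> {1..Suc n} \<Longrightarrow> time_change (b j) (b' j)"
    and slow: "\<And>j. j \<in> {1..n} \<Longrightarrow> ((\<lambda>t. b' j t / b' (Suc n) t) \<longlongrightarrow> 0) at_top"
    and \<phi>: "\<And>j. j \<in> {1..Suc n} \<Longrightarrow> regular_orbit (\<phi> j) (m j)"
    and \<eta>: "\<eta> > 0"
  shows "\<forall>\<^sub>F y in at_top. norm (LBINT t:{0..y}. (\<Prod>j\<in>{1..n}. \<phi> j (b j t)) *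
    (\<phi> (Suc n) (b (Suc n) t) - m (Suc n))) \<le> \<eta> * y"
proof -
  define N where "N = norm (m (Suc n))"
  have \<phi>M[measurable]: "\<phi> j \<in> borel_measurable borel" and \<phi>1: "norm (\<phi> j s) \<le> 1" if "j \<in> {1..Suc n}" for j s
    using \<phi>[OF that] by (auto simp: regular_orbit_def)
  \<comment> \<open>\<open>C\<close> is chosen before \<open>g\<close>, \<open>\<eta>\<close> and
    \<open>K\<close> are known, so the accuracy \<open>e\<close> can be fixed before the
    approximations are.\<close>
  define Q where "Q = (\<lambda>j C. C > 0 \<and> (\<forall>(g :: real \<Rightarrow> real) \<eta> K. g \<in> borel_measurable borel \<longrightarrow>
      (\<forall>s. 0 \<le> g s) \<longrightarrow> (\<forall>s. g s \<le> K) \<longrightarrow> \<eta> > 0 \<longrightarrow>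
      (\<forall>\<^sub>F S in at_top. (LBINT s:{0..S}. g s) \<le> \<eta> * S) \<longrightarrow>
      (\<forall>\<^sub>F y in at_top. (LBINT t:{0..y}. g (b j t)) \<le> C * \<eta> * y)))"
  have "\<exists>C. Q j C" if "j \<in> {1..Suc n}" for j
    unfolding Q_def by (rule time_change_average[OF tc[OF that] b[OF that]]) blast
  then obtain C where Q: "\<And>j. j \<in> {1..Suc n} \<Longrightarrow> Q j (C j)" by metis
  then have C0: "C j > 0" if "j \<in> {1..Suc n}" for j
    using that unfolding Q_def by blast
  have C: "\<forall>\<^sub>F y in at_top. (LBINT t:{0..y}. g (b j t)) \<le> C j * \<eta> * y"
    if "j \<in> {1..Suc n}" "g \<in> borel_measurable borel" "\<And>s. 0 \<le> g s" "\<And>s. g s \<le> K" "\<eta> > 0"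
      "\<forall>\<^sub>F S in at_top. (LBINT s:{0..S}. g s) \<le> \<eta> * S" for j and g :: "real \<Rightarrow> real" and \<eta> K
    using Q[OF that(1)] that unfolding Q_def by blast
  define D where "D = (\<Sum>j\<in>{1..Suc n}. C j)"
  have D: "D > 0" unfolding D_def by (rule sum_pos) (use C0 in auto)
  \<comment> \<open>Half of \<open>\<eta>\<close> pays for all replacement errors, whose total is at
    most \<open>(1 + N) * D * e * y\<close>, the other half for the oscillatory integral.\<close>
  define e where "e = \<eta> / (2 * ((1 + N) * D + 1))"
  have N: "N \<ge> 0" by (simp add: N_def)
  have e: "e > 0" using \<eta> D N by (simp add: e_def add_nonneg_pos)
  have De: "(1 + N) * D * e \<le> \<eta> / 2"
  proof -
    have "(1 + N) * D \<ge> 0" using N D by simp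
    then have "((1 + N) * D) * \<eta> \<le> ((1 + N) * D + 1) * \<eta>" using \<eta> by (intro mult_right_mono) auto
    then show ?thesis using N D unfolding e_def by (simp add: field_simps add_pos_nonneg)
  qed
  define R where "R = (\<lambda>j \<psi> \<psi>' L.
      (\<forall>s. (\<psi> has_vector_derivative \<psi>' s) (at s) \<and> norm (\<psi> s) \<le> 1 \<and> norm (\<psi>' s) \<le> L) \<and>
      (\<forall>\<^sub>F S in at_top. (LBINT s:{0..S}. norm (\<phi> j s - \<psi> s)) \<le> e * S))"
  have "\<exists>\<psi> \<psi>' L. R j \<psi> \<psi>' L" if "j \<in> {1..Suc n}" for j
    using \<phi>[OF that] e unfolding regular_orbit_def R_def by blast
  then obtain \<psi> \<psi>' L where R: "\<And>j. j \<in> {1..Suc n} \<Longrightarrow> R j (\<psi> j) (\<psi>' j) (L j)" by metis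
  have \<psi>: "(\<psi> j has_vector_derivative \<psi>' j s) (at s)" "norm (\<psi> j s) \<le> 1" "norm (\<psi>' j s) \<le> L j"
      "\<forall>\<^sub>F S in at_top. (LBINT s:{0..S}. norm (\<phi> j s - \<psi> j s)) \<le> e * S"
    if "j \<in> {1..Suc n}" for j s
    using R[OF that] unfolding R_def by auto
  have \<psi>M[measurable]: "\<psi> j \<in> borel_measurable borel" if "j \<in> {1..Suc n}" for j
    by (intro borel_measurable_continuous_onI continuous_at_imp_continuous_on ballI
        has_vector_derivative_continuous[OF \<psi>(1)[OF that]])
  have "regular_orbit (\<phi> (Suc n)) (m (Suc n))" by (rule \<phi>) simp
  then have "\<exists>h G K. (\<forall>s. (G has_vector_derivative h s) (at s) \<and> norm (G s) \<le> K \<and> norm (h s) \<le> K) \<and>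
      continuous_on UNIV h \<and>
      (\<forall>\<^sub>F S in at_top. (LBINT s:{0..S}. norm (\<phi> (Suc n) s - m (Suc n) - h s)) \<le> e * S)"
    using e unfolding regular_orbit_def by blast
  then obtain h G K where hG0: "\<forall>s. (G has_vector_derivative h s) (at s) \<and> norm (G s) \<le> K \<and> norm (h s) \<le> K"
    and hG4: "continuous_on UNIV h"
    and hm: "\<forall>\<^sub>F S in at_top. (LBINT s:{0..S}. norm (\<phi> (Suc n) s - m (Suc n) - h s)) \<le> e * S"
    by blast
  have hG: "(G has_vector_derivative h s) (at s)" "norm (G s) \<le> K" "norm (h s) \<le> K" "continuous_on UNIV h" for s
    using hG0 hG4 by auto
  have [measurable]: "h \<in> borel_measurable borel"
    by (rule borel_measurable_continuous_onI) (rule hG(4))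
  define F where "F = (\<lambda>t. \<Prod>j\<in>{1..n}. \<psi> j (b j t))"
  define P where "P = (\<lambda>t. \<Prod>j\<in>{1..n}. \<phi> j (b j t))"
  have FM[measurable]: "F \<in> borel_measurable borel"
    unfolding F_def by (intro borel_measurable_prod measurable_compose[OF b] \<psi>M) auto
  have PM[measurable]: "P \<in> borel_measurable borel"
    unfolding P_def by (intro borel_measurable_prod measurable_compose[OF b] \<phi>M) auto
  have F1: "norm (F t) \<le> 1" for t
    unfolding F_def prod_norm[symmetric] by (rule prod_le_1) (use \<psi>(2) in auto)
  have P1: "norm (P t) \<le> 1" for t
    unfolding P_def prod_norm[symmetric] by (rule prod_le_1) (use \<phi>1 in auto)
  have PF: "norm (P t - F t) \<le> (\<Sum>j\<in>{1..n}. norm (\<phi> j (b j t) - \<psi> j (b j t)))" for t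
    unfolding P_def F_def by (rule norm_prod_diff) (use \<phi>1 \<psi>(2) in auto)

  have osc: "\<forall>\<^sub>F y in at_top. norm (LBINT t:{0..y}. F t * h (b (Suc n) t)) \<le> (\<eta> / 2) * y"
  proof (rule time_change_oscillation[OF _ _ FM F1 _ _ hG(1,2,4,3)])
    show "time_change (b (Suc n)) (b' (Suc n))" "b (Suc n) \<in> borel_measurable borel" "0 < \<eta> / 2"
      using tc b \<eta> by auto
    have pos: "\<forall>\<^sub>F t in at_top. b' j t > 0" if "j \<in> {1..Suc n}" for j
      using tc[OF that] unfolding time_change_def by (auto elim: eventually_mono)
    have der: "\<forall>\<^sub>F t in at_top. (b j has_real_derivative b' j t) (at t)" if "j \<in> {1..Suc n}" for j
      using tc[OF that] unfolding time_change_def by (auto elim: eventually_mono)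
    have all: "\<forall>\<^sub>F t in at_top. \<forall>j\<in>{1..n}. b' j t > 0 \<and> (b j has_real_derivative b' j t) (at t)"
      by (rule eventually_ball_finite) (use pos der in \<open>auto intro: eventually_conj\<close>)
    have F': "\<forall>\<^sub>F t in at_top. (F has_vector_derivative vector_derivative F (at t)) (at t) \<and>
        norm (vector_derivative F (at t)) \<le> (\<Sum>j\<in>{1..n}. L j * b' j t)"
      using all
    proof eventually_elim
      case (elim t)
      have dj: "((\<lambda>t. \<psi> j (b j t)) has_vector_derivative b' j t *\<^sub>R \<psi>' j (b j t)) (at t)" if "j \<in> {1..n}" for j
        using vector_diff_chain_at[of "b j" "b' j t" t "\<psi> j" "\<psi>' j (b j t)"] elim that \<psi>(1)[of j]
        by (auto simp: has_real_derivative_iff_has_vector_derivative o_def)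
      have "\<exists>d. (F has_vector_derivative d) (at t) \<and> norm d \<le> (\<Sum>j\<in>{1..n}. norm (b' j t *\<^sub>R \<psi>' j (b j t)))"
        unfolding F_def by (rule has_vector_derivative_prod_bounded[OF _ dj]) (use \<psi>(2) in auto)
      then obtain d where d: "(F has_vector_derivative d) (at t)"
        "norm d \<le> (\<Sum>j\<in>{1..n}. norm (b' j t *\<^sub>R \<psi>' j (b j t)))" by blast
      have "(\<Sum>j\<in>{1..n}. norm (b' j t *\<^sub>R \<psi>' j (b j t))) \<le> (\<Sum>j\<in>{1..n}. L j * b' j t)"
      proof (rule sum_mono)
        fix j assume j: "j \<in> {1..n}"
        then have bp: "b' j t > 0" using elim by blast
        then have "b' j t * norm (\<psi>' j (b j t)) \<le> b' j t * L j"
          using j \<psi>(3)[of j] by (intro mult_left_mono) auto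
        then show "norm (b' j t *\<^sub>R \<psi>' j (b j t)) \<le> L j * b' j t"
          using bp by (simp add: mult.commute)
      qed
      then show ?case using d vector_derivative_at[OF d(1)] by auto
    qed
    then show "\<forall>\<^sub>F t in at_top. (F has_vector_derivative vector_derivative F (at t)) (at t)"
      by (rule eventually_mono) simp
    fix \<epsilon> :: real assume \<epsilon>: "\<epsilon> > 0"
    have "((\<lambda>t. \<Sum>j\<in>{1..n}. L j * (b' j t / b' (Suc n) t)) \<longlongrightarrow> (\<Sum>j\<in>{1..n}. L j * 0)) at_top"
      by (intro tendsto_intros slow)
    then have "\<forall>\<^sub>F t in at_top. (\<Sum>j\<in>{1..n}. L j * (b' j t / b' (Suc n) t)) < \<epsilon>"
      using order_tendstoD(2) \<epsilon> by fastforce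
    with F' pos[of "Suc n", simplified]
    show "\<forall>\<^sub>F t in at_top. norm (vector_derivative F (at t)) \<le> \<epsilon> * b' (Suc n) t"
    proof eventually_elim
      case (elim t)
      have "(\<Sum>j\<in>{1..n}. L j * b' j t) = (\<Sum>j\<in>{1..n}. L j * (b' j t / b' (Suc n) t)) * b' (Suc n) t"
        using elim by (simp add: sum_distrib_right)
      also have "\<dots> \<le> \<epsilon> * b' (Suc n) t" using elim by (intro mult_right_mono) auto
      finally show ?case using elim by linarith
    qed
  qed

  \<comment> \<open>The index \<open>Suc n\<close> carries the error of the oscillating
    approximation, the smaller indices that of the differentiable one.\<close>
  define g where "g = (\<lambda>j s. if j = Suc n then norm (\<phi> (Suc n) s - m (Suc n) - h s) else norm (\<phi> j s - \<psi> j s))"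
  define B where "B = 2 + N + K"
  have K: "K \<ge> 0" using hG(2)[of 0] norm_ge_zero order_trans by blast
  have gM[measurable]: "g j \<in> borel_measurable borel" if "j \<in> {1..Suc n}" for j
    using that unfolding g_def by (cases "j = Suc n") measurable
  have g0: "0 \<le> g j s" for j s by (simp add: g_def)
  have gB: "g j s \<le> B" if "j \<in> {1..Suc n}" for j s
  proof (cases "j = Suc n")
    case True
    have "norm (\<phi> (Suc n) s - m (Suc n) - h s) \<le> norm (\<phi> (Suc n) s) + norm (m (Suc n)) + norm (h s)"
      by (meson add_mono_thms_linordered_semiring(3) norm_triangle_ineq4 order_trans)
    then show ?thesis using \<phi>1[of "Suc n" s] hG(3)[of s] True by (simp add: g_def B_def N_def)
  next
    case False
    then show ?thesis using \<phi>1[OF that, of s] \<psi>(2)[OF that, of s] norm_triangle_ineq4[of "\<phi> j s" "\<psi> j s"] N K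
      by (simp add: g_def B_def)
  qed
  have gavg: "\<forall>\<^sub>F S in at_top. (LBINT s:{0..S}. g j s) \<le> e * S" if "j \<in> {1..Suc n}" for j
    using hm \<psi>(4)[OF that] by (cases "j = Suc n") (simp_all add: g_def)
  have "\<forall>\<^sub>F y in at_top. \<forall>j\<in>{1..Suc n}. (LBINT t:{0..y}. g j (b j t)) \<le> C j * e * y"
    by (rule eventually_ball_finite) (use C[OF _ gM g0 gB e gavg] in auto)
  with osc eventually_ge_at_top[of 0] show ?thesis
  proof eventually_elim
    case (elim y)
    define X where "X = (\<lambda>t. P t * (\<phi> (Suc n) (b (Suc n) t) - m (Suc n)))"
    define Y where "Y = (\<lambda>t. F t * h (b (Suc n) t))"
    have [measurable]: "\<phi> (Suc n) \<in> borel_measurable borel" "b (Suc n) \<in> borel_measurable borel" by auto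
    have XM[measurable]: "X \<in> borel_measurable borel" unfolding X_def by measurable
    have YM[measurable]: "Y \<in> borel_measurable borel" unfolding Y_def by measurable
    have X1: "norm (X t) \<le> 1 * (1 + N)" for t
      unfolding X_def norm_mult N_def
      by (intro mult_mono P1 order_trans[OF norm_triangle_ineq4] add_mono \<phi>1) auto
    have Y1: "norm (Y t) \<le> 1 * K" for t
      unfolding Y_def norm_mult by (intro mult_mono F1 hG) auto
    have XY: "norm (X t - Y t) \<le> (\<Sum>j\<in>{1..Suc n}. (1 + N) * g j (b j t))" for t
    proof -
      let ?z = "\<phi> (Suc n) (b (Suc n) t)"
      \<comment> \<open>The slow factors are exchanged while the last one, of norm at most
        \<open>1 + N\<close>, is kept; then the last one is exchanged next to \<open>F\<close>, of
        norm at most 1.\<close>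
      have "X t - Y t = (P t - F t) * (?z - m (Suc n)) + F t * (?z - m (Suc n) - h (b (Suc n) t))"
        by (simp add: X_def Y_def algebra_simps)
      then have "norm (X t - Y t) \<le> norm ((P t - F t) * (?z - m (Suc n))) +
          norm (F t * (?z - m (Suc n) - h (b (Suc n) t)))"
        by (metis norm_triangle_ineq)
      also have "norm ((P t - F t) * (?z - m (Suc n))) \<le> (\<Sum>j\<in>{1..n}. g j (b j t)) * (1 + N)"
        unfolding norm_mult
      proof (rule mult_mono)
        show "norm (P t - F t) \<le> (\<Sum>j\<in>{1..n}. g j (b j t))"
          using PF[of t] by (simp add: g_def)
        show "norm (?z - m (Suc n)) \<le> 1 + N"
          using norm_triangle_ineq4[of ?z "m (Suc n)"] \<phi>1[of "Suc n" "b (Suc n) t"] by (simp add: N_def)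
      qed (auto intro: sum_nonneg g0)
      also have "norm (F t * (?z - m (Suc n) - h (b (Suc n) t))) \<le> 1 * g (Suc n) (b (Suc n) t)"
        unfolding norm_mult by (intro mult_mono F1) (auto simp: g_def)
      also have "1 * g (Suc n) (b (Suc n) t) \<le> (1 + N) * g (Suc n) (b (Suc n) t)"
        by (intro mult_right_mono g0) (use N in auto)
      finally show ?thesis by (simp add: sum_distrib_left mult.commute)
    qed
    have gi: "set_integrable lborel {0..y} (\<lambda>t. g j (b j t))" if "j \<in> {1..Suc n}" for j
      by (rule bounded_borel_set_integrable[of _ B])
        (use that g0 gB measurable_compose[OF b[OF that] gM[OF that]] in auto)
    have Xi: "set_integrable lborel {0..y} X" "set_integrable lborel {0..y} Y"
      by (rule bounded_borel_set_integrable[OF _ X1] bounded_borel_set_integrable[OF _ Y1]; simp)+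
    have "norm ((LBINT t:{0..y}. X t) - (LBINT t:{0..y}. Y t)) = norm (LBINT t:{0..y}. X t - Y t)"
      using Xi by (simp add: set_integral_diff)
    also have "\<dots> \<le> (LBINT t:{0..y}. norm (X t - Y t))"
      by (rule set_integral_norm_bound) (use Xi in simp)
    also have "\<dots> \<le> (LBINT t:{0..y}. (\<Sum>j\<in>{1..Suc n}. (1 + N) * g j (b j t)))"
    proof (rule set_integral_mono)
      show "set_integrable lborel {0..y} (\<lambda>t. norm (X t - Y t))"
        by (rule set_integrable_norm) (use Xi in simp)
      show "set_integrable lborel {0..y} (\<lambda>t. \<Sum>j\<in>{1..Suc n}. (1 + N) * g j (b j t))"
        unfolding set_integrable_def scaleR_sum_right
        by (rule Bochner_Integration.integrable_sum)
          (use gi in \<open>auto simp: set_integrable_def mult.left_commute\<close>)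
    qed (rule XY)
    also have "\<dots> = (\<Sum>j\<in>{1..Suc n}. (1 + N) * (LBINT t:{0..y}. g j (b j t)))"
    proof -
      have "(LBINT t:{0..y}. (\<Sum>j\<in>{1..Suc n}. (1 + N) * g j (b j t))) =
          (\<Sum>j\<in>{1..Suc n}. (LBINT t:{0..y}. (1 + N) * g j (b j t)))"
        unfolding set_lebesgue_integral_def scaleR_sum_right
        by (rule Bochner_Integration.integral_sum)
          (use gi in \<open>auto simp: set_integrable_def mult.left_commute\<close>)
      then show ?thesis by simp
    qed
    also have "\<dots> \<le> (\<Sum>j\<in>{1..Suc n}. (1 + N) * (C j * e * y))"
      by (intro sum_mono mult_left_mono) (use elim N in auto)
    also have "\<dots> = ((1 + N) * D * e) * y"
      by (simp add: D_def sum_distrib_left sum_distrib_right mult_ac del: sum.cl_ivl_Suc)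
    also have "\<dots> \<le> \<eta> / 2 * y" using De elim by (intro mult_right_mono) auto
    finally have "norm ((LBINT t:{0..y}. X t) - (LBINT t:{0..y}. Y t)) \<le> \<eta> / 2 * y" .
    moreover have "norm (LBINT t:{0..y}. Y t) \<le> \<eta> / 2 * y" using elim by (simp add: Y_def)
    moreover have "norm (LBINT t:{0..y}. X t) \<le> norm ((LBINT t:{0..y}. X t) - (LBINT t:{0..y}. Y t)) +
        norm (LBINT t:{0..y}. Y t)"
      by (metis diff_add_cancel norm_triangle_ineq)
    ultimately have "norm (LBINT t:{0..y}. X t) \<le> \<eta> * y" by (simp add: algebra_simps)
    then show ?case by (simp add: X_def P_def)
  qed
qed

text \<open>Subtracting its mean from the fastest factor leaves a negligible average, and the mean
  itself factors out of a product with one factor less. The functions \<open>\<phi> j\<close> are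
  unrelated to one another; only the speeds are ordered.\<close>

theorem average_prod_tendsto:
  fixes \<phi> :: "nat \<Rightarrow> real \<Rightarrow> complex" and b b' :: "nat \<Rightarrow> real \<Rightarrow> real"
  assumes "\<And>j. j \<in> {1..n} \<Longrightarrow> b j \<in> borel_measurable borel"
    and "\<And>j. j \<in> {1..n} \<Longrightarrow> time_change (b j) (b' j)"
    and "\<And>i j. i \<in> {1..n} \<Longrightarrow> j \<in> {1..n} \<Longrightarrow> i < j \<Longrightarrow> ((\<lambda>t. b' i t / b' j t) \<longlongrightarrow> 0) at_top"
    and "\<And>j. j \<in> {1..n} \<Longrightarrow> regular_orbit (\<phi> j) (m j)"
  shows "((\<lambda>y. (1 / y) *\<^sub>R (LBINT t:{0..y}. \<Prod>j\<in>{1..n}. \<phi> j (b j t))) \<longlongrightarrow> (\<Prod>j\<in>{1..n}. m j)) at_top"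
  using assms
proof (induction n)
  case 0
  have "\<forall>\<^sub>F y::real in at_top. (1 / y) *\<^sub>R (LBINT t:{0..y}. (1::complex)) = 1"
    using eventually_gt_at_top[of 0] by eventually_elim (simp add: set_integral_const)
  then show ?case by (simp add: tendsto_eventually)
next
  case (Suc n)
  define P where "P = (\<lambda>t. \<Prod>j\<in>{1..n}. \<phi> j (b j t))"
  define z where "z = (\<lambda>t. \<phi> (Suc n) (b (Suc n) t))"
  let ?m = "m (Suc n)"
  have \<phi>: "\<phi> j \<in> borel_measurable borel" "norm (\<phi> j s) \<le> 1" if "j \<in> {1..Suc n}" for j s
    using Suc.prems(4)[OF that] by (auto simp: regular_orbit_def)
  have PM[measurable]: "P \<in> borel_measurable borel"
    unfolding P_def by (intro borel_measurable_prod measurable_compose[OF Suc.prems(1)] \<phi>) auto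
  have zM[measurable]: "z \<in> borel_measurable borel"
    unfolding z_def by (intro measurable_compose[OF Suc.prems(1)] \<phi>) auto
  have P1: "norm (P t) \<le> 1" for t
    unfolding P_def prod_norm[symmetric] by (rule prod_le_1) (use \<phi>(2) in auto)
  have z1: "norm (z t - ?m) \<le> 1 + norm ?m" for t
    unfolding z_def by (intro order_trans[OF norm_triangle_ineq4] add_mono \<phi>) auto
  have Pi: "set_integrable lborel {0..y} P" for y
    by (rule bounded_borel_set_integrable[OF PM P1])
  have Pz1: "norm (P t * (z t - ?m)) \<le> 1 * (1 + norm ?m)" for t
    unfolding norm_mult by (intro mult_mono P1 z1) auto
  have Pzi: "set_integrable lborel {0..y} (\<lambda>t. P t * (z t - ?m))" for y
    by (rule bounded_borel_set_integrable[OF _ Pz1]) measurable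
  have lim1: "((\<lambda>y. (1 / y) *\<^sub>R (LBINT t:{0..y}. P t * (z t - ?m))) \<longlongrightarrow> 0) at_top"
    unfolding tendsto_iff dist_norm
  proof (intro allI impI)
    fix \<epsilon> :: real assume \<epsilon>: "\<epsilon> > 0"
    have "\<forall>\<^sub>F y in at_top. norm (LBINT t:{0..y}. P t * (z t - ?m)) \<le> (\<epsilon> / 2) * y"
      unfolding P_def z_def by (rule average_prod_step) (use Suc.prems \<epsilon> in auto)
    with eventually_gt_at_top[of 0]
    show "\<forall>\<^sub>F y in at_top. norm ((1 / y) *\<^sub>R (LBINT t:{0..y}. P t * (z t - ?m)) - 0) < \<epsilon>"
    proof eventually_elim
      case (elim y)
      then have "norm (LBINT t:{0..y}. P t * (z t - ?m)) < \<epsilon> * y"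
        using \<epsilon> by (smt (verit) field_sum_of_halves mult_pos_pos mult_less_cancel_right)
      then show ?case using elim by (simp add: field_simps)
    qed
  qed
  have lim2: "((\<lambda>y. (1 / y) *\<^sub>R (LBINT t:{0..y}. P t)) \<longlongrightarrow> (\<Prod>j\<in>{1..n}. m j)) at_top"
    unfolding P_def by (rule Suc.IH) (use Suc.prems in auto)
  have "(LBINT t:{0..y}. P t * z t) = (LBINT t:{0..y}. P t * (z t - ?m)) + (LBINT t:{0..y}. P t) * ?m" for y
  proof -
    have "(LBINT t:{0..y}. P t * z t) = (LBINT t:{0..y}. P t * (z t - ?m) + P t * ?m)"
      by (simp add: algebra_simps)
    also have "\<dots> = (LBINT t:{0..y}. P t * (z t - ?m)) + (LBINT t:{0..y}. P t * ?m)"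
      using Pzi Pi by (intro set_integral_add) auto
    finally show ?thesis by simp
  qed
  then have "(\<lambda>y. (1 / y) *\<^sub>R (LBINT t:{0..y}. \<Prod>j\<in>{1..Suc n}. \<phi> j (b j t))) =
      (\<lambda>y. (1 / y) *\<^sub>R (LBINT t:{0..y}. P t * (z t - ?m)) + ((1 / y) *\<^sub>R (LBINT t:{0..y}. P t)) * ?m)"
    by (simp add: P_def z_def scaleR_add_right)
  then show ?case using tendsto_add[OF lim1 tendsto_mult_right[OF lim2, of ?m]] by simp
qed

section \<open>Birkhoff's theorem for flows\<close>

text \<open>Boundedness makes the extended real limsup finite, so coercing it to a real loses
  nothing and later arguments can be phrased with real inequalities.\<close>

lemma real_limsup_properties:
  fixes u :: "nat \<Rightarrow> real"
  assumes K: "\<And>n. \<bar>u n\<bar> \<le> K"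
  defines "L \<equiv> real_of_ereal (limsup (\<lambda>n. ereal (u n)))"
  shows "\<epsilon> > 0 \<Longrightarrow> \<forall>\<^sub>F n in sequentially. u n < L + \<epsilon>"
    and "\<forall>\<^sub>F n in sequentially. u n \<le> c \<Longrightarrow> L \<le> c"
    and "\<bar>L\<bar> \<le> K"
proof -
  have ub: "u n \<le> K" and lb: "- K \<le> u n" for n using K[of n] by auto
  have le: "limsup (\<lambda>n. ereal (u n)) \<le> ereal K"
    by (rule Limsup_bounded) (use ub in auto)
  have ge: "ereal (- K) \<le> limsup (\<lambda>n. ereal (u n))"
    by (rule order_trans[OF Liminf_bounded Liminf_le_Limsup]) (use lb in auto)
  have eq: "ereal L = limsup (\<lambda>n. ereal (u n))"
    using le ge unfolding L_def by (cases "limsup (\<lambda>n. ereal (u n))") auto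
  show "\<bar>L\<bar> \<le> K" using le ge unfolding eq[symmetric] by auto
  show "\<forall>\<^sub>F n in sequentially. u n < L + \<epsilon>" if "\<epsilon> > 0"
  proof -
    have "limsup (\<lambda>n. ereal (u n)) < ereal (L + \<epsilon>)" using that by (simp flip: eq)
    from Limsup_lessD[OF this] show ?thesis by simp
  qed
  show "L \<le> c" if "\<forall>\<^sub>F n in sequentially. u n \<le> c"
  proof -
    have "limsup (\<lambda>n. ereal (u n)) \<le> ereal c"
      by (rule Limsup_bounded) (use that in simp)
    then show ?thesis by (simp flip: eq)
  qed
qed

text \<open>Shifting a window trades a piece of length \<open>\<bar>s' - s\<bar>\<close> at one end
  for one at the other, and each carries at most \<open>K\<close> times its length.\<close>

lemma window_lipschitz:
  fixes \<phi> :: "real \<Rightarrow> 'b::{banach, second_countable_topology}"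
  assumes \<phi>: "\<phi> \<in> borel_measurable borel" "\<And>t. norm (\<phi> t) \<le> K" and r: "r \<ge> 0"
  shows "norm ((LBINT v:{s'..s'+r}. \<phi> v) - (LBINT v:{s..s+r}. \<phi> v)) \<le> 2 * K * \<bar>s' - s\<bar>"
proof -
  have small: "norm (LBINT v:{a..b}. \<phi> v) \<le> K * (b - a)" if "a \<le> b" for a b
  proof -
    have "norm (LBINT v:{a..b}. \<phi> v) \<le> (LBINT v:{a..b}. norm (\<phi> v))"
      by (rule set_integral_norm_bound[OF bounded_borel_set_integrable[OF \<phi>]])
    also have "\<dots> \<le> K * (b - a)"
      by (rule set_integral_le_const) (use \<phi> that in auto)
    finally show ?thesis .
  qed
  have *: "norm ((LBINT v:{s'..s'+r}. \<phi> v) - (LBINT v:{s..s+r}. \<phi> v)) \<le> 2 * K * (s' - s)"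
    if "s \<le> s'" for s s'
  proof -
    have "(LBINT v:{s..s'+r}. \<phi> v) = (LBINT v:{s..s'}. \<phi> v) + (LBINT v:{s'..s'+r}. \<phi> v)"
      "(LBINT v:{s..s'+r}. \<phi> v) = (LBINT v:{s..s+r}. \<phi> v) + (LBINT v:{s+r..s'+r}. \<phi> v)"
      by (rule set_integral_split_Icc[OF \<phi>]; use that r in simp)+
    then have eq: "(LBINT v:{s'..s'+r}. \<phi> v) - (LBINT v:{s..s+r}. \<phi> v) =
        (LBINT v:{s+r..s'+r}. \<phi> v) - (LBINT v:{s..s'}. \<phi> v)"
      by (simp add: algebra_simps)
    show ?thesis
      unfolding eq using norm_triangle_ineq4[of "LBINT v:{s+r..s'+r}. \<phi> v" "LBINT v:{s..s'}. \<phi> v"]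
        small[of "s+r" "s'+r"] small[of s s'] that by (simp add: algebra_simps)
  qed
  show ?thesis
    using *[of s s'] *[of s' s] by (cases "s \<le> s'") (auto simp: norm_minus_commute abs_if)
qed

lemma window_continuous:
  fixes \<phi> :: "real \<Rightarrow> 'b::{banach, second_countable_topology}"
  assumes \<phi>: "\<phi> \<in> borel_measurable borel" "\<And>t. norm (\<phi> t) \<le> K" and r: "r \<ge> 0"
  shows "continuous_on UNIV (\<lambda>s. LBINT v:{s..s+r}. \<phi> v)"
proof (rule lipschitz_on_continuous_on)
  have "K \<ge> 0" using \<phi>(2)[of 0] norm_ge_zero order_trans by blast
  then show "(2 * K)-lipschitz_on UNIV (\<lambda>s. LBINT v:{s..s+r}. \<phi> v)"
    unfolding lipschitz_on_def dist_norm real_norm_def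
    using window_lipschitz[OF \<phi> r] by auto
qed

text \<open>\<open>Q\<close> is an antiderivative on the whole line, so its differences describe
  windows at negative \<open>s\<close> as well, without sign conventions.\<close>

lemma continuous_antiderivative:
  fixes \<phi> :: "real \<Rightarrow> complex"
  assumes "continuous_on UNIV \<phi>"
  obtains Q where "\<forall>s. (Q has_vector_derivative \<phi> s) (at s)"
    and "\<forall>s r. r \<ge> 0 \<longrightarrow> (LBINT v:{s..s+r}. \<phi> v) = Q (s + r) - Q s"
proof -
  have "\<exists>Q. \<forall>x::real. -\<infinity> < ereal x \<longrightarrow> ereal x < \<infinity> \<longrightarrow> (Q has_vector_derivative \<phi> x) (at x)"
    by (rule einterval_antiderivative) (use assms in \<open>auto simp: continuous_on_eq_continuous_at\<close>)
  then obtain Q where Q: "\<And>s. (Q has_vector_derivative \<phi> s) (at s)" by auto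
  moreover have "(LBINT v:{s..s+r}. \<phi> v) = Q (s + r) - Q s" if "r \<ge> 0" for s r
    unfolding set_lebesgue_integral_def
    by (rule integral_FTC_atLeastAtMost)
      (use that Q assms in \<open>auto intro: has_vector_derivative_at_within continuous_on_subset\<close>)
  ultimately show ?thesis using that by blast
qed

text \<open>Lebesgue differentiation along one-sided intervals of length \<open>1 / (n + 1)\<close>.
  The exceptional set is negligible for the gauge integral, that is, null for the completed measure,
  and this passes to \<open>lborel\<close>.\<close>

lemma AE_tendsto_shrinking_window:
  fixes \<phi> :: "real \<Rightarrow> complex"
  assumes \<phi>[measurable]: "\<phi> \<in> borel_measurable borel" and K: "\<And>t. norm (\<phi> t) \<le> K"
  shows "AE s in lborel. (\<lambda>n. real (Suc n) *\<^sub>R (LBINT v:{s..s + 1 / real (Suc n)}. \<phi> v)) \<longlonglongrightarrow> \<phi> s"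
proof -
  have si: "set_integrable lborel {a..b} \<phi>" for a b
    by (rule bounded_borel_set_integrable[OF \<phi> K])
  have "\<phi> integrable_on cbox a b" for a b
    using set_borel_integral_eq_integral(1)[OF si] by simp
  then obtain N where N: "negligible N" and lim: "\<And>x e. \<lbrakk>x \<notin> N; 0 < e\<rbrakk> \<Longrightarrow>
      \<exists>d>0. \<forall>h. 0 < h \<and> h < d \<longrightarrow>
        norm (integral (cbox x (x + h *\<^sub>R One)) \<phi> /\<^sub>R h ^ DIM(real) - \<phi> x) < e"
    using integrable_ccontinuous_explicit[of \<phi>] by blast
  have "AE s in lebesgue. s \<notin> N"
    using N by (intro AE_not_in) (simp add: negligible_iff_null_sets)
  then have "AE s in lborel. s \<notin> N"
    by (simp add: AE_completion_iff)
  then show ?thesis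
  proof eventually_elim
    case (elim s)
    show ?case unfolding LIMSEQ_iff
    proof (intro allI impI)
      fix e :: real assume "e > 0"
      then obtain d where d: "d > 0" "\<And>h. 0 < h \<Longrightarrow> h < d \<Longrightarrow>
        norm (integral (cbox s (s + h *\<^sub>R One)) \<phi> /\<^sub>R h ^ DIM(real) - \<phi> s) < e"
        using lim[OF elim] by blast
      obtain n0 where n0: "1 / real (Suc n0) < d" using d(1) nat_approx_posE by blast
      have "norm (real (Suc n) *\<^sub>R (LBINT v:{s..s + 1 / real (Suc n)}. \<phi> v) - \<phi> s) < e" if "n \<ge> n0" for n
      proof -
        have "1 / real (Suc n) \<le> 1 / real (Suc n0)" using that by (simp add: frac_le)
        then have "1 / real (Suc n) < d" using n0 by simp
        from d(2)[OF _ this] have "norm (real (Suc n) *\<^sub>R integral {s..s + 1 / real (Suc n)} \<phi> - \<phi> s) < e"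
          by simp
        then show ?thesis by (simp add: set_borel_integral_eq_integral(2)[OF si])
      qed
      then show "\<exists>n0. \<forall>n\<ge>n0. norm (real (Suc n) *\<^sub>R (LBINT v:{s..s + 1 / real (Suc n)}. \<phi> v) - \<phi> s) < e"
        by blast
    qed
  qed
qed

text \<open>
  Garsia's argument: \<open>Mx n\<close> is the maximum of \<open>0\<close> and the first \<open>n\<close> ergodic sums, and
  \<open>F \<ge> Mx n - Mx n \<circ> \<tau>\<close> wherever \<open>Mx n > 0\<close>.
\<close>

lemma (in prob_space) maximal_ergodic:
  fixes F :: "'a \<Rightarrow> real" and \<tau> :: "'a \<Rightarrow> 'a"
  assumes \<tau>[measurable]: "\<tau> \<in> measurable M M" and mp: "distr M M \<tau> = M"
    and F[measurable]: "F \<in> borel_measurable M" and K: "\<And>x. x \<in> space M \<Longrightarrow> \<bar>F x\<bar> \<le> K"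
    and s0: "\<And>x. x \<in> space M \<Longrightarrow> s 0 x \<le> 0"
    and s: "\<And>x n. x \<in> space M \<Longrightarrow> s (Suc n) x = F x + s n (\<tau> x)"
    and pos: "\<And>x. x \<in> space M \<Longrightarrow> \<exists>n. s n x > 0"
  shows "0 \<le> (\<integral>x. F x \<partial>M)"
proof -
  define Mx where "Mx = rec_nat (\<lambda>_. 0) (\<lambda>n m x. max 0 (F x + m (\<tau> x)))"
  have Mx0: "Mx 0 = (\<lambda>_. 0)" and MxS: "Mx (Suc n) = (\<lambda>x. max 0 (F x + Mx n (\<tau> x)))" for n
    by (simp_all add: Mx_def)
  have \<tau>s: "\<tau> x \<in> space M" if "x \<in> space M" for x using measurable_space[OF \<tau> that] .
  have [measurable]: "Mx n \<in> borel_measurable M" for n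
    by (induction n) (simp_all add: Mx0 MxS)
  have nonneg: "0 \<le> Mx n x" for n x by (cases n) (simp_all add: Mx0 MxS)
  have mono: "Mx n x \<le> Mx (Suc n) x" if "x \<in> space M" for n x
    using that
  proof (induction n arbitrary: x)
    case 0
    then show ?case by (simp add: Mx0 MxS)
  next
    case (Suc n)
    then show ?case using Suc.IH[OF \<tau>s[OF Suc.prems]] unfolding MxS[of n] MxS[of "Suc n"] by simp
  qed
  have Mxs: "s n x \<le> Mx n x" if "x \<in> space M" for n x
    using that
  proof (induction n arbitrary: x)
    case 0
    then show ?case using s0 by (simp add: Mx0)
  next
    case (Suc n)
    then show ?case using Suc.IH[OF \<tau>s[OF Suc.prems]] s[OF Suc.prems] unfolding MxS by simp
  qed
  have bdd: "norm (Mx n x) \<le> real n * K" if "x \<in> space M" for n x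
    using that
  proof (induction n arbitrary: x)
    case 0
    then show ?case by (simp add: Mx0)
  next
    case (Suc n)
    have "Mx n (\<tau> x) \<le> real n * K" using Suc.IH[OF \<tau>s[OF Suc.prems]] by simp
    moreover have "F x \<le> K" "0 \<le> K" using K[OF Suc.prems] by auto
    ultimately show ?case unfolding MxS by (simp add: algebra_simps)
  qed
  have int: "integrable M (Mx n)" for n
    by (rule integrable_const_bound[of _ "real n * K"]) (use bdd in \<open>auto intro!: AE_I2\<close>)
  \<comment> \<open>\<open>E n\<close> is \<open>F\<close> cut off to the set where
    \<open>Mx (Suc n)\<close> is positive. Its integral dominates that of
    \<open>Mx (Suc n) - Mx (Suc n) \<circ> \<tau>\<close>, which is 0.\<close>
  define E where "E = (\<lambda>n x. if Mx (Suc n) x > 0 then F x else 0)"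
  have [measurable]: "E n \<in> borel_measurable M" for n unfolding E_def by measurable
  have Eb: "norm (E n x) \<le> K" if "x \<in> space M" for n x
    using K[OF that] by (auto simp: E_def)
  have intE: "integrable M (E n)" for n
    by (rule integrable_const_bound[of _ K]) (use Eb in \<open>auto intro!: AE_I2\<close>)
  have ge: "0 \<le> (\<integral>x. E n x \<partial>M)" for n
  proof -
    have inteq: "(\<integral>x. Mx (Suc n) (\<tau> x) \<partial>M) = (\<integral>x. Mx (Suc n) x \<partial>M)"
      using integral_distr[OF \<tau>, of "Mx (Suc n)"] by (simp add: mp)
    have int': "integrable M (\<lambda>x. Mx (Suc n) (\<tau> x))"
      by (rule integrable_const_bound[of _ "real (Suc n) * K"])
        (use bdd[OF \<tau>s] in \<open>auto intro!: AE_I2 simp del: of_nat_Suc\<close>)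
    have "0 = (\<integral>x. Mx (Suc n) x - Mx (Suc n) (\<tau> x) \<partial>M)"
      using inteq int int' by simp
    also have "\<dots> \<le> (\<integral>x. E n x \<partial>M)"
    proof (rule integral_mono)
      fix x assume x: "x \<in> space M"
      show "Mx (Suc n) x - Mx (Suc n) (\<tau> x) \<le> E n x"
      proof (cases "Mx (Suc n) x > 0")
        case True
        then have "Mx (Suc n) x = F x + Mx n (\<tau> x)" unfolding MxS by (simp add: max_def split: if_splits)
        then show ?thesis using True mono[OF \<tau>s[OF x], of n] by (simp add: E_def)
      next
        case False
        then show ?thesis using nonneg[of "Suc n" x] nonneg[of "Suc n" "\<tau> x"] by (simp add: E_def)
      qed
    qed (use int int' intE in auto)
    finally show ?thesis .
  qed
  \<comment> \<open>By \<open>pos\<close>, each point belongs to the cut-off set for all large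
    \<open>n\<close>, so the cut-off disappears in the limit.\<close>
  have "(\<lambda>n. \<integral>x. E n x \<partial>M) \<longlonglongrightarrow> (\<integral>x. F x \<partial>M)"
  proof (rule integral_dominated_convergence[where w = "\<lambda>_. K"])
    show "AE x in M. (\<lambda>n. E n x) \<longlonglongrightarrow> F x"
    proof (rule AE_I2)
      fix x assume x: "x \<in> space M"
      obtain n0 where "s n0 x > 0" using pos[OF x] by blast
      then have n0: "Mx n0 x > 0" using Mxs[OF x, of n0] by simp
      have "Mx n x \<ge> Mx n0 x" if "n \<ge> n0" for n
        using that by (induction rule: dec_induct) (auto intro: order_trans[OF _ mono[OF x]])
      then have "E n x = F x" if "n \<ge> n0" for n using n0 that unfolding E_def
        by (metis le_SucI less_le_trans)
      then show "(\<lambda>n. E n x) \<longlonglongrightarrow> F x"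
        by (intro tendsto_eventually) (auto simp: eventually_sequentially)
    qed
  qed (use Eb in \<open>auto intro!: AE_I2\<close>)
  then show ?thesis by (rule LIMSEQ_le_const) (use ge in auto)
qed

section \<open>Window averages of a probability preserving flow\<close>

locale probability_flow = prob_space M for M :: "'a measure" +
  fixes T :: "real \<Rightarrow> 'a \<Rightarrow> 'a"
  assumes flow: "measure_preserving_flow M T"
begin

lemma flow_measurable [measurable]: "T t \<in> measurable M M"
  and flow_distr: "distr M M (T t) = M"
  and flow_add: "x \<in> space M \<Longrightarrow> T (s + t) x = T s (T t x)"
  and flow_joint: "(\<lambda>(t, x). T t x) \<in> measurable (borel \<Otimes>\<^sub>M M) M"
  using flow unfolding measure_preserving_flow_def by auto

lemma flow_space: "x \<in> space M \<Longrightarrow> T t x \<in> space M"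
  by (rule measurable_space[OF flow_measurable])

text \<open>Joint measurability of the flow enters here: orbits, window integrals and the Fubini
  arguments all need \<open>T\<close> with both arguments varying.\<close>

lemma flow_compose_measurable [measurable (raw)]:
  assumes "g \<in> borel_measurable N" "h \<in> measurable N M"
  shows "(\<lambda>y. T (g y) (h y)) \<in> measurable N M"
  using measurable_compose[OF measurable_Pair[OF assms] flow_joint] by simp

lemma orbit_measurable:
  assumes "f \<in> borel_measurable M" "x \<in> space M"
  shows "(\<lambda>s. f (T s x)) \<in> borel_measurable borel"
proof -
  have "(\<lambda>s. T s x) \<in> measurable borel M"
    using assms(2) by (intro flow_compose_measurable) auto
  then show ?thesis by (rule measurable_compose) (rule assms)
qed

lemma integral_flow:
  fixes g :: "'a \<Rightarrow> 'b::{banach, second_countable_topology}"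
  assumes "g \<in> borel_measurable M"
  shows "(\<integral>x. g (T t x) \<partial>M) = (\<integral>x. g x \<partial>M)"
  using integral_distr[OF flow_measurable assms, of t] by (simp add: flow_distr)

text \<open>Used with large \<open>r\<close> for ergodic averages and with small \<open>r\<close> to
  smooth along the flow. At \<open>r = 0\<close> the value is 0, so norm bounds extend to all
  \<open>r \<ge> 0\<close>.\<close>

definition window :: "('a \<Rightarrow> 'b::{banach, second_countable_topology}) \<Rightarrow> real \<Rightarrow> 'a \<Rightarrow> 'b"
  where "window f r x = (1 / r) *\<^sub>R (LBINT u:{0..r}. f (T u x))"

lemma window_integral_measurable:
  fixes f :: "'a \<Rightarrow> 'b::{banach, second_countable_topology}"
  assumes [measurable]: "f \<in> borel_measurable M"
  shows "(\<lambda>x. LBINT u:{0..r}. f (T u x)) \<in> borel_measurable M"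
  unfolding set_lebesgue_integral_def
  by (rule lborel.borel_measurable_lebesgue_integral) measurable

lemma window_measurable [measurable]:
  fixes f :: "'a \<Rightarrow> 'b::{banach, second_countable_topology}"
  assumes "f \<in> borel_measurable M"
  shows "window f r \<in> borel_measurable M"
  unfolding window_def using window_integral_measurable[OF assms] by measurable

lemma window_norm_le:
  fixes f :: "'a \<Rightarrow> 'b::{banach, second_countable_topology}"
  assumes f: "f \<in> borel_measurable M" and K: "\<And>x. x \<in> space M \<Longrightarrow> norm (f x) \<le> K"
    and x: "x \<in> space M" and r: "r \<ge> 0"
  shows "norm (window f r x) \<le> K"
proof -
  have K0: "K \<ge> 0" using K[OF x] norm_ge_zero order_trans by blast
  note o = orbit_measurable[OF f x] K[OF flow_space[OF x]]
  have "norm (LBINT u:{0..r}. f (T u x)) \<le> (LBINT u:{0..r}. norm (f (T u x)))"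
    by (rule set_integral_norm_bound[OF bounded_borel_set_integrable[OF o]])
  also have "\<dots> \<le> K * (r - 0)"
    by (rule set_integral_le_const) (use o r in auto)
  finally show ?thesis using r K0 by (cases "r = 0") (auto simp: window_def field_simps)
qed

lemma orbit_shift:
  fixes f :: "'a \<Rightarrow> 'b::{banach, second_countable_topology}"
  assumes x: "x \<in> space M"
  shows "(LBINT u:{0..r}. f (T u (T s x))) = (LBINT v:{s..s+r}. f (T v x))"
proof -
  have "(LBINT v:{s..s+r}. f (T v x)) =
      (\<integral>u. indicator {s..s+r} (s + 1 * u) *\<^sub>R f (T (s + 1 * u) x) \<partial>lborel)"
    unfolding set_lebesgue_integral_def by (subst lborel_integral_real_affine[of 1 _ s]) simp_all
  also have "\<dots> = (LBINT u:{0..r}. f (T u (T s x)))"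
    unfolding set_lebesgue_integral_def
    by (rule Bochner_Integration.integral_cong)
      (auto simp: indicator_def flow_add[OF x, symmetric] add.commute)
  finally show ?thesis ..
qed

lemma window_flow:
  fixes f :: "'a \<Rightarrow> 'b::{banach, second_countable_topology}"
  assumes "x \<in> space M"
  shows "window f r (T s x) = (1 / r) *\<^sub>R (LBINT v:{s..s+r}. f (T v x))"
  unfolding window_def orbit_shift[OF assms] ..

text \<open>By Fubini it suffices to treat \<open>f (T u x) * h x\<close> for fixed
  \<open>u\<close>; there \<open>h x\<close> may be replaced by \<open>h (T u x)\<close>, and
  \<open>T u\<close> preserves the integral. With \<open>h = 1\<close> windows keep the integral;
  with the conjugate of an invariant function they keep the inner products that determine the
  projection.\<close>

lemma integral_window_mult:
  fixes f h :: "'a \<Rightarrow> 'b::{real_normed_field, banach, second_countable_topology}"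
  assumes f[measurable]: "f \<in> borel_measurable M" and K: "\<And>x. x \<in> space M \<Longrightarrow> norm (f x) \<le> K"
    and h: "integrable M h" and inv: "\<And>t. AE x in M. h (T t x) = h x" and r: "r > 0"
  shows "(\<integral>x. window f r x * h x \<partial>M) = (\<integral>x. f x * h x \<partial>M)"
proof -
  interpret P: pair_sigma_finite M lborel by unfold_locales
  have [measurable]: "h \<in> borel_measurable M" using h by simp
  define g where "g = (\<lambda>(x, u). indicator {0..r} u *\<^sub>R (f (T u x) * h x))"
  have gM[measurable]: "g \<in> borel_measurable (M \<Otimes>\<^sub>M lborel)" unfolding g_def by measurable
  obtain x0 where "x0 \<in> space M" using not_empty by blast
  then have K0: "K \<ge> 0" using K[of x0] norm_ge_zero order_trans by blast
  have hu: "integrable M (\<lambda>x. f (T u x) * h x)" for u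
    by (rule Bochner_Integration.integrable_bound[of M "\<lambda>x. K * norm (h x)"])
      (use h K[OF flow_space] K0 in \<open>auto intro!: AE_I2 mult_right_mono simp: norm_mult\<close>)
  have orb: "set_integrable lborel {0..r} (\<lambda>u. f (T u x) * h x)" if "x \<in> space M" for x
    by (rule bounded_borel_set_integrable[of _ "K * norm (h x)"])
      (use orbit_measurable[OF f that] K[OF flow_space[OF that]] in \<open>auto simp: norm_mult intro!: mult_right_mono\<close>)
  have "integrable (M \<Otimes>\<^sub>M lborel) g"
  proof (rule P.Fubini_integrable[OF gM])
    have le: "norm (\<integral>u. norm (g (x, u)) \<partial>lborel) \<le> norm (r * (K * norm (h x)))" if x: "x \<in> space M" for x
    proof -
      have "(\<integral>u. norm (g (x, u)) \<partial>lborel) = (LBINT u:{0..r}. norm (f (T u x) * h x))"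
        unfolding set_lebesgue_integral_def g_def
        by (rule Bochner_Integration.integral_cong) (auto simp: indicator_def)
      also have "\<dots> \<le> (K * norm (h x)) * (r - 0)"
        by (rule set_integral_le_const)
          (use r orbit_measurable[OF f x] K[OF flow_space[OF x]] in \<open>auto simp: norm_mult intro!: mult_right_mono\<close>)
      finally have "(\<integral>u. norm (g (x, u)) \<partial>lborel) \<le> r * (K * norm (h x))" by (simp add: mult.commute)
      then have "\<bar>\<integral>u. norm (g (x, u)) \<partial>lborel\<bar> \<le> \<bar>r * (K * norm (h x))\<bar>"
        by (subst abs_of_nonneg) (auto intro: order_trans[OF _ abs_ge_self])
      then show ?thesis by simp
    qed
    show "integrable M (\<lambda>x. \<integral>u. norm (g (x, u)) \<partial>lborel)"
    proof (rule Bochner_Integration.integrable_bound[of M "\<lambda>x. r * (K * norm (h x))"])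
      show "integrable M (\<lambda>x. r * (K * norm (h x)))"
        by (intro integrable_mult_right integrable_norm h)
      show "(\<lambda>x. \<integral>u. norm (g (x, u)) \<partial>lborel) \<in> borel_measurable M"
        by (rule lborel.borel_measurable_lebesgue_integral) measurable
    qed (intro AE_I2 le)
    show "AE x in M. integrable lborel (\<lambda>u. g (x, u))"
      using orb by (intro AE_I2) (auto simp: g_def set_integrable_def)
  qed
  from P.Fubini_integral[of "\<lambda>x u. g (x, u)"] this
  have "(\<integral>u. \<integral>x. g (x, u) \<partial>M \<partial>lborel) = (\<integral>x. \<integral>u. g (x, u) \<partial>lborel \<partial>M)"
    by simp
  moreover have "(\<integral>x. g (x, u) \<partial>M) = indicator {0..r} u *\<^sub>R (\<integral>x. f x * h x \<partial>M)" for u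
  proof -
    have "(\<integral>x. f (T u x) * h x \<partial>M) = (\<integral>x. f (T u x) * h (T u x) \<partial>M)"
      by (rule integral_cong_AE) (use inv[of u] in auto)
    also have "\<dots> = (\<integral>x. f x * h x \<partial>M)"
      by (rule integral_flow) measurable
    finally show ?thesis by (simp add: g_def)
  qed
  moreover have "(\<integral>u. indicator {0..r} u *\<^sub>R (\<integral>x. f x * h x \<partial>M) \<partial>lborel) = r *\<^sub>R (\<integral>x. f x * h x \<partial>M)"
    using set_integral_const[of "{0..r}" lborel "\<integral>x. f x * h x \<partial>M"] r by (simp add: set_lebesgue_integral_def)
  moreover have "(\<integral>u. g (x, u) \<partial>lborel) = r *\<^sub>R (window f r x * h x)" for x
  proof -
    have "(\<integral>u. g (x, u) \<partial>lborel) = (LBINT u:{0..r}. f (T u x)) * h x"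
      unfolding g_def prod.case mult_scaleR_left[symmetric] set_lebesgue_integral_def
      by (rule integral_mult_left_zero)
    then show ?thesis using r by (simp add: window_def)
  qed
  ultimately show ?thesis using r by simp
qed

text \<open>The cocycle identity that turns integrals over \<open>[0, n]\<close> into ergodic sums
  of \<open>window f 1\<close> under the map \<open>T 1\<close>.\<close>

lemma window_Suc:
  fixes f :: "'a \<Rightarrow> 'b::{banach, second_countable_topology}"
  assumes f: "f \<in> borel_measurable M" and K: "\<And>x. x \<in> space M \<Longrightarrow> norm (f x) \<le> K" and x: "x \<in> space M"
  shows "(LBINT u:{0..real (Suc n)}. f (T u x)) =
    (LBINT u:{0..1}. f (T u x)) + (LBINT u:{0..real n}. f (T u (T 1 x)))"
proof -
  have "(LBINT u:{0..real (Suc n)}. f (T u x)) =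
      (LBINT u:{0..1}. f (T u x)) + (LBINT u:{1..real (Suc n)}. f (T u x))"
    by (rule set_integral_split_Icc[OF orbit_measurable[OF f x] K[OF flow_space[OF x]]]) auto
  also have "real (Suc n) = 1 + real n" by simp
  finally show ?thesis unfolding orbit_shift[OF x] by simp
qed

section \<open>Birkhoff's theorem through upper means\<close>

text \<open>A limsup over integer lengths only, so measurability is that of a countable limsup; real
  lengths are recovered later by rounding up. It is defined at every point, so no exceptional set
  has to be carried along.\<close>

definition upper_mean :: "('a \<Rightarrow> real) \<Rightarrow> 'a \<Rightarrow> real"
  where "upper_mean f x = real_of_ereal (limsup (\<lambda>n. ereal (window f (real n) x)))"

context
  fixes f :: "'a \<Rightarrow> real" and K :: real
  assumes f[measurable]: "f \<in> borel_measurable M" and Kball: "\<forall>x\<in>space M. \<bar>f x\<bar> \<le> K"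
begin

lemma abs_le_bound: "x \<in> space M \<Longrightarrow> \<bar>f x\<bar> \<le> K" using Kball by blast

lemma window_abs_le: "x \<in> space M \<Longrightarrow> \<bar>window f (real n) x\<bar> \<le> K"
  using window_norm_le[OF f, of K] abs_le_bound by simp

lemma upper_mean_measurable [measurable]: "upper_mean f \<in> borel_measurable M"
  unfolding upper_mean_def by measurable

lemma upper_mean_bound: "x \<in> space M \<Longrightarrow> \<bar>upper_mean f x\<bar> \<le> K"
  unfolding upper_mean_def by (rule real_limsup_properties(3)) (rule window_abs_le)

lemma upper_mean_gt:
  "x \<in> space M \<Longrightarrow> \<epsilon> > 0 \<Longrightarrow> \<forall>\<^sub>F n in sequentially. window f (real n) x < upper_mean f x + \<epsilon>"
  unfolding upper_mean_def by (rule real_limsup_properties(1)[OF window_abs_le])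

lemma upper_mean_le:
  "x \<in> space M \<Longrightarrow> \<forall>\<^sub>F n in sequentially. window f (real n) x \<le> c \<Longrightarrow> upper_mean f x \<le> c"
  unfolding upper_mean_def by (rule real_limsup_properties(2)[OF window_abs_le])

lemma window_flow_close:
  assumes x: "x \<in> space M"
  shows "(\<lambda>n. window f (real n) (T t x) - window f (real n) x) \<longlonglongrightarrow> 0"
proof (rule Lim_null_comparison)
  have "norm (window f (real n) (T t x) - window f (real n) x) \<le> 2 * K * \<bar>t\<bar> / real n" for n
  proof -
    have "norm ((LBINT v:{t..t+real n}. f (T v x)) - (LBINT v:{0..0+real n}. f (T v x))) \<le> 2 * K * \<bar>t - 0\<bar>"
      by (rule window_lipschitz[OF orbit_measurable[OF f x]]) (use abs_le_bound[OF flow_space[OF x]] in auto)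
    then show ?thesis
      unfolding window_flow[OF x] unfolding window_def real_scaleR_def real_norm_def
      by (simp flip: right_diff_distrib diff_divide_distrib add: abs_mult divide_right_mono)
  qed
  then show "\<forall>\<^sub>F n in sequentially. norm (window f (real n) (T t x) - window f (real n) x) \<le> 2 * K * \<bar>t\<bar> / real n"
    by simp
  show "(\<lambda>n. 2 * K * \<bar>t\<bar> / real n) \<longlonglongrightarrow> 0" by (rule lim_const_over_n)
qed

text \<open>Averages of length \<open>n\<close> from \<open>x\<close> and from \<open>T t x\<close>
  differ by at most \<open>2 * K * \<bar>t\<bar> / n\<close>. The equality holds at every point and
  for every real \<open>t\<close>, which later makes the mean constant along an orbit.\<close>

lemma upper_mean_invariant:
  assumes x: "x \<in> space M"
  shows "upper_mean f (T t x) = upper_mean f x"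
proof -
  have close: "\<forall>\<^sub>F n in sequentially. \<bar>window f (real n) (T t x) - window f (real n) x\<bar> < \<epsilon>" if "\<epsilon> > 0" for \<epsilon>
    using tendstoD[OF window_flow_close[OF x] that] by (simp add: dist_norm)
  have 1: "upper_mean f (T t x) \<le> upper_mean f x + \<epsilon>" if e: "\<epsilon> > 0" for \<epsilon>
  proof (rule upper_mean_le[OF flow_space[OF x]])
    have "\<epsilon> / 2 > 0" using e by simp
    from close[OF this] upper_mean_gt[OF x this]
    show "\<forall>\<^sub>F n in sequentially. window f (real n) (T t x) \<le> upper_mean f x + \<epsilon>"
      by eventually_elim (auto simp: abs_if split: if_splits)
  qed
  have 2: "upper_mean f x \<le> upper_mean f (T t x) + \<epsilon>" if e: "\<epsilon> > 0" for \<epsilon>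
  proof (rule upper_mean_le[OF x])
    have "\<epsilon> / 2 > 0" using e by simp
    from close[OF this] upper_mean_gt[OF flow_space[OF x, of t] this]
    show "\<forall>\<^sub>F n in sequentially. window f (real n) x \<le> upper_mean f (T t x) + \<epsilon>"
      by eventually_elim (auto simp: abs_if split: if_splits)
  qed
  show ?thesis
    by (rule antisym; rule field_le_epsilon; rule 1 2; assumption)
qed

lemma integrable_upper_mean: "integrable M (upper_mean f)"
  by (rule integrable_const_bound[of _ K]) (use upper_mean_bound in \<open>auto intro!: AE_I2\<close>)

text \<open>The time-one map and \<open>F = window f 1 - upper_mean f + \<epsilon>\<close> have some positive ergodic sum everywhere.\<close>

lemma integral_upper_mean_le: "(\<integral>x. upper_mean f x \<partial>M) \<le> (\<integral>x. f x \<partial>M)"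
proof (rule field_le_epsilon)
  fix \<epsilon> :: real assume e: "\<epsilon> > 0"
  define F where "F = (\<lambda>x. window f 1 x - upper_mean f x + \<epsilon>)"
  have int: "integrable M (window f 1)"
    by (rule integrable_const_bound[of _ K]) (use window_abs_le[of _ 1] in \<open>auto intro!: AE_I2\<close>)
  have "0 \<le> (\<integral>x. F x \<partial>M)"
  proof (rule maximal_ergodic[OF flow_measurable[of 1] flow_distr,
        where s = "\<lambda>n x. (LBINT u:{0..real n}. f (T u x)) - real n * (upper_mean f x - \<epsilon>)"])
    show "F \<in> borel_measurable M" unfolding F_def by measurable
    show "\<bar>F x\<bar> \<le> 2 * K + \<epsilon>" if "x \<in> space M" for x
      using window_abs_le[OF that, of 1] upper_mean_bound[OF that] e by (simp add: F_def abs_le_iff)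
    show "(LBINT u:{0..real 0}. f (T u x)) - real 0 * (upper_mean f x - \<epsilon>) \<le> 0" for x
    proof -
      have "(LBINT u:{0..0::real}. f (T u x)) = 0"
        unfolding set_lebesgue_integral_def
        by (rule integral_eq_zero_AE) (use AE_lborel_singleton[of "0::real"] in \<open>eventually_elim, auto simp: indicator_def\<close>)
      then show ?thesis by simp
    qed
    show "(LBINT u:{0..real (Suc n)}. f (T u x)) - real (Suc n) * (upper_mean f x - \<epsilon>) =
        F x + ((LBINT u:{0..real n}. f (T u (T 1 x))) - real n * (upper_mean f (T 1 x) - \<epsilon>))"
      if "x \<in> space M" for x n
      unfolding upper_mean_invariant[OF that] F_def window_def using window_Suc[OF f _ that, of K n] abs_le_bound
      by (simp add: algebra_simps)
    \<comment> \<open>Otherwise every average of positive integer length is at most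
      \<open>upper_mean f x - \<epsilon>\<close>, against the definition as a limsup.\<close>
    show "\<exists>n. 0 < (LBINT u:{0..real n}. f (T u x)) - real n * (upper_mean f x - \<epsilon>)" if x: "x \<in> space M" for x
    proof (rule ccontr)
      assume "\<not> ?thesis"
      then have "(LBINT u:{0..real n}. f (T u x)) \<le> real n * (upper_mean f x - \<epsilon>)" for n
        by (auto simp: not_less)
      then have "window f (real n) x \<le> upper_mean f x - \<epsilon>" if "n > 0" for n
        using that by (simp add: window_def field_simps)
      then have "\<forall>\<^sub>F n in sequentially. window f (real n) x \<le> upper_mean f x - \<epsilon>"
        by (auto simp: eventually_sequentially intro!: exI[of _ 1])
      from upper_mean_le[OF x this] e show False by simp
    qed
  qed
  also have "(\<integral>x. F x \<partial>M) = (\<integral>x. window f 1 x \<partial>M) - (\<integral>x. upper_mean f x \<partial>M) + \<epsilon>"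
    unfolding F_def using int integrable_upper_mean prob_space by simp
  also have "(\<integral>x. window f 1 x \<partial>M) = (\<integral>x. f x \<partial>M)"
    using integral_window_mult[OF f, of K "\<lambda>_. 1" 1] abs_le_bound by simp
  finally show "(\<integral>x. upper_mean f x \<partial>M) \<le> (\<integral>x. f x \<partial>M) + \<epsilon>" by simp
qed

end

text \<open>The upper mean of \<open>- f\<close> is minus the lower mean of \<open>f\<close>. The
  gap between upper and lower mean is nonnegative, and the integral inequality for \<open>f\<close>
  and for \<open>- f\<close> bounds its integral by 0; so the gap vanishes almost everywhere and
  both inequalities are equalities.\<close>

lemma birkhoff_real:
  fixes f :: "'a \<Rightarrow> real"
  assumes f[measurable]: "f \<in> borel_measurable M" and K: "\<forall>x\<in>space M. \<bar>f x\<bar> \<le> K"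
  shows "AE x in M. (\<lambda>n. window f (real n) x) \<longlonglongrightarrow> upper_mean f x"
    and "(\<integral>x. upper_mean f x \<partial>M) = (\<integral>x. f x \<partial>M)"
proof -
  define f' where "f' = (\<lambda>x. - f x)"
  have f'[measurable]: "f' \<in> borel_measurable M" and K': "\<forall>x\<in>space M. \<bar>f' x\<bar> \<le> K"
    unfolding f'_def using K by auto
  have wf': "window f' r x = - window f r x" for r x
    unfolding window_def f'_def set_lebesgue_integral_def by simp
  let ?s = "\<lambda>x. upper_mean f x + upper_mean f' x"
  have ints: "integrable M ?s"
    using integrable_upper_mean[OF f K] integrable_upper_mean[OF f' K'] by simp
  have conv: "(\<lambda>n. window f (real n) x) \<longlonglongrightarrow> upper_mean f x" if x: "x \<in> space M" and z: "?s x = 0" for x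
  proof (rule LIMSEQ_I)
    fix e :: real assume e: "e > 0"
    from upper_mean_gt[OF f K x e] upper_mean_gt[OF f' K' x e]
    have "\<forall>\<^sub>F n in sequentially. norm (window f (real n) x - upper_mean f x) < e"
      by eventually_elim (use z wf' in \<open>auto simp: abs_if\<close>)
    then show "\<exists>n0. \<forall>n\<ge>n0. norm (window f (real n) x - upper_mean f x) < e"
      by (simp add: eventually_sequentially)
  qed
  have nonneg: "0 \<le> ?s x" if x: "x \<in> space M" for x
  proof (rule field_le_epsilon)
    fix e :: real assume e: "e > 0"
    then have e2: "e / 2 > 0" by simp
    from upper_mean_gt[OF f K x e2] upper_mean_gt[OF f' K' x e2]
    have "\<forall>\<^sub>F n::nat in sequentially. 0 \<le> ?s x + e"
      by eventually_elim (use wf' in \<open>simp add: field_simps\<close>)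
    then show "0 \<le> ?s x + e" by simp
  qed
  have le1: "(\<integral>x. upper_mean f x \<partial>M) \<le> (\<integral>x. f x \<partial>M)"
    by (rule integral_upper_mean_le[OF f K])
  have "(\<integral>x. upper_mean f' x \<partial>M) \<le> (\<integral>x. f' x \<partial>M)"
    by (rule integral_upper_mean_le[OF f' K'])
  also have "\<dots> = - (\<integral>x. f x \<partial>M)" by (simp add: f'_def)
  finally have le2: "(\<integral>x. upper_mean f' x \<partial>M) \<le> - (\<integral>x. f x \<partial>M)" .
  have sum: "(\<integral>x. ?s x \<partial>M) = (\<integral>x. upper_mean f x \<partial>M) + (\<integral>x. upper_mean f' x \<partial>M)"
    by (intro Bochner_Integration.integral_add integrable_upper_mean[OF f K] integrable_upper_mean[OF f' K'])
  have "0 \<le> (\<integral>x. ?s x \<partial>M)" using nonneg by (intro integral_nonneg_AE AE_I2)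
  then have "(\<integral>x. ?s x \<partial>M) = 0" and eq: "(\<integral>x. upper_mean f x \<partial>M) = (\<integral>x. f x \<partial>M)"
    using sum le1 le2 by linarith+
  then have "AE x in M. ?s x = 0"
    using integral_nonneg_eq_0_iff_AE[OF ints] nonneg by auto
  then show "AE x in M. (\<lambda>n. window f (real n) x) \<longlonglongrightarrow> upper_mean f x"
    using AE_space by eventually_elim (rule conv)
  show "(\<integral>x. upper_mean f x \<partial>M) = (\<integral>x. f x \<partial>M)" by (rule eq)
qed

end

section \<open>Regularity of almost every orbit\<close>

lemma borel_measurable_cnj [measurable (raw)]:
  assumes "h \<in> borel_measurable M"
  shows "(\<lambda>x. cnj (h x)) \<in> borel_measurable M"
  by (rule measurable_compose[OF assms]) (intro borel_measurable_continuous_onI continuous_intros)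

lemma has_vector_derivative_shift:
  assumes "(Q has_vector_derivative q) (at (s + c))"
  shows "((\<lambda>s. Q (s + c)) has_vector_derivative q) (at s)"
proof -
  have "((\<lambda>s. s + c) has_real_derivative 1) (at s)"
    by (auto intro!: derivative_eq_intros)
  then have "((\<lambda>s. s + c) has_vector_derivative 1) (at s)"
    by (simp add: has_real_derivative_iff_has_vector_derivative)
  from vector_diff_chain_at[OF this assms] show ?thesis by (simp add: o_def)
qed

text \<open>Let \<open>Q\<close> be a primitive of \<open>\<phi>\<close>, hence 1-Lipschitz.
  \<open>G s\<close> is \<open>Q s\<close> minus the average of \<open>Q\<close> over
  \<open>[s, s + N]\<close>, so it is bounded by \<open>N\<close>, and the derivative of the
  subtracted average is the window average of \<open>\<phi>\<close>. The primitive \<open>R\<close>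
  of \<open>Q\<close> only serves to write that average.\<close>

lemma oscillation_primitive:
  fixes \<phi> :: "real \<Rightarrow> complex"
  assumes \<phi>: "continuous_on UNIV \<phi>" "\<And>s. norm (\<phi> s) \<le> 1" and N: "N > 0"
  obtains G where "\<And>s. (G has_vector_derivative (\<phi> s - (1 / N) *\<^sub>R (LBINT v:{s..s+N}. \<phi> v))) (at s)"
    and "\<And>s. norm (G s) \<le> N"
proof -
  obtain Q where Q': "\<forall>s. (Q has_vector_derivative \<phi> s) (at s)"
    and Qint: "\<forall>s r. r \<ge> 0 \<longrightarrow> (LBINT v:{s..s+r}. \<phi> v) = Q (s + r) - Q s"
    by (rule continuous_antiderivative[OF \<phi>(1)])
  have Q: "(Q has_vector_derivative \<phi> s) (at s)" for s using Q' by blast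
  have Qc: "continuous_on UNIV Q"
    by (intro continuous_at_imp_continuous_on ballI has_vector_derivative_continuous[OF Q])
  obtain R where R': "\<forall>s. (R has_vector_derivative Q s) (at s)"
    by (rule continuous_antiderivative[OF Qc])
  have R: "(R has_vector_derivative Q s) (at s)" for s using R' by blast
  define G where "G = (\<lambda>s. Q s - (1 / N) *\<^sub>R (R (s + N) - R s))"
  have shift: "((\<lambda>s. R (s + N)) has_vector_derivative Q (s + N)) (at s)" for s
    by (rule has_vector_derivative_shift) (rule R)
  have G': "(G has_vector_derivative (\<phi> s - (1 / N) *\<^sub>R (LBINT v:{s..s+N}. \<phi> v))) (at s)" for s
  proof -
    have "(G has_vector_derivative (\<phi> s - (1 / N) *\<^sub>R (Q (s + N) - Q s))) (at s)"
      unfolding G_def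
      by (intro has_vector_derivative_diff Q bounded_linear.has_vector_derivative[OF bounded_linear_scaleR_right] shift R)
    then show ?thesis using Qint N by simp
  qed
  moreover have "norm (G s) \<le> N" for s
  proof -
    have QL: "norm (Q x - Q s) \<le> N" if x: "x \<in> {s..s+N}" for x
    proof -
      have \<phi>M: "\<phi> \<in> borel_measurable borel" by (rule borel_measurable_continuous_onI[OF \<phi>(1)])
      have "Q x - Q s = (LBINT v:{s..x}. \<phi> v)"
        using Qint[rule_format, of "x - s" s] x by simp
      also have "norm \<dots> \<le> (LBINT v:{s..x}. norm (\<phi> v))"
        by (rule set_integral_norm_bound[OF bounded_borel_set_integrable[OF \<phi>M \<phi>(2)]])
      also have "\<dots> \<le> 1 * (x - s)"
        by (rule set_integral_le_const) (use \<phi>M \<phi>(2) x in auto)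
      finally have "norm (Q x - Q s) \<le> x - s" by simp
      then show ?thesis using x by simp
    qed
    \<comment> \<open>On the window the derivative \<open>Q\<close> of \<open>R\<close> stays within
      \<open>N\<close> of \<open>Q s\<close>.\<close>
    have "norm (R (s + N) - R s - (s + N - s) *\<^sub>R Q s) \<le> norm (s + N - s) * N"
      by (rule vector_differentiable_bound_linearization[where S = "{s..s+N}"])
        (use N QL R in \<open>auto simp: closed_segment_eq_real_ivl intro: has_vector_derivative_at_within\<close>)
    then have "norm (R (s + N) - R s - N *\<^sub>R Q s) \<le> N * N" using N by simp
    moreover have "R (s + N) - R s - N *\<^sub>R Q s = - (N *\<^sub>R G s)"
      using N by (simp add: G_def scaleR_diff_right)
    ultimately show ?thesis using N by simp
  qed
  ultimately show ?thesis using that by blast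
qed

context probability_flow
begin

section \<open>Errors that are small on average along almost every orbit\<close>

text \<open>Rounding \<open>S\<close> up to an integer only enlarges the integral of a nonnegative
  function and costs a factor \<open>(S + 1) / S\<close>. The level \<open>c\<close> between
  \<open>L\<close> and \<open>\<eta>\<close> leaves room for it.\<close>

lemma eventually_average_le:
  fixes e :: "'a \<Rightarrow> real"
  assumes e[measurable]: "e \<in> borel_measurable M"
    and e0: "\<And>x. x \<in> space M \<Longrightarrow> 0 \<le> e x" and eK: "\<And>x. x \<in> space M \<Longrightarrow> e x \<le> K"
    and x: "x \<in> space M" and lim: "(\<lambda>n. window e (real n) x) \<longlonglongrightarrow> L" and \<eta>: "L < \<eta>" "0 < \<eta>"
  shows "\<forall>\<^sub>F S in at_top. (LBINT s:{0..S}. e (T s x)) \<le> \<eta> * S"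
proof -
  define c where "c = (max L 0 + \<eta>) / 2"
  have c: "L < c" "0 < c" "c < \<eta>" using \<eta> by (auto simp: c_def max_def)
  have "\<forall>\<^sub>F n in sequentially. window e (real n) x < c"
    by (rule order_tendstoD(2)[OF lim c(1)])
  then obtain n0 where n0: "\<And>n. n \<ge> n0 \<Longrightarrow> window e (real n) x < c"
    unfolding eventually_sequentially by blast
  \<comment> \<open>The threshold \<open>c / (\<eta> - c)\<close> is exactly the condition
    \<open>(S + 1) * c \<le> \<eta> * S\<close>.\<close>
  have "(LBINT s:{0..S}. e (T s x)) \<le> \<eta> * S" if S: "S \<ge> max (max 1 (real n0)) (c / (\<eta> - c))" for S
  proof -
    define n where "n = nat \<lceil>S\<rceil>"
    have n: "S \<le> real n" "real n \<le> S + 1" "n \<ge> n0" "n > 0"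
      using S unfolding n_def by linarith+
    have "(LBINT s:{0..S}. e (T s x)) \<le> (LBINT s:{0..real n}. e (T s x))"
      by (rule set_integral_mono_set[OF orbit_measurable[OF e x], of K])
        (use e0[OF flow_space[OF x]] eK[OF flow_space[OF x]] n in auto)
    also have "\<dots> = real n * window e (real n) x" using n by (simp add: window_def)
    also have "\<dots> \<le> real n * c" using n0[OF n(3)] by (intro mult_left_mono) auto
    also have "\<dots> \<le> (S + 1) * c" using n c by (intro mult_right_mono) auto
    also have "\<dots> \<le> \<eta> * S" using S c by (simp add: field_simps)
    finally show ?thesis .
  qed
  then show ?thesis unfolding eventually_at_top_linorder by blast
qed

text \<open>The orbit mean of \<open>e k\<close> has the same integral as \<open>e k\<close>. By
  Markov's inequality the set where all these means are at least \<open>c\<close> has probability at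
  most the integral of \<open>e k\<close> divided by \<open>c\<close>, for every \<open>k\<close>,
  hence 0. The index \<open>k\<close> may depend on the point and on \<open>\<eta>\<close>, so no
  subsequence has to be extracted.\<close>

lemma AE_small_averages:
  fixes e :: "nat \<Rightarrow> 'a \<Rightarrow> real"
  assumes e[measurable]: "\<And>k. e k \<in> borel_measurable M"
    and e0: "\<And>k x. x \<in> space M \<Longrightarrow> 0 \<le> e k x" and eK: "\<And>k x. x \<in> space M \<Longrightarrow> e k x \<le> K"
    and lim: "(\<lambda>k. \<integral>x. e k x \<partial>M) \<longlonglongrightarrow> 0"
  shows "AE x in M. \<forall>\<eta>>0. \<exists>k. \<forall>\<^sub>F S in at_top. (LBINT s:{0..S}. e k (T s x)) \<le> \<eta> * S"
proof -
  have eb: "\<forall>x\<in>space M. \<bar>e k x\<bar> \<le> K" for k using e0 eK by simp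
  note [measurable] = upper_mean_measurable[OF e eb]
  have conv: "AE x in M. \<forall>k. (\<lambda>n. window (e k) (real n) x) \<longlonglongrightarrow> upper_mean (e k) x"
    unfolding AE_all_countable by (intro allI birkhoff_real(1)[OF e eb])
  have nonneg: "AE x in M. \<forall>k. 0 \<le> upper_mean (e k) x"
    using conv AE_space
  proof eventually_elim
    case (elim x)
    have "0 \<le> window (e k) (real n) x" for k n
      unfolding window_def set_lebesgue_integral_def
      by (intro scaleR_nonneg_nonneg integral_nonneg_AE AE_I2) (auto intro!: mult_nonneg_nonneg e0 flow_space elim)
    then show ?case using elim(1) by (meson LIMSEQ_le_const)
  qed
  have "AE x in M. \<exists>k. upper_mean (e k) x < 1 / real (Suc m)" for m
  proof -
    define c where "c = 1 / real (Suc m)"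
    have c: "c > 0" by (simp add: c_def)
    define B where "B = {x\<in>space M. \<forall>k. c \<le> upper_mean (e k) x}"
    have B[measurable]: "B \<in> sets M" unfolding B_def by measurable
    have "prob B * c \<le> (\<integral>x. e k x \<partial>M)" for k
    proof -
      have "prob B * c = (\<integral>x. indicator B x * c \<partial>M)" by simp
      also have "\<dots> \<le> (\<integral>x. upper_mean (e k) x \<partial>M)"
      proof (rule integral_mono_AE)
        show "integrable M (\<lambda>x. indicator B x * c)"
          by (intro integrable_mult_left integrable_real_indicator B) (simp add: emeasure_eq_measure)
        show "integrable M (upper_mean (e k))" by (rule integrable_upper_mean[OF e eb])
        show "AE x in M. indicator B x * c \<le> upper_mean (e k) x"
          using nonneg by eventually_elim (auto simp: indicator_def B_def)
      qed
      also have "\<dots> = (\<integral>x. e k x \<partial>M)" by (rule birkhoff_real(2)[OF e eb])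
      finally show ?thesis .
    qed
    then have "prob B * c \<le> 0" by (intro LIMSEQ_le_const[OF lim]) auto
    then have "prob B = 0" using c by (simp add: mult_le_0_iff order_antisym)
    then have "AE x in M. x \<notin> B" by (intro AE_not_in) (simp add: null_sets_def emeasure_eq_measure)
    then show ?thesis using AE_space
      by eventually_elim (auto simp: B_def c_def not_le)
  qed
  then have "AE x in M. \<forall>m. \<exists>k. upper_mean (e k) x < 1 / real (Suc m)"
    unfolding AE_all_countable by blast
  with conv AE_space show ?thesis
  proof eventually_elim
    case (elim x)
    show ?case
    proof (intro allI impI)
      fix \<eta> :: real assume \<eta>: "\<eta> > 0"
      obtain m where m: "1 / real (Suc m) < \<eta>" using \<eta> nat_approx_posE by blast
      obtain k where "upper_mean (e k) x < 1 / real (Suc m)" using elim by blast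
      with m have "upper_mean (e k) x < \<eta>" by simp
      then show "\<exists>k. \<forall>\<^sub>F S in at_top. (LBINT s:{0..S}. e k (T s x)) \<le> \<eta> * S"
        using eventually_average_le[OF e e0 eK elim(2) elim(1)[rule_format] _ \<eta>] by blast
    qed
  qed
qed

section \<open>The Birkhoff limit as invariant projection\<close>

text \<open>For bounded measurable \<open>f\<close> this is a version of the projection that is
  exactly invariant at every point of \<open>space M\<close>, whereas a given projection is
  determined and invariant only up to null sets.\<close>

definition orbit_mean :: "('a \<Rightarrow> complex) \<Rightarrow> 'a \<Rightarrow> complex"
  where "orbit_mean f x = Complex (upper_mean (\<lambda>x. Re (f x)) x) (upper_mean (\<lambda>x. Im (f x)) x)"

context
  fixes f :: "'a \<Rightarrow> complex"
  assumes f[measurable]: "f \<in> borel_measurable M" and f1: "\<forall>x\<in>space M. norm (f x) \<le> 1"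
begin

lemma norm_le_1: "x \<in> space M \<Longrightarrow> norm (f x) \<le> 1"
  using f1 by blast

lemma Re_Im_le_1: "\<forall>x\<in>space M. \<bar>Re (f x)\<bar> \<le> 1" "\<forall>x\<in>space M. \<bar>Im (f x)\<bar> \<le> 1"
  using f1 abs_Re_le_cmod abs_Im_le_cmod order_trans by blast+

lemma Re_Im_measurable: "(\<lambda>x. Re (f x)) \<in> borel_measurable M" "(\<lambda>x. Im (f x)) \<in> borel_measurable M"
  by measurable

lemma orbit_mean_measurable [measurable]: "orbit_mean f \<in> borel_measurable M"
proof -
  note [measurable] = upper_mean_measurable[OF Re_Im_measurable(1) Re_Im_le_1(1)]
    upper_mean_measurable[OF Re_Im_measurable(2) Re_Im_le_1(2)]
  have "orbit_mean f = (\<lambda>x. complex_of_real (upper_mean (\<lambda>x. Re (f x)) x) +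
      \<i> * complex_of_real (upper_mean (\<lambda>x. Im (f x)) x))"
    by (auto simp: orbit_mean_def Complex_eq)
  then show ?thesis by simp
qed

text \<open>The constant 2 adds the bounds for the real and the imaginary part.\<close>

lemma orbit_mean_norm_le: "x \<in> space M \<Longrightarrow> norm (orbit_mean f x) \<le> 2"
  using upper_mean_bound[OF Re_Im_measurable(1) Re_Im_le_1(1), of x]
    upper_mean_bound[OF Re_Im_measurable(2) Re_Im_le_1(2), of x] cmod_le[of "orbit_mean f x"]
  by (simp add: orbit_mean_def)

lemma orbit_mean_invariant: "x \<in> space M \<Longrightarrow> orbit_mean f (T t x) = orbit_mean f x"
  unfolding orbit_mean_def
  using upper_mean_invariant[OF Re_Im_measurable(1) Re_Im_le_1(1)]
    upper_mean_invariant[OF Re_Im_measurable(2) Re_Im_le_1(2)] by simp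

lemma orbit_integrable:
  assumes "x \<in> space M"
  shows "set_integrable lborel {a..b} (\<lambda>s. f (T s x))"
  by (rule bounded_borel_set_integrable[OF orbit_measurable[OF f assms] norm_le_1[OF flow_space[OF assms]]])

lemma orbit_mean_limit: "AE x in M. (\<lambda>n. window f (real n) x) \<longlonglongrightarrow> orbit_mean f x"
  using birkhoff_real(1)[OF Re_Im_measurable(1) Re_Im_le_1(1)]
    birkhoff_real(1)[OF Re_Im_measurable(2) Re_Im_le_1(2)] AE_space
proof eventually_elim
  case (elim x)
  have si: "integrable lborel (\<lambda>s. indicator {0..r} s *\<^sub>R f (T s x))" for r
    using orbit_integrable[OF elim(3), of 0 r] by (simp add: set_integrable_def)
  have "window f r x = Complex (window (\<lambda>x. Re (f x)) r x) (window (\<lambda>x. Im (f x)) r x)" for r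
    using integral_Re[OF si[of r]] integral_Im[OF si[of r]]
    by (simp add: window_def set_lebesgue_integral_def complex_eq_iff)
  then show ?case
    using elim(1,2) by (simp add: orbit_mean_def tendsto_Complex)
qed

lemma window_norm_le_1: "x \<in> space M \<Longrightarrow> r \<ge> 0 \<Longrightarrow> norm (window f r x) \<le> 1"
  by (rule window_norm_le[OF f norm_le_1])

lemma integral_norm_window_orbit_mean_tendsto_0:
  "(\<lambda>n. \<integral>x. norm (window f (real n) x - orbit_mean f x) \<partial>M) \<longlonglongrightarrow> 0"
proof -
  have "(\<lambda>n. \<integral>x. norm (window f (real n) x - orbit_mean f x) \<partial>M) \<longlonglongrightarrow> (\<integral>x. 0 \<partial>M)"
  proof (rule integral_dominated_convergence[where w = "\<lambda>_. 3"])
    show "AE x in M. (\<lambda>n. norm (window f (real n) x - orbit_mean f x)) \<longlonglongrightarrow> 0"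
      using orbit_mean_limit by eventually_elim (simp add: tendsto_norm_zero_iff LIM_zero_iff)
    show "AE x in M. norm (norm (window f (real n) x - orbit_mean f x)) \<le> 3" for n
    proof (rule AE_I2)
      fix x assume x: "x \<in> space M"
      show "norm (norm (window f (real n) x - orbit_mean f x)) \<le> 3"
        using norm_triangle_ineq4[of "window f (real n) x" "orbit_mean f x"]
          window_norm_le_1[OF x, of "real n"] orbit_mean_norm_le[OF x] by simp
    qed
  qed auto
  then show ?thesis by simp
qed

text \<open>A local ergodic theorem. On every orbit Lebesgue differentiation puts
  \<open>T s x\<close> into the convergence set \<open>G\<close> for almost every \<open>s\<close>.
  Fubini provides one time \<open>s\<close> such that \<open>T s x\<close> lies in \<open>G\<close>
  for almost every \<open>x\<close>, and since \<open>T s\<close> preserves the measure,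
  \<open>G\<close> itself has full measure.\<close>

lemma AE_window_tendsto: "AE x in M. (\<lambda>n. window f (1 / real (Suc n)) x) \<longlonglongrightarrow> f x"
proof -
  interpret P: pair_sigma_finite lborel M by unfold_locales
  define G where "G = {x\<in>space M. (\<lambda>n. window f (1 / real (Suc n)) x) \<longlonglongrightarrow> f x}"
  have "G = {x\<in>space M. (\<lambda>n. window f (1 / real (Suc n)) x - f x) \<longlonglongrightarrow> 0}"
    by (simp add: G_def LIM_zero_iff)
  also have "\<dots> \<in> sets M" by measurable
  finally have G[measurable]: "G \<in> sets M" .
  have "AE x in M. AE s in lborel. T s x \<in> G"
  proof (rule AE_I2)
    fix x assume x: "x \<in> space M"
    have "AE s in lborel. (\<lambda>n. real (Suc n) *\<^sub>R (LBINT v:{s..s + 1 / real (Suc n)}. f (T v x))) \<longlonglongrightarrow> f (T s x)"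
      by (rule AE_tendsto_shrinking_window[OF orbit_measurable[OF f x] norm_le_1[OF flow_space[OF x]]])
    then show "AE s in lborel. T s x \<in> G"
      by eventually_elim (use x in \<open>simp add: G_def window_flow flow_space\<close>)
  qed
  moreover have m: "{p \<in> space (lborel \<Otimes>\<^sub>M M). T (fst p) (snd p) \<in> G} \<in> sets (lborel \<Otimes>\<^sub>M M)"
    by measurable
  ultimately have "AE s in lborel. AE x in M. T s x \<in> G"
    using P.AE_commute[OF m] by blast
  then have "\<exists>s. AE x in M. T s x \<in> G"
    using eventually_happens'[of "ae_filter lborel"] by (auto simp: ae_filter_eq_bot_iff)
  then obtain s where "AE x in M. T s x \<in> G" by blast
  then have "AE x in distr M M (T s). x \<in> G"
    by (subst AE_distr_iff) auto
  then have "AE x in M. x \<in> G" unfolding flow_distr .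
  then show ?thesis by eventually_elim (simp add: G_def)
qed

lemma integral_norm_window_tendsto_0:
  "(\<lambda>n. \<integral>x. norm (f x - window f (1 / real (Suc n)) x) \<partial>M) \<longlonglongrightarrow> 0"
proof -
  have "(\<lambda>n. \<integral>x. norm (f x - window f (1 / real (Suc n)) x) \<partial>M) \<longlonglongrightarrow> (\<integral>x. 0 \<partial>M)"
  proof (rule integral_dominated_convergence[where w = "\<lambda>_. 2"])
    show "AE x in M. (\<lambda>n. norm (f x - window f (1 / real (Suc n)) x)) \<longlonglongrightarrow> 0"
      using AE_window_tendsto
    proof eventually_elim
      case (elim x)
      from tendsto_diff[OF tendsto_const[of "f x"] elim] show ?case
        by (simp add: tendsto_norm_zero_iff)
    qed
    show "AE x in M. norm (norm (f x - window f (1 / real (Suc n)) x)) \<le> 2" for n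
    proof (rule AE_I2)
      fix x assume x: "x \<in> space M"
      show "norm (norm (f x - window f (1 / real (Suc n)) x)) \<le> 2"
        using norm_triangle_ineq4[of "f x" "window f (1 / real (Suc n)) x"]
          window_norm_le_1[OF x, of "1 / real (Suc n)"] norm_le_1[OF x] by simp
    qed
  qed auto
  then show ?thesis by simp
qed

text \<open>The difference \<open>d\<close> of the two candidates is an invariant square integrable
  function, and both \<open>f - p\<close> and \<open>f - orbit_mean f\<close> are orthogonal to it.
  Hence \<open>d\<close> is orthogonal to itself.\<close>

lemma orbit_mean_unique_projection:
  assumes p: "is_orthogonal_projection M (L_two_invariant M T) f p"
  shows "AE x in M. p x = orbit_mean f x"
proof -
  have pV: "p \<in> L_two_invariant M T" using p unfolding is_orthogonal_projection_def by blast
  then have pM[measurable]: "p \<in> borel_measurable M" and p2: "integrable M (\<lambda>x. (norm (p x))\<^sup>2)"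
    and pinv: "\<And>t. AE x in M. p (T t x) = p x"
    unfolding L_two_invariant_def L_two_def by auto
  \<comment> \<open>Square integrable functions are integrable on a probability space, by
    \<open>2 * u \<le> u^2 + 1\<close>.\<close>
  have L1: "integrable M h" if [measurable]: "h \<in> borel_measurable M" and h2: "integrable M (\<lambda>x. (norm (h x))\<^sup>2)"
    for h :: "'a \<Rightarrow> complex"
  proof (rule Bochner_Integration.integrable_bound[of M "\<lambda>x. 1 + (norm (h x))\<^sup>2"])
    have "norm (h x) \<le> 1 + (norm (h x))\<^sup>2" for x
    proof -
      have "2 * norm (h x) \<le> (norm (h x))\<^sup>2 + 1"
        using zero_le_power2[of "norm (h x) - 1"] by (simp add: power2_diff)
      then show ?thesis using norm_ge_zero[of "h x"] by linarith
    qed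
    then show "AE x in M. norm (h x) \<le> norm (1 + (norm (h x))\<^sup>2)"
      by (intro AE_I2) (auto intro: order_trans[OF _ abs_ge_self])
  qed (use h2 in auto)
  \<comment> \<open>Windows of \<open>f\<close> keep its inner products with invariant functions;
    the limit is taken with dominating function \<open>norm (h x)\<close>.\<close>
  have proj: "(\<integral>x. orbit_mean f x * cnj (h x) \<partial>M) = (\<integral>x. f x * cnj (h x) \<partial>M)"
    if h: "h \<in> L_two_invariant M T" for h
  proof -
    have [measurable]: "h \<in> borel_measurable M" and h2: "integrable M (\<lambda>x. (norm (h x))\<^sup>2)"
      and hinv: "\<And>t. AE x in M. h (T t x) = h x"
      using h unfolding L_two_invariant_def L_two_def by auto
    have hi: "integrable M h" by (rule L1) (use h2 in auto)
    have ci: "integrable M (\<lambda>x. cnj (h x))" using hi by simp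
    have cinv: "AE x in M. cnj (h (T t x)) = cnj (h x)" for t
      using hinv[of t] by eventually_elim simp
    have "(\<lambda>n. \<integral>x. window f (real n) x * cnj (h x) \<partial>M) \<longlonglongrightarrow> (\<integral>x. orbit_mean f x * cnj (h x) \<partial>M)"
    proof (rule integral_dominated_convergence[where w = "\<lambda>x. norm (h x)"])
      show "AE x in M. (\<lambda>n. window f (real n) x * cnj (h x)) \<longlonglongrightarrow> orbit_mean f x * cnj (h x)"
        using orbit_mean_limit by eventually_elim (intro tendsto_intros)
      show "AE x in M. norm (window f (real n) x * cnj (h x)) \<le> norm (h x)" for n
        by (intro AE_I2) (use window_norm_le_1[of _ "real n"] in \<open>auto simp: norm_mult intro: mult_left_le_one_le\<close>)
    qed (use hi in auto)
    moreover have "\<forall>\<^sub>F n in sequentially. (\<integral>x. window f (real n) x * cnj (h x) \<partial>M) = (\<integral>x. f x * cnj (h x) \<partial>M)"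
      using eventually_gt_at_top[of "0::nat"]
      by eventually_elim (rule integral_window_mult[OF f norm_le_1 ci cinv]; simp)
    then have "(\<lambda>n. \<integral>x. window f (real n) x * cnj (h x) \<partial>M) \<longlonglongrightarrow> (\<integral>x. f x * cnj (h x) \<partial>M)"
      by (rule tendsto_eventually)
    ultimately show ?thesis by (rule LIMSEQ_unique)
  qed
  define d where "d = (\<lambda>x. p x - orbit_mean f x)"
  have dM[measurable]: "d \<in> borel_measurable M" unfolding d_def by measurable
  have d2: "integrable M (\<lambda>x. (norm (d x))\<^sup>2)"
  proof (rule Bochner_Integration.integrable_bound[of M "\<lambda>x. 2 * (norm (p x))\<^sup>2 + 8"])
    show "AE x in M. norm ((norm (d x))\<^sup>2) \<le> norm (2 * (norm (p x))\<^sup>2 + 8)"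
    proof (rule AE_I2)
      fix x assume x: "x \<in> space M"
      have "norm (d x) \<le> norm (p x) + 2"
        using norm_triangle_ineq4[of "p x" "orbit_mean f x"] orbit_mean_norm_le[OF x] by (simp add: d_def)
      then have "(norm (d x))\<^sup>2 \<le> (norm (p x) + 2)\<^sup>2" by (intro power_mono) auto
      also have "\<dots> \<le> 2 * (norm (p x))\<^sup>2 + 8"
        using zero_le_power2[of "norm (p x) - 2"] by (simp add: power2_sum power2_diff)
      finally show "norm ((norm (d x))\<^sup>2) \<le> norm (2 * (norm (p x))\<^sup>2 + 8)" by simp
    qed
  qed (use p2 in auto)
  have dV: "d \<in> L_two_invariant M T"
    unfolding L_two_invariant_def L_two_def
  proof (intro CollectI conjI allI dM d2)
    fix t
    show "AE x in M. d (T t x) = d x"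
      using pinv[of t] AE_space by eventually_elim (simp add: d_def orbit_mean_invariant)
  qed
  have di: "integrable M d" by (rule L1[OF dM d2])
  have i1: "integrable M (\<lambda>x. f x * cnj (d x))"
    by (rule Bochner_Integration.integrable_bound[OF di])
      (use norm_le_1 in \<open>auto simp: norm_mult intro!: AE_I2 mult_left_le_one_le\<close>)
  have i2: "integrable M (\<lambda>x. orbit_mean f x * cnj (d x))"
  proof (rule Bochner_Integration.integrable_bound[of M "\<lambda>x. 2 * norm (d x)"])
    show "AE x in M. norm (orbit_mean f x * cnj (d x)) \<le> norm (2 * norm (d x))"
      using orbit_mean_norm_le by (auto simp: norm_mult intro!: AE_I2 mult_right_mono)
  qed (use di in auto)
  have i3: "integrable M (\<lambda>x. p x * cnj (d x))"
  proof (rule Bochner_Integration.integrable_bound[of M "\<lambda>x. (norm (p x))\<^sup>2 + (norm (d x))\<^sup>2"])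
    have "norm (p x * cnj (d x)) \<le> (norm (p x))\<^sup>2 + (norm (d x))\<^sup>2" for x
      using sum_squares_bound[of "norm (p x)" "norm (d x)"]
        mult_nonneg_nonneg[OF norm_ge_zero[of "p x"] norm_ge_zero[of "d x"]]
      unfolding norm_mult complex_mod_cnj by linarith
    then show "AE x in M. norm (p x * cnj (d x)) \<le> norm ((norm (p x))\<^sup>2 + (norm (d x))\<^sup>2)"
      by (auto intro: order_trans[OF _ abs_ge_self])
  qed (use p2 d2 in auto)
  have "(\<integral>x. (f x - p x) * cnj (d x) \<partial>M) = 0"
    using p dV unfolding is_orthogonal_projection_def by blast
  then have "(\<integral>x. f x * cnj (d x) \<partial>M) - (\<integral>x. p x * cnj (d x) \<partial>M) = 0"
    using i1 i3 by (simp add: left_diff_distrib)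
  then have "(\<integral>x. p x * cnj (d x) \<partial>M) - (\<integral>x. orbit_mean f x * cnj (d x) \<partial>M) = 0"
    using proj[OF dV] by simp
  then have "(\<integral>x. p x * cnj (d x) - orbit_mean f x * cnj (d x) \<partial>M) = 0"
    using i2 i3 by simp
  also have "(\<lambda>x. p x * cnj (d x) - orbit_mean f x * cnj (d x)) = (\<lambda>x. complex_of_real ((norm (d x))\<^sup>2))"
  proof
    fix x
    have "p x * cnj (d x) - orbit_mean f x * cnj (d x) = d x * cnj (d x)"
      by (simp add: d_def algebra_simps)
    then show "p x * cnj (d x) - orbit_mean f x * cnj (d x) = complex_of_real ((norm (d x))\<^sup>2)"
      by (simp only: complex_norm_square)
  qed
  finally have "(\<integral>x. (norm (d x))\<^sup>2 \<partial>M) = 0"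
    by (simp only: integral_complex_of_real of_real_eq_0_iff)
  then have "AE x in M. (norm (d x))\<^sup>2 = 0"
    using integral_nonneg_eq_0_iff_AE[OF d2] by simp
  then show ?thesis by eventually_elim (simp add: d_def)
qed

lemma orbit_window_continuous:
  assumes x: "x \<in> space M" and r: "r > 0"
  shows "continuous_on UNIV (\<lambda>s. window f r (T s x))"
  unfolding window_flow[OF x]
  by (intro continuous_intros window_continuous[OF orbit_measurable[OF f x] norm_le_1[OF flow_space[OF x]]])
    (use r in auto)

end

text \<open>A single window of a measurable function is only Lipschitz along orbits. A window of
  this continuous function \<open>g\<close> is differentiable, with derivative
  \<open>(g (s + r') - g s) / r'\<close>.\<close>

lemma orbit_double_window_derivative:
  fixes f :: "'a \<Rightarrow> complex"
  assumes f: "f \<in> borel_measurable M" "\<forall>x\<in>space M. norm (f x) \<le> 1"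
    and x: "x \<in> space M" and r: "r > 0" "r' > 0"
  shows "\<exists>\<psi>'. \<forall>s. ((\<lambda>s. window (window f r) r' (T s x)) has_vector_derivative \<psi>' s) (at s) \<and> norm (\<psi>' s) \<le> 2 / r'"
proof -
  define g where "g = (\<lambda>s. window f r (T s x))"
  have g1: "norm (g s) \<le> 1" for s
    unfolding g_def by (rule window_norm_le_1[OF f flow_space[OF x]]) (use r in simp)
  have gc: "continuous_on UNIV g" unfolding g_def by (rule orbit_window_continuous[OF f x r(1)])
  obtain Q where Q': "\<forall>s. (Q has_vector_derivative g s) (at s)"
    and Qint: "\<forall>s r. r \<ge> 0 \<longrightarrow> (LBINT v:{s..s+r}. g v) = Q (s + r) - Q s"
    by (rule continuous_antiderivative[OF gc])
  have Q: "(Q has_vector_derivative g s) (at s)" for s using Q' by blast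
  have eq: "(\<lambda>s. window (window f r) r' (T s x)) = (\<lambda>s. (1 / r') *\<^sub>R (Q (s + r') - Q s))"
    using Qint r by (simp add: window_flow[OF x, of "window f r"] g_def[symmetric])
  have shift: "((\<lambda>s. Q (s + r')) has_vector_derivative g (s + r')) (at s)" for s
    by (rule has_vector_derivative_shift) (rule Q)
  have d1: "((\<lambda>s. (1 / r') *\<^sub>R (Q (s + r') - Q s)) has_vector_derivative (1 / r') *\<^sub>R (g (s + r') - g s)) (at s)" for s
    by (intro bounded_linear.has_vector_derivative[OF bounded_linear_scaleR_right] has_vector_derivative_diff shift Q)
  have d2: "norm ((1 / r') *\<^sub>R (g (s + r') - g s)) \<le> 2 / r'" for s
  proof -
    have "norm (g (s + r') - g s) \<le> 2"
      using norm_triangle_ineq4[of "g (s + r')" "g s"] g1[of "s + r'"] g1[of s] by linarith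
    then show ?thesis using r by (simp add: divide_right_mono)
  qed
  show ?thesis unfolding eq
    by (intro exI[of _ "\<lambda>s. (1 / r') *\<^sub>R (g (s + r') - g s)"] allI conjI d1 d2)
qed

text \<open>Windows contract the \<open>L^1\<close> norm whatever their length, so an approximation
  of \<open>f\<close> remains one after long averaging.\<close>

lemma integral_norm_window_le:
  fixes g :: "'a \<Rightarrow> complex"
  assumes g[measurable]: "g \<in> borel_measurable M" and K: "\<And>x. x \<in> space M \<Longrightarrow> norm (g x) \<le> K" and r: "r > 0"
  shows "(\<integral>x. norm (window g r x) \<partial>M) \<le> (\<integral>x. norm (g x) \<partial>M)"
proof -
  have ng: "(\<lambda>x. norm (g x)) \<in> borel_measurable M" by measurable
  have le: "norm (window g r x) \<le> window (\<lambda>x. norm (g x)) r x" if x: "x \<in> space M" for x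
  proof -
    have "norm (LBINT u:{0..r}. g (T u x)) \<le> (LBINT u:{0..r}. norm (g (T u x)))"
      by (rule set_integral_norm_bound[OF bounded_borel_set_integrable[OF orbit_measurable[OF g x] K[OF flow_space[OF x]]]])
    then show ?thesis using r by (simp add: window_def divide_right_mono)
  qed
  have "(\<integral>x. norm (window g r x) \<partial>M) \<le> (\<integral>x. window (\<lambda>x. norm (g x)) r x \<partial>M)"
  proof (rule integral_mono)
    show "integrable M (\<lambda>x. norm (window g r x))"
      by (rule integrable_const_bound[of _ K])
        (use window_norm_le[OF g K] r in \<open>auto intro!: AE_I2\<close>)
    show "integrable M (window (\<lambda>x. norm (g x)) r)"
      by (rule integrable_const_bound[of _ K])
        (use window_norm_le[OF ng, of K] K r in \<open>auto intro!: AE_I2\<close>)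
  qed (rule le)
  also have "\<dots> = (\<integral>x. norm (g x) \<partial>M)"
    using integral_window_mult[OF ng, of K "\<lambda>_. 1" r] K r by simp
  finally show ?thesis .
qed

text \<open>Double windows \<open>\<psi> k\<close> approach \<open>f\<close> in \<open>L^1\<close>
  and are differentiable along orbits; they give the first approximation. The second is
  \<open>\<psi> k\<close> minus its average over a window of length \<open>N k\<close>, long enough
  for the corresponding window of \<open>f\<close> to be close to the mean. Both errors tend to 0 in
  \<open>L^1\<close>, which makes their averages small on almost every orbit.\<close>

theorem AE_regular_orbit:
  fixes f :: "'a \<Rightarrow> complex"
  assumes f[measurable]: "f \<in> borel_measurable M" and f1: "\<forall>x\<in>space M. norm (f x) \<le> 1"
    and p: "is_orthogonal_projection M (L_two_invariant M T) f p"
  shows "AE x in M. regular_orbit (\<lambda>s. f (T s x)) (p x)"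
proof -
  have wi: "\<forall>x\<in>space M. norm (window f r x) \<le> 1" if "r > 0" for r
    using window_norm_le_1[OF f f1] that by auto
  \<comment> \<open>The inner length is chosen for \<open>f\<close>, then the outer one for the
    resulting window, each at the price of half the error.\<close>
  have "\<exists>n m. (\<integral>x. norm (f x - window (window f (1 / real (Suc n))) (1 / real (Suc m)) x) \<partial>M) < 1 / real (Suc k)" for k
  proof -
    have e: "1 / real (Suc k) / 2 > 0" by simp
    obtain n where n: "(\<integral>x. norm (f x - window f (1 / real (Suc n)) x) \<partial>M) < 1 / real (Suc k) / 2"
      using order_tendstoD(2)[OF integral_norm_window_tendsto_0[OF f f1] e] by (auto simp: eventually_sequentially)
    let ?g = "window f (1 / real (Suc n))"
    have gM[measurable]: "?g \<in> borel_measurable M" by measurable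
    have g1: "\<forall>x\<in>space M. norm (?g x) \<le> 1" by (rule wi) simp
    obtain m where m: "(\<integral>x. norm (?g x - window ?g (1 / real (Suc m)) x) \<partial>M) < 1 / real (Suc k) / 2"
      using order_tendstoD(2)[OF integral_norm_window_tendsto_0[OF gM g1] e] by (auto simp: eventually_sequentially)
    let ?h = "window ?g (1 / real (Suc m))"
    have h1: "\<forall>x\<in>space M. norm (?h x) \<le> 1" using window_norm_le_1[OF gM g1] by auto
    have int: "integrable M f" "integrable M ?g" "integrable M ?h"
      by (rule integrable_const_bound[of _ 1]; use f1 g1 h1 in \<open>auto intro!: AE_I2\<close>)+
    have "(\<integral>x. norm (f x - ?h x) \<partial>M) \<le> (\<integral>x. norm (f x - ?g x) + norm (?g x - ?h x) \<partial>M)"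
    proof (rule integral_mono)
      show "norm (f x - ?h x) \<le> norm (f x - ?g x) + norm (?g x - ?h x)" for x
        using norm_triangle_ineq[of "f x - ?g x" "?g x - ?h x"] by simp
    qed (intro Bochner_Integration.integrable_add integrable_norm Bochner_Integration.integrable_diff int)+
    also have "\<dots> = (\<integral>x. norm (f x - ?g x) \<partial>M) + (\<integral>x. norm (?g x - ?h x) \<partial>M)"
      by (intro Bochner_Integration.integral_add integrable_norm Bochner_Integration.integrable_diff int)
    also have "\<dots> < 1 / real (Suc k) / 2 + 1 / real (Suc k) / 2" using n m by (rule add_strict_mono)
    finally have "(\<integral>x. norm (f x - ?h x) \<partial>M) < 1 / real (Suc k)"
      by (simp only: field_sum_of_halves)
    then show ?thesis by blast
  qed
  then obtain n m where nm:
    "\<And>k. (\<integral>x. norm (f x - window (window f (1 / real (Suc (n k)))) (1 / real (Suc (m k))) x) \<partial>M) < 1 / real (Suc k)"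
    by metis
  define \<psi> where "\<psi> = (\<lambda>k. window (window f (1 / real (Suc (n k)))) (1 / real (Suc (m k))))"
  have \<psi>M[measurable]: "\<psi> k \<in> borel_measurable M" for k unfolding \<psi>_def by measurable
  have g1: "\<forall>x\<in>space M. norm (window f (1 / real (Suc n)) x) \<le> 1" for n by (rule wi) simp
  have \<psi>1: "\<forall>x\<in>space M. norm (\<psi> k x) \<le> 1" for k
    unfolding \<psi>_def using window_norm_le_1[OF window_measurable[OF f] g1] by auto
  have \<psi>d: "(\<integral>x. norm (f x - \<psi> k x) \<partial>M) < 1 / real (Suc k)" for k
    using nm by (simp add: \<psi>_def)
  have "\<exists>N>0. (\<integral>x. norm (window f (real N) x - orbit_mean f x) \<partial>M) < 1 / real (Suc k)" for k
  proof -
    have "\<forall>\<^sub>F N in sequentially. (\<integral>x. norm (window f (real N) x - orbit_mean f x) \<partial>M) < 1 / real (Suc k)"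
      by (rule order_tendstoD(2)[OF integral_norm_window_orbit_mean_tendsto_0[OF f f1]]) simp
    with eventually_gt_at_top[of 0] have "\<forall>\<^sub>F N in sequentially. N > 0 \<and>
        (\<integral>x. norm (window f (real N) x - orbit_mean f x) \<partial>M) < 1 / real (Suc k)"
      by eventually_elim simp
    then show ?thesis by (auto dest: eventually_happens)
  qed
  then obtain N where N0: "\<And>k. N k > 0" and
    N: "\<And>k. (\<integral>x. norm (window f (real (N k)) x - orbit_mean f x) \<partial>M) < 1 / real (Suc k)"
    by metis
  note [measurable] = orbit_mean_measurable[OF f f1]
  have fM1: "norm (f x) \<le> 1" if "x \<in> space M" for x using f1 that by blast
  have \<psi>M1: "norm (\<psi> k x) \<le> 1" if "x \<in> space M" for k x using \<psi>1 that by blast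
  have \<psi>w: "norm (window (\<psi> k) (real (N k)) x) \<le> 1" if "x \<in> space M" for k x
    by (rule window_norm_le_1[OF \<psi>M \<psi>1 that]) simp
  have fw: "norm (window f (real (N k)) x) \<le> 1" if "x \<in> space M" for k x
    by (rule window_norm_le_1[OF f f1 that]) simp
  have fi: "integrable M f" by (rule integrable_const_bound[of _ 1]) (use fM1 in \<open>auto intro!: AE_I2\<close>)
  have \<psi>i: "integrable M (\<psi> k)" for k by (rule integrable_const_bound[of _ 1]) (use \<psi>M1 in \<open>auto intro!: AE_I2\<close>)
  have \<psi>wi: "integrable M (window (\<psi> k) (real (N k)))" for k
    by (rule integrable_const_bound[of _ 1]) (use \<psi>w in \<open>auto intro!: AE_I2\<close>)
  have fwi: "integrable M (window f (real (N k)))" for k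
    by (rule integrable_const_bound[of _ 1]) (use fw in \<open>auto intro!: AE_I2\<close>)
  have mi: "integrable M (orbit_mean f)"
    by (rule integrable_const_bound[of _ 2]) (use orbit_mean_norm_le[OF f f1] in \<open>auto intro!: AE_I2\<close>)
  have sq: "(\<lambda>k. c * (1 / real (Suc k))) \<longlonglongrightarrow> 0" for c :: real
    using tendsto_mult_right_zero[OF LIMSEQ_inverse_real_of_nat] by (simp add: inverse_eq_divide)

  define e1 where "e1 = (\<lambda>k x. norm (f x - \<psi> k x))"
  have A1: "AE x in M. \<forall>\<eta>>0. \<exists>k. \<forall>\<^sub>F S in at_top. (LBINT s:{0..S}. e1 k (T s x)) \<le> \<eta> * S"
  proof (rule AE_small_averages)
    show "e1 k x \<le> 2" if "x \<in> space M" for k x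
      using norm_triangle_ineq4[of "f x" "\<psi> k x"] fM1[OF that] \<psi>M1[OF that, of k] by (simp add: e1_def)
    show "(\<lambda>k. \<integral>x. e1 k x \<partial>M) \<longlonglongrightarrow> 0"
    proof (rule tendsto_sandwich[OF _ _ tendsto_const sq[of 1]])
      show "\<forall>\<^sub>F k in sequentially. 0 \<le> (\<integral>x. e1 k x \<partial>M)" by (simp add: e1_def)
      show "\<forall>\<^sub>F k in sequentially. (\<integral>x. e1 k x \<partial>M) \<le> 1 * (1 / real (Suc k))"
        using \<psi>d by (auto simp: e1_def intro!: always_eventually less_imp_le simp del: of_nat_Suc)
    qed
  qed (auto simp: e1_def)

  define e2 where "e2 = (\<lambda>k x. norm (f x - orbit_mean f x - (\<psi> k x - window (\<psi> k) (real (N k)) x)))"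
  have A2: "AE x in M. \<forall>\<eta>>0. \<exists>k. \<forall>\<^sub>F S in at_top. (LBINT s:{0..S}. e2 k (T s x)) \<le> \<eta> * S"
  proof (rule AE_small_averages)
    show "e2 k \<in> borel_measurable M" for k unfolding e2_def by measurable
    show "0 \<le> e2 k x" for k x by (simp add: e2_def)
    show "e2 k x \<le> 5" if "x \<in> space M" for k x
      using norm_triangle_ineq4[of "f x - orbit_mean f x" "\<psi> k x - window (\<psi> k) (real (N k)) x"]
        norm_triangle_ineq4[of "f x" "orbit_mean f x"] norm_triangle_ineq4[of "\<psi> k x" "window (\<psi> k) (real (N k)) x"]
        fM1[OF that] \<psi>M1[OF that, of k] \<psi>w[OF that, of k] orbit_mean_norm_le[OF f f1 that] by (simp add: e2_def)
    \<comment> \<open>Three errors of size \<open>1 / (k + 1)\<close>: \<open>f - \<psi> k\<close>,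
      its window of length \<open>N k\<close>, and the window of \<open>f\<close> minus the
      mean.\<close>
    have le: "(\<integral>x. e2 k x \<partial>M) \<le> 3 * (1 / real (Suc k))" for k
    proof -
      let ?W = "\<lambda>f. window f (real (N k))"
      define g where "g = (\<lambda>x. \<psi> k x - f x)"
      have gM[measurable]: "g \<in> borel_measurable M" unfolding g_def by measurable
      have g2: "norm (g x) \<le> 2" if "x \<in> space M" for x
        using norm_triangle_ineq4[of "\<psi> k x" "f x"] fM1[OF that] \<psi>M1[OF that, of k] by (simp add: g_def)
      have gw: "?W (\<psi> k) x - ?W f x = ?W g x" if "x \<in> space M" for x
        using set_integral_diff(2)[OF orbit_integrable[OF \<psi>M \<psi>1 that] orbit_integrable[OF f f1 that], of 0 "real (N k)" k]
        unfolding window_def g_def by (simp flip: scaleR_diff_right)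
      have gi: "integrable M (?W g)"
        by (rule integrable_const_bound[of _ 2]) (use window_norm_le[OF gM g2] in \<open>auto intro!: AE_I2\<close>)
      have "(\<integral>x. e2 k x \<partial>M) \<le> (\<integral>x. norm (f x - \<psi> k x) + norm (?W g x) + norm (?W f x - orbit_mean f x) \<partial>M)"
      proof (rule integral_mono)
        show "integrable M (e2 k)" unfolding e2_def using fi \<psi>i \<psi>wi mi by simp
        show "integrable M (\<lambda>x. norm (f x - \<psi> k x) + norm (?W g x) + norm (?W f x - orbit_mean f x))"
          using fi \<psi>i gi fwi mi by simp
        fix x assume x: "x \<in> space M"
        have "f x - orbit_mean f x - (\<psi> k x - ?W (\<psi> k) x) = (f x - \<psi> k x) + ?W g x + (?W f x - orbit_mean f x)"
          using gw[OF x] by (simp add: algebra_simps)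
        then show "e2 k x \<le> norm (f x - \<psi> k x) + norm (?W g x) + norm (?W f x - orbit_mean f x)"
          unfolding e2_def by (metis (no_types, lifting) add_right_mono norm_triangle_ineq order_trans)
      qed
      also have "\<dots> = (\<integral>x. norm (f x - \<psi> k x) \<partial>M) + (\<integral>x. norm (?W g x) \<partial>M) + (\<integral>x. norm (?W f x - orbit_mean f x) \<partial>M)"
        using fi \<psi>i gi fwi mi by simp
      also have "(\<integral>x. norm (?W g x) \<partial>M) \<le> (\<integral>x. norm (g x) \<partial>M)"
        by (rule integral_norm_window_le[OF gM g2]) (use N0 in auto)
      also have "(\<integral>x. norm (g x) \<partial>M) = (\<integral>x. norm (f x - \<psi> k x) \<partial>M)"
        by (simp add: g_def norm_minus_commute)
      finally show ?thesis using \<psi>d[of k] N[of k] by linarith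
    qed
    show "(\<lambda>k. \<integral>x. e2 k x \<partial>M) \<longlonglongrightarrow> 0"
    proof (rule tendsto_sandwich[OF _ _ tendsto_const sq[of 3]])
      show "\<forall>\<^sub>F k in sequentially. 0 \<le> (\<integral>x. e2 k x \<partial>M)" by (simp add: e2_def)
      show "\<forall>\<^sub>F k in sequentially. (\<integral>x. e2 k x \<partial>M) \<le> 3 * (1 / real (Suc k))"
        using le by (intro always_eventually allI)
    qed
  qed
  from A1 A2 orbit_mean_unique_projection[OF f f1 p] AE_space
  show ?thesis
  proof eventually_elim
    case (elim x)
    note x = elim(4)
    show ?case unfolding regular_orbit_def
    proof (intro conjI allI impI)
      show "(\<lambda>s. f (T s x)) \<in> borel_measurable borel" by (rule orbit_measurable[OF f x])
      show "norm (f (T s x)) \<le> 1" for s by (rule fM1[OF flow_space[OF x]])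
    next
      fix \<eta> :: real assume "\<eta> > 0"
      then obtain k where k: "\<forall>\<^sub>F S in at_top. (LBINT s:{0..S}. e1 k (T s x)) \<le> \<eta> * S"
        using elim(1) by blast
      obtain \<psi>' where "\<forall>s. ((\<lambda>s. \<psi> k (T s x)) has_vector_derivative \<psi>' s) (at s) \<and>
          norm (\<psi>' s) \<le> 2 / (1 / real (Suc (m k)))"
        using orbit_double_window_derivative[OF f f1 x, of "1 / real (Suc (n k))" "1 / real (Suc (m k))"]
        unfolding \<psi>_def by auto
      then show "\<exists>\<psi> \<psi>' L. (\<forall>s. (\<psi> has_vector_derivative \<psi>' s) (at s) \<and> norm (\<psi> s) \<le> 1 \<and> norm (\<psi>' s) \<le> L) \<and>
          (\<forall>\<^sub>F S in at_top. (LBINT s:{0..S}. norm (f (T s x) - \<psi> s)) \<le> \<eta> * S)"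
        using k \<psi>M1[OF flow_space[OF x], of k] unfolding e1_def by blast
    next
      fix \<eta> :: real assume "\<eta> > 0"
      then obtain k where k: "\<forall>\<^sub>F S in at_top. (LBINT s:{0..S}. e2 k (T s x)) \<le> \<eta> * S"
        using elim(2) by blast
      define h where "h = (\<lambda>s. \<psi> k (T s x) - window (\<psi> k) (real (N k)) (T s x))"
      have c\<psi>: "continuous_on UNIV (\<lambda>s. \<psi> k (T s x))"
        unfolding \<psi>_def by (rule orbit_window_continuous[OF window_measurable[OF f] g1 x]) simp
      have ch: "continuous_on UNIV h"
        unfolding h_def
        by (intro continuous_on_diff c\<psi> orbit_window_continuous[OF \<psi>M \<psi>1 x]) (use N0 in auto)
      obtain G where G: "\<And>s. (G has_vector_derivative (\<psi> k (T s x) -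
            (1 / real (N k)) *\<^sub>R (LBINT v:{s..s+real (N k)}. \<psi> k (T v x)))) (at s)"
          "\<And>s. norm (G s) \<le> real (N k)"
        using oscillation_primitive[OF c\<psi> \<psi>M1[OF flow_space[OF x]], of "real (N k)"] N0[of k] by auto
      have G': "(G has_vector_derivative h s) (at s)" for s
        using G(1)[of s] unfolding h_def window_flow[OF x] .
      have h2: "norm (h s) \<le> 2" for s
        using norm_triangle_ineq4[of "\<psi> k (T s x)" "window (\<psi> k) (real (N k)) (T s x)"]
          \<psi>M1[OF flow_space[OF x], of k s] \<psi>w[OF flow_space[OF x], of k s] by (simp add: h_def)
      \<comment> \<open>The error at \<open>T s x\<close> contains
        \<open>orbit_mean f (T s x)\<close>, which equals the constant
        \<open>orbit_mean f x = p x\<close>.\<close>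
      have "\<forall>\<^sub>F S in at_top. (LBINT s:{0..S}. norm (f (T s x) - p x - h s)) \<le> \<eta> * S"
        using k elim(3) by (simp add: e2_def h_def orbit_mean_invariant[OF f f1 x])
      then show "\<exists>h G K. (\<forall>s. (G has_vector_derivative h s) (at s) \<and> norm (G s) \<le> K \<and> norm (h s) \<le> K) \<and>
          continuous_on UNIV h \<and> (\<forall>\<^sub>F S in at_top. (LBINT s:{0..S}. norm (f (T s x) - p x - h s)) \<le> \<eta> * S)"
        using G' G(2) h2 ch
        by (intro exI[of _ h] exI[of _ G] exI[of _ "max 2 (real (N k))"]) (auto simp: le_max_iff_disj)
    qed
  qed
qed

end

section \<open>Pointwise convergence\<close>

text \<open>For each fixed \<open>t\<close> the map \<open>T (b t)\<close> pulls null sets back to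
  null sets, and Fubini exchanges the two quantifiers. Thus changing a function on a null set of
  \<open>M\<close> does not alter its time integrals along almost every orbit.\<close>

lemma (in probability_flow) AE_flow_time:
  assumes P: "{x\<in>space M. P x} \<in> sets M" "AE x in M. P x" and b[measurable]: "b \<in> borel_measurable borel"
  shows "AE x in M. AE t in lborel. P (T (b t) x)"
proof -
  interpret P: pair_sigma_finite lborel M by unfold_locales
  have "AE t in lborel. AE x in M. P (T (b t) x)"
  proof (rule AE_I2)
    fix t
    have "AE x in distr M M (T (b t)). P x" using P(2) unfolding flow_distr .
    then show "AE x in M. P (T (b t) x)"
      by (subst (asm) AE_distr_iff) (use P(1) in auto)
  qed
  moreover have m: "{p \<in> space (lborel \<Otimes>\<^sub>M M). P (T (b (fst p)) (snd p))} \<in> sets (lborel \<Otimes>\<^sub>M M)"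
  proof -
    have "(\<lambda>p. T (b (fst p)) (snd p)) \<in> measurable (lborel \<Otimes>\<^sub>M M) M" by measurable
    from measurable_sets[OF this P(1)]
    have "(\<lambda>p. T (b (fst p)) (snd p)) -` {x\<in>space M. P x} \<inter> space (lborel \<Otimes>\<^sub>M M) \<in> sets (lborel \<Otimes>\<^sub>M M)" .
    also have "(\<lambda>p. T (b (fst p)) (snd p)) -` {x\<in>space M. P x} \<inter> space (lborel \<Otimes>\<^sub>M M) =
        {p \<in> space (lborel \<Otimes>\<^sub>M M). P (T (b (fst p)) (snd p))}"
      by (auto simp: space_pair_measure flow_space)
    finally show ?thesis .
  qed
  ultimately show ?thesis using P.AE_commute[OF m] by blast
qed

lemma filterlim_div_powr_at_top:
  assumes "(\<lambda>t. t powr \<delta>) \<prec> u" "\<forall>\<^sub>F t in at_top. u t \<ge> 0"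
  shows "filterlim (\<lambda>t. u t / t powr \<delta>) at_top at_top"
proof -
  have ne: "\<forall>\<^sub>F t in at_top. u t \<noteq> 0" and lim: "((\<lambda>t. t powr \<delta> / u t) \<longlongrightarrow> 0) at_top"
    using assms(1) unfolding negligible_wrt_def by auto
  have "\<forall>\<^sub>F t in at_top. 0 < t powr \<delta> / u t"
    using ne assms(2) eventually_gt_at_top[of 0] by eventually_elim auto
  from filterlim_inverse_at_top[OF lim this] show ?thesis by simp
qed

text \<open>Eventually \<open>u t \<ge> t powr \<delta> \<ge> 1\<close>, so the relation to
  \<open>v\<close> rules out \<open>v t \<le> 1\<close>, and then
  \<open>v t powr (1 - \<delta>) \<le> v t\<close>. Hence \<open>v\<close> inherits the growth of
  \<open>u\<close>, which lets the step be iterated along the chain.\<close>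

lemma growth_step:
  assumes \<delta>: "0 < \<delta>" "\<delta> < 1"
    and u: "filterlim (\<lambda>t. u t / t powr \<delta>) at_top at_top"
    and uv: "u \<prec> (\<lambda>t. v t powr (1 - \<delta>))" and v: "\<forall>\<^sub>F t in at_top. v t \<ge> 0"
  shows "filterlim (\<lambda>t. v t / t powr \<delta>) at_top at_top" and "((\<lambda>t. u t / v t) \<longlongrightarrow> 0) at_top"
proof -
  have ne: "\<forall>\<^sub>F t in at_top. v t powr (1 - \<delta>) \<noteq> 0"
    and lim: "((\<lambda>t. u t / v t powr (1 - \<delta>)) \<longlongrightarrow> 0) at_top"
    using uv unfolding negligible_wrt_def by auto
  have big: "\<forall>\<^sub>F t in at_top. u t / t powr \<delta> \<ge> 1"
    using u by (simp add: filterlim_at_top)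
  have lt1: "\<forall>\<^sub>F t in at_top. u t / v t powr (1 - \<delta>) < 1"
    by (rule order_tendstoD(2)[OF lim]) simp
  have ev: "\<forall>\<^sub>F t in at_top. 1 \<le> u t \<and> u t \<le> v t powr (1 - \<delta>) \<and> v t powr (1 - \<delta>) \<le> v t"
    using ne big lt1 v eventually_ge_at_top[of 1]
  proof eventually_elim
    case (elim t)
    have "t powr \<delta> \<ge> 1" using elim(5) \<delta> by (simp add: ge_one_powr_ge_zero)
    moreover have "t powr \<delta> \<le> u t" using elim(2,5) by (simp add: le_divide_eq)
    ultimately have u1: "1 \<le> u t" by linarith
    have "0 < v t powr (1 - \<delta>)" using elim(1) by simp
    then have uv: "u t \<le> v t powr (1 - \<delta>)" using elim(3) by (simp add: divide_less_eq)
    \<comment> \<open>If \<open>v t \<le> 1\<close>, the power is at most 1 while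
      \<open>u t \<ge> 1\<close>, so the quotient could not be below 1.\<close>
    have "v t > 1"
    proof (rule ccontr)
      assume "\<not> v t > 1"
      then have "v t powr (1 - \<delta>) \<le> 1" using elim(4) \<delta> by (intro powr_le1) auto
      then have "u t = 1" "v t powr (1 - \<delta>) = 1" using u1 uv by auto
      then show False using elim(3) by simp
    qed
    then have "v t powr (1 - \<delta>) \<le> v t powr 1" using \<delta> by (intro powr_mono) auto
    then show ?case using u1 uv \<open>v t > 1\<close> by simp
  qed
  show "filterlim (\<lambda>t. v t / t powr \<delta>) at_top at_top"
  proof (rule filterlim_at_top_mono[OF u])
    show "\<forall>\<^sub>F t in at_top. u t / t powr \<delta> \<le> v t / t powr \<delta>"
      using ev by eventually_elim (auto intro!: divide_right_mono)
  qed
  show "((\<lambda>t. u t / v t) \<longlongrightarrow> 0) at_top"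
  proof (rule tendsto_sandwich[OF _ _ tendsto_const lim])
    show "\<forall>\<^sub>F t in at_top. 0 \<le> u t / v t" using ev by eventually_elim auto
    show "\<forall>\<^sub>F t in at_top. u t / v t \<le> u t / v t powr (1 - \<delta>)"
      using ev by eventually_elim (auto intro!: divide_left_mono mult_pos_pos)
  qed
qed

text \<open>Membership in \<open>L_infinity M\<close> bounds \<open>f\<close> only almost
  everywhere, whereas the orbitwise arguments use the bound 1 at every point. Replacing
  \<open>f\<close> by 0 where it exceeds \<open>K\<close> and dividing by \<open>K\<close> repairs
  this; the projection depends only on the class of \<open>f\<close> and scales with it.\<close>

lemma projection_of_rescaled_truncation:
  assumes f: "f \<in> L_infinity M" and p: "is_orthogonal_projection M (L_two_invariant M T) f p"
  obtains K f' where "K > (0::real)" "f' \<in> borel_measurable M" "\<forall>x\<in>space M. norm (f' x) \<le> 1"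
    "AE x in M. f x = complex_of_real K * f' x"
    "is_orthogonal_projection M (L_two_invariant M T) f' (\<lambda>x. p x / complex_of_real K)"
proof -
  have fM[measurable]: "f \<in> borel_measurable M" using f by (simp add: L_infinity_def)
  obtain C where C: "AE x in M. norm (f x) \<le> C" using f by (auto simp: L_infinity_def)
  \<comment> \<open>The maximum with 1 guards against a bound \<open>C\<close> that is not
    positive.\<close>
  define K where "K = max C 1"
  have K: "K > 0" by (simp add: K_def)
  define f' where "f' = (\<lambda>x. if norm (f x) \<le> K then f x / complex_of_real K else 0)"
  have f'M[measurable]: "f' \<in> borel_measurable M" unfolding f'_def by measurable
  have eq: "AE x in M. f x = complex_of_real K * f' x"
    using C by eventually_elim (use K in \<open>auto simp: f'_def K_def\<close>)
  have pV: "p \<in> L_two_invariant M T"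
    and orth: "\<And>h. h \<in> L_two_invariant M T \<Longrightarrow> (\<integral>x. (f x - p x) * cnj (h x) \<partial>M) = 0"
    using p unfolding is_orthogonal_projection_def by auto
  have pM[measurable]: "p \<in> borel_measurable M" using pV by (simp add: L_two_invariant_def L_two_def)
  have "(\<lambda>x. p x / complex_of_real K) \<in> L_two_invariant M T"
    using pV unfolding L_two_invariant_def L_two_def
    by (auto simp: norm_divide power_divide elim!: eventually_mono)
  moreover have "(\<integral>x. (f' x - p x / complex_of_real K) * cnj (h x) \<partial>M) = 0" if h: "h \<in> L_two_invariant M T" for h
  proof -
    have [measurable]: "h \<in> borel_measurable M" using h by (simp add: L_two_invariant_def L_two_def)
    have "(\<integral>x. (f' x - p x / complex_of_real K) * cnj (h x) \<partial>M) =
        (\<integral>x. (1 / complex_of_real K) * ((f x - p x) * cnj (h x)) \<partial>M)"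
    proof (rule integral_cong_AE)
      show "AE x in M. (f' x - p x / complex_of_real K) * cnj (h x) =
          (1 / complex_of_real K) * ((f x - p x) * cnj (h x))"
        using eq by eventually_elim (use K in \<open>simp add: field_simps\<close>)
    qed measurable
    also have "\<dots> = (1 / complex_of_real K) * (\<integral>x. (f x - p x) * cnj (h x) \<partial>M)"
      by (rule integral_mult_right_zero)
    finally show ?thesis using orth[OF h] by simp
  qed
  ultimately have "is_orthogonal_projection M (L_two_invariant M T) f' (\<lambda>x. p x / complex_of_real K)"
    unfolding is_orthogonal_projection_def by blast
  then show ?thesis
    using that[OF K f'M _ eq] K by (simp add: f'_def norm_divide)
qed

text \<open>The averages start at 0, where the values of \<open>a j\<close> carry no information and
  need not be measurable. Hence Borel functions \<open>b j\<close> with the same germs are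
  integrated; they exist by \<open>hardy_field_borel_representative\<close>.\<close>

theorem theorem1p11:
  fixes H :: "germ set" and l :: nat and a :: "nat \<Rightarrow> real \<Rightarrow> real" and c \<delta> :: real
    and b :: "nat \<Rightarrow> real \<Rightarrow> real"
    and M :: "'a measure" and T :: "nat \<Rightarrow> real \<Rightarrow> 'a \<Rightarrow> 'a"
    and f f_inv :: "nat \<Rightarrow> 'a \<Rightarrow> complex"
  assumes "l \<ge> 1"
    and "hardy_field H"
    and "\<And>j. j \<in> {1..l} \<Longrightarrow> germ_of (a j) \<in> H"
    and "\<And>j t. j \<in> {1..l} \<Longrightarrow> t \<ge> c \<Longrightarrow> a j t \<ge> 0"
    and "0 < \<delta>" and "\<delta> < 1"
    and "(\<lambda>t. t powr \<delta>) \<prec> a 1"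
    and "\<And>j. j \<in> {1..<l} \<Longrightarrow> (\<lambda>t. a (j + 1) t powr \<delta>) \<prec> a j"
    and "\<And>j. j \<in> {1..<l} \<Longrightarrow> a j \<prec> (\<lambda>t. a (j + 1) t powr (1 - \<delta>))"
    and b_extends_a: "\<And>j. j \<in> {1..l} \<Longrightarrow> b j \<in> borel_measurable borel"
      "\<And>j. j \<in> {1..l} \<Longrightarrow> \<forall>\<^sub>F t in at_top. b j t = a j t"
    and "prob_space M"
    and "\<And>j. j \<in> {1..l} \<Longrightarrow> measure_preserving_flow M (T j)"
    and "\<And>j. j \<in> {1..l} \<Longrightarrow> f j \<in> L_infinity M"
    and "\<And>j. j \<in> {1..l} \<Longrightarrow>
      is_orthogonal_projection M (L_two_invariant M (T j)) (f j) (f_inv j)"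
  shows "AE x in M.
    ((\<lambda>y. (1 / y) *\<^sub>R (LBINT t:{0..y}. (\<Prod>j\<in>{1..l}. f j (T j (b j t) x))))
      \<longlongrightarrow> (\<Prod>j\<in>{1..l}. f_inv j x)) at_top"
proof -
  note H = assms(2) and \<delta> = assms(5,6)
  have nn: "\<forall>\<^sub>F t in at_top. a j t \<ge> 0" if "j \<in> {1..l}" for j
    using eventually_ge_at_top[of c] by eventually_elim (rule assms(4)[OF that])
  \<comment> \<open>The growth above \<open>t powr \<delta>\<close> starts at \<open>a 1\<close> and
    is passed up the chain.\<close>
  have grow_a: "filterlim (\<lambda>t. a j t / t powr \<delta>) at_top at_top" if "j \<in> {1..l}" for j
  proof -
    have "1 \<le> j" "j \<le> l" using that by auto
    then show ?thesis
    proof (induction j rule: dec_induct)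
      case base
      then show ?case using filterlim_div_powr_at_top[OF assms(7) nn[of 1]] by simp
    next
      case (step k)
      then show ?case using growth_step(1)[OF \<delta> _ assms(9)[of k] nn[of "k + 1"]] by simp
    qed
  qed
  have quot_step: "((\<lambda>t. a k t / a (Suc k) t) \<longlongrightarrow> 0) at_top" if "k \<in> {1..<l}" for k
    using growth_step(2)[OF \<delta> grow_a assms(9) nn[of "k + 1"]] that by simp
  have pos: "\<forall>\<^sub>F t in at_top. a j t \<noteq> 0" if "j \<in> {1..l}" for j
  proof -
    have "\<forall>\<^sub>F t in at_top. a j t / t powr \<delta> \<ge> 1"
      using grow_a[OF that] by (simp add: filterlim_at_top)
    then show ?thesis by eventually_elim auto
  qed
  \<comment> \<open>Quotients of neighbours telescope; \<open>pos\<close> permits the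
    cancellation.\<close>
  have quot_a: "((\<lambda>t. a i t / a j t) \<longlongrightarrow> 0) at_top" if "i \<in> {1..l}" "j \<in> {1..l}" "i < j" for i j
  proof -
    have "Suc i \<le> j" "j \<le> l" using that by auto
    then show ?thesis
    proof (induction j rule: dec_induct)
      case base
      then show ?case using quot_step[of i] that by simp
    next
      case (step k)
      have k: "k \<in> {1..<l}" using step by auto
      have 1: "((\<lambda>t. (a i t / a k t) * (a k t / a (Suc k) t)) \<longlongrightarrow> 0 * 0) at_top"
        by (rule tendsto_mult) (use step quot_step[OF k] in auto)
      have 2: "\<forall>\<^sub>F t in at_top. (a i t / a k t) * (a k t / a (Suc k) t) = a i t / a (Suc k) t"
        using pos[of k] k by (auto elim!: eventually_mono)
      show ?case using Lim_transform_eventually[OF 1 2] by simp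
    qed
  qed
  have germ_b: "germ_of (b j) \<in> H" if "j \<in> {1..l}" for j
    using assms(3)[OF that] b_extends_a(2)[OF that] by (metis germ_of_eq_iff)
  have grow_b: "filterlim (\<lambda>t. b j t / t powr \<delta>) at_top at_top" if "j \<in> {1..l}" for j
  proof -
    have "\<forall>\<^sub>F t in at_top. b j t / t powr \<delta> = a j t / t powr \<delta>"
      using b_extends_a(2)[OF that] by eventually_elim simp
    from filterlim_cong[OF refl refl this] show ?thesis using grow_a[OF that] by simp
  qed
  have quot_b: "((\<lambda>t. b i t / b j t) \<longlongrightarrow> 0) at_top" if "i \<in> {1..l}" "j \<in> {1..l}" "i < j" for i j
  proof -
    have "\<forall>\<^sub>F t in at_top. b i t / b j t = a i t / a j t"
      using b_extends_a(2)[OF that(1)] b_extends_a(2)[OF that(2)] by eventually_elim simp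
    from tendsto_cong[OF this] show ?thesis using quot_a[OF that] by simp
  qed
  have "\<exists>b'. germ_of b' \<in> H \<and> time_change (b j) b'" if "j \<in> {1..l}" for j
    by (rule hardy_field_time_change[OF H germ_b[OF that] \<delta>(1) grow_b[OF that]]) blast
  then obtain b' where b': "\<And>j. j \<in> {1..l} \<Longrightarrow> germ_of (b' j) \<in> H \<and> time_change (b j) (b' j)"
    by metis
  have slow: "((\<lambda>t. b' i t / b' j t) \<longlongrightarrow> 0) at_top" if "i \<in> {1..l}" "j \<in> {1..l}" "i < j" for i j
    using hardy_field_derivative_quotient_tendsto_0[OF H] b' quot_b that by blast

  have pf: "probability_flow M (T j)" if "j \<in> {1..l}" for j
    using assms(12) assms(13)[OF that] by (simp add: probability_flow_def probability_flow_axioms_def)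
  define Q where "Q = (\<lambda>j K f'. K > (0::real) \<and> f' \<in> borel_measurable M \<and> (\<forall>x\<in>space M. norm (f' x) \<le> 1) \<and>
    (AE x in M. f j x = complex_of_real K * f' x) \<and>
    is_orthogonal_projection M (L_two_invariant M (T j)) f' (\<lambda>x. f_inv j x / complex_of_real K))"
  have "\<exists>K f'. Q j K f'" if "j \<in> {1..l}" for j
    unfolding Q_def
    by (rule projection_of_rescaled_truncation[OF assms(14)[OF that] assms(15)[OF that]]) blast
  then obtain K f' where Q: "\<And>j. j \<in> {1..l} \<Longrightarrow> Q j (K j) (f' j)" by metis
  have K: "K j > 0" and f'M: "f' j \<in> borel_measurable M" and f'1: "\<forall>x\<in>space M. norm (f' j x) \<le> 1"
    and f'eq: "AE x in M. f j x = complex_of_real (K j) * f' j x"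
    and f'p: "is_orthogonal_projection M (L_two_invariant M (T j)) (f' j) (\<lambda>x. f_inv j x / complex_of_real (K j))"
    if "j \<in> {1..l}" for j
    using Q[OF that] unfolding Q_def by auto
  have fM: "f j \<in> borel_measurable M" if "j \<in> {1..l}" for j
    using assms(14)[OF that] by (simp add: L_infinity_def)

  have reg: "AE x in M. \<forall>j\<in>{1..l}. regular_orbit (\<lambda>s. f' j (T j s x)) (f_inv j x / complex_of_real (K j))"
    by (rule AE_finite_allI) (simp, rule probability_flow.AE_regular_orbit[OF pf f'M f'1 f'p])
  \<comment> \<open>Almost every orbit meets the set where \<open>f j\<close> differs from its
    rescaled truncation only at a null set of times \<open>t\<close>, so the integrals below agree
    exactly.\<close>
  have tim: "AE x in M. \<forall>j\<in>{1..l}. AE t in lborel.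
      f j (T j (b j t) x) = complex_of_real (K j) * f' j (T j (b j t) x)"
  proof (rule AE_finite_allI)
    fix j assume j: "j \<in> {1..l}"
    note [measurable] = fM[OF j] f'M[OF j]
    show "AE x in M. AE t in lborel. f j (T j (b j t) x) = complex_of_real (K j) * f' j (T j (b j t) x)"
      by (rule probability_flow.AE_flow_time[OF pf[OF j] _ f'eq[OF j] b_extends_a(1)[OF j]]) measurable
  qed simp
  from reg tim AE_space show ?thesis
  proof eventually_elim
    case (elim x)
    define z where "z = (\<lambda>j t. f' j (T j (b j t) x))"
    have lim: "((\<lambda>y. (1 / y) *\<^sub>R (LBINT t:{0..y}. \<Prod>j\<in>{1..l}. z j t)) \<longlongrightarrow>
        (\<Prod>j\<in>{1..l}. f_inv j x / complex_of_real (K j))) at_top"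
      unfolding z_def
      by (rule average_prod_tendsto[where b' = b' and \<phi> = "\<lambda>j s. f' j (T j s x)"])
        (use b_extends_a(1) b' slow elim(1) in blast)+
    have orb: "(\<lambda>t. g (T j (b j t) x)) \<in> borel_measurable borel"
      if "j \<in> {1..l}" "g \<in> borel_measurable M" for j and g :: "'a \<Rightarrow> complex"
      by (rule measurable_compose[OF b_extends_a(1)[OF that(1)]])
        (rule probability_flow.orbit_measurable[OF pf[OF that(1)] that(2) elim(3)])
    have eq: "(LBINT t:{0..y}. (\<Prod>j\<in>{1..l}. f j (T j (b j t) x))) =
        (\<Prod>j\<in>{1..l}. complex_of_real (K j)) * (LBINT t:{0..y}. \<Prod>j\<in>{1..l}. z j t)" for y
    proof -
      have "(LBINT t:{0..y}. (\<Prod>j\<in>{1..l}. f j (T j (b j t) x))) =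
          (LBINT t:{0..y}. (\<Prod>j\<in>{1..l}. complex_of_real (K j)) * (\<Prod>j\<in>{1..l}. z j t))"
        unfolding set_lebesgue_integral_def
      proof (rule integral_cong_AE)
        have 1: "(\<lambda>t. \<Prod>j\<in>{1..l}. f j (T j (b j t) x)) \<in> borel_measurable borel"
          by (intro borel_measurable_prod orb fM)
        then show "(\<lambda>t. indicator {0..y} t *\<^sub>R (\<Prod>j\<in>{1..l}. f j (T j (b j t) x))) \<in> borel_measurable lborel"
          by measurable
        have 2: "(\<lambda>t. \<Prod>j\<in>{1..l}. z j t) \<in> borel_measurable borel"
          unfolding z_def by (intro borel_measurable_prod orb f'M)
        then show "(\<lambda>t. indicator {0..y} t *\<^sub>R ((\<Prod>j\<in>{1..l}. complex_of_real (K j)) * (\<Prod>j\<in>{1..l}. z j t)))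
            \<in> borel_measurable lborel"
          by measurable
        have "AE t in lborel. \<forall>j\<in>{1..l}. f j (T j (b j t) x) = complex_of_real (K j) * z j t"
          unfolding z_def by (rule AE_finite_allI) (use elim(2) in auto)
        then show "AE t in lborel. indicator {0..y} t *\<^sub>R (\<Prod>j\<in>{1..l}. f j (T j (b j t) x)) =
            indicator {0..y} t *\<^sub>R ((\<Prod>j\<in>{1..l}. complex_of_real (K j)) * (\<Prod>j\<in>{1..l}. z j t))"
          by eventually_elim (simp add: prod.distrib)
      qed
      then show ?thesis by simp
    qed
    have "((\<lambda>y. (\<Prod>j\<in>{1..l}. complex_of_real (K j)) * ((1 / y) *\<^sub>R (LBINT t:{0..y}. \<Prod>j\<in>{1..l}. z j t))) \<longlongrightarrow>
        (\<Prod>j\<in>{1..l}. complex_of_real (K j)) * (\<Prod>j\<in>{1..l}. f_inv j x / complex_of_real (K j))) at_top"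
      by (rule tendsto_mult_left[OF lim])
    moreover have "(\<Prod>j\<in>{1..l}. complex_of_real (K j)) * (\<Prod>j\<in>{1..l}. f_inv j x / complex_of_real (K j)) =
        (\<Prod>j\<in>{1..l}. f_inv j x)"
      unfolding prod.distrib[symmetric]
    proof (rule prod.cong)
      show "complex_of_real (K j) * (f_inv j x / complex_of_real (K j)) = f_inv j x" if "j \<in> {1..l}" for j
        using K[OF that] by simp
    qed simp
    ultimately show ?case unfolding eq by (simp add: mult_scaleR_right)
  qed
qed

end
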